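(* The bi-monotone product $\check{\bowtie}$ of linear functionals on two-faced algebras is a positive $(1,2)$-u.a.u. product, i.e. for all linear functionals $\varphi_i\colon A_i\to\mathbb C$ on two-faced algebras $A_i$ ($i=1,2,3$) and all two-faced algebra homomorphisms $j_i\colon B_i\to A_i$ ($i=1,2$) between two-faced algebras the following hold: \begin{itemize} \item $(\varphi_1\mathbin{\check{\bowtie}}\varphi_2)\circ\iota_1=\varphi_1$ and $(\varphi_1\mathbin{\check{\bowtie}}\varphi_2)\circ\iota_2=\varphi_2$, where $\iota_i\colon A_i\hookrightarrow A_1\sqcup A_2$ is the canonical embedding; \item $(\varphi_1\mathbin{\check{\bowtie}}\varphi_2)\mathbin{\check{\bowtie}}\varphi_3=\varphi_1\mathbin{\check{\bowtie}}(\varphi_2\mathbin{\check{\bowtie}}\varphi_3)$ (under the canonical identification $(A_1\sqcup A_2)\sqcup A_3=A_1\sqcup(A_2\sqcup A_3)$); \item $(\varphi_1\mathbin{\check{\bowtie}}\varphi_2)\circ(j_1\mathbin{\underline{\sqcup}}j_2)=(\varphi_1\circ j_1)\mathbin{\check{\bowtie}}(\varphi_2\circ j_2)$, where $j_1\mathbin{\underline{\sqcup}}j_2:=(\iota_1\circ j_1)\sqcup(\iota_2\circ j_2)\colon B_1\sqcup B_2\to A_1\sqcup A_2$; \item if $A_1,A_2$ are two-faced $*$-algebras and $\widetilde\varphi_1,\widetilde\varphi_2$ are states on $\widetilde A_1,\widetilde A_2$ respectively, then $\widetilde{\varphi_1\mathbin{\check{\bowtie}}\varphi_2}$ is a state on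 $\widetilde A_1\sqcup_1\widetilde A_2$. \end{itemize}
   Context: Algebras are complex and associative, not necessarily unital. $\sqcup$ denotes the free product of (not necessarily unital) algebras, i.e. the coproduct without identification of units, and $\sqcup_1$ the free product of unital algebras with units identified. For homomorphisms $f_i\colon B_i\to C$, $f_1\sqcup f_2\colon B_1\sqcup B_2\to C$ is the homomorphism restricting to $f_i$ on $B_i$. A two-faced algebra is an algebra $A$ with two subalgebras $A^{\mathfrak l}$ (left face) and $A^{\mathfrak r}$ (right face) such that the canonical map $A^{\mathfrak l}\sqcup A^{\mathfrak r}\to A$ is an isomorphism; a two-faced $*$-algebra is the same with $A$ a $*$-algebra and the faces $*$-subalgebras. The free product $A_1\sqcup A_2$ of two-faced algebras is two-faced with faces $A_1^{\mathfrak l}\sqcup A_2^{\mathfrak l}$ and $A_1^{\mathfrak r}\sqcup A_2^{\mathfrak r}$. A two-faced algebra homomorphism $j\colon B\to A$ is an algebra homomorphism with $j(B^{\mathfrak l})\subset A^{\mathfrak l}$ and $j(B^{\mathfrak r})\subset A^{\mathfrak r}$. $\widetilde A=\mathbb C1\oplus A$ is the unitization of $A$ (a new unit is adjoined), and for a linear functional $\varphi$ on $A$, $\widetilde\varphi$ is its extension to $\widetilde A$ with $\widetilde\varphi(1)=1$. One identifies $\widetilde{A_1\sqcup A_2}=\widetilde A_1\sqcup_1\widetilde A_2$. Bi-monotone product of linear functionals: a pointed representation of an algebra $A$ on a vector space $\widetilde V=\mathbb C\Omega\oplus V$ (with this fixed decomposition, $\Omega\neq0$) is a homomorphism $\pi\colon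 A\to L(\widetilde V)$ to the linear operators on $\widetilde V$; $P$ denotes the projection onto $\mathbb C\Omega$ along $V$. Every linear functional $\varphi$ on $A$ admits such a $\pi$ with $\varphi(a)\Omega=P\pi(a)\Omega$ for all $a\in A$. Given $\pi_i$ on $\widetilde V_i=\mathbb C\Omega_i\oplus V_i$ for two-faced algebras $A_i$, $i=1,2$, the pointed representation $\pi_1\bowtie\pi_2$ of $A_1\sqcup A_2$ on $\widetilde V_1\otimes\widetilde V_2=\mathbb C(\Omega_1\otimes\Omega_2)\oplus\bigl((\Omega_1\otimes V_2)\oplus(V_1\otimes\Omega_2)\oplus(V_1\otimes V_2)\bigr)$ is the homomorphism determined by $$\pi_1\bowtie\pi_2(a)=\begin{cases}\pi_1(a)\otimes\mathrm{id}& a\in A_1^{\mathfrak l}\\ \pi_1(a)\otimes P& a\in A_1^{\mathfrak r}\\ \mathrm{id}\otimes\pi_2(a)& a\in A_2^{\mathfrak r}\\ P\otimes\pi_2(a)& a\in A_2^{\mathfrak l}.\end{cases}$$ If $\varphi_i(a)\Omega_i=P\pi_i(a)\Omega_i$ for all $a\in A_i$, then $\varphi_1\mathbin{\check{\bowtie}}\varphi_2$ is the linear functional on $A_1\sqcup A_2$ defined by $(\varphi_1\mathbin{\check{\bowtie}}\varphi_2)(a)\,\Omega=P(\pi_1\bowtie\pi_2)(a)\Omega$ with $\Omega=\Omega_1\otimes\Omega_2$; it does not depend on the choice of $\pi_1,\pi_2$. *)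

theory Defs
  imports Complex_Main "HOL-Library.Nonpos_Ints"
begin

section \<open>Complex vector spaces and (not necessarily unital) complex algebras\<close>

class scaleC =
  fixes scaleC :: "complex \<Rightarrow> 'a \<Rightarrow> 'a" (infixr \<open>*\<^sub>C\<close> 75)

class complex_vector = scaleC + ab_group_add +
  assumes scaleC_add_right: "a *\<^sub>C (x + y) = a *\<^sub>C x + a *\<^sub>C y"
    and scaleC_add_left: "(a + b) *\<^sub>C x = a *\<^sub>C x + b *\<^sub>C x"
    and scaleC_scaleC: "a *\<^sub>C b *\<^sub>C x = (a * b) *\<^sub>C x"
    and scaleC_one: "1 *\<^sub>C x = x"

class complex_algebra = complex_vector + ring +
  assumes mult_scaleC_left: "(a *\<^sub>C x) * y = a *\<^sub>C (x * y)"
    and mult_scaleC_right: "x * (a *\<^sub>C y) = a *\<^sub>C (x * y)"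

text \<open>\<open>1 \<noteq> 0\<close> is not required.\<close>

class complex_unital_algebra = complex_algebra + monoid_mult

instantiation complex :: complex_unital_algebra
begin
definition scaleC_complex_def [simp]: "a *\<^sub>C (z::complex) = a * z"
instance by standard (simp_all add: algebra_simps)
end

global_interpretation cvs: vector_space "scaleC :: complex \<Rightarrow> 'a \<Rightarrow> 'a::complex_vector"
  by unfold_locales (simp_all add: scaleC_add_right scaleC_add_left scaleC_scaleC scaleC_one)

abbreviation clinear :: "('a::complex_vector \<Rightarrow> 'b::complex_vector) \<Rightarrow> bool" where
  "clinear \<equiv> Vector_Spaces.linear scaleC scaleC"

definition alg_hom :: "('a::complex_algebra \<Rightarrow> 'b::complex_algebra) \<Rightarrow> bool" where
  "alg_hom f \<longleftrightarrow> clinear f \<and> (\<forall>x y. f (x * y) = f x * f y)"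

definition subalgebra :: "'a::complex_algebra set \<Rightarrow> bool" where
  "subalgebra S \<longleftrightarrow> cvs.subspace S \<and> (\<forall>x\<in>S. \<forall>y\<in>S. x * y \<in> S)"

definition is_star :: "('a::complex_algebra \<Rightarrow> 'a) \<Rightarrow> bool" where
  "is_star st \<longleftrightarrow> (\<forall>x y. st (x + y) = st x + st y) \<and> (\<forall>c x. st (c *\<^sub>C x) = cnj c *\<^sub>C st x)
     \<and> (\<forall>x y. st (x * y) = st y * st x) \<and> (\<forall>x. st (st x) = x)"

definition is_state :: "('a::complex_unital_algebra \<Rightarrow> 'a) \<Rightarrow> ('a \<Rightarrow> complex) \<Rightarrow> bool" where
  "is_state st \<psi> \<longleftrightarrow> clinear \<psi> \<and> \<psi> 1 = 1 \<and> (\<forall>x. \<psi> (st x * x) \<in> \<real>\<^sub>\<ge>\<^sub>0)"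

lemma clinear_iff:
  "clinear f \<longleftrightarrow> (\<forall>x y. f (x + y) = f x + f y) \<and> (\<forall>c x. f (c *\<^sub>C x) = c *\<^sub>C f x)"
proof
  assume "clinear f"
  then interpret Vector_Spaces.linear scaleC scaleC f .
  show "(\<forall>x y. f (x + y) = f x + f y) \<and> (\<forall>c x. f (c *\<^sub>C x) = c *\<^sub>C f x)"
    by (simp add: add scale)
next
  assume "(\<forall>x y. f (x + y) = f x + f y) \<and> (\<forall>c x. f (c *\<^sub>C x) = c *\<^sub>C f x)"
  then show "clinear f" by unfold_locales auto
qed

lemma clinear_add: "clinear f \<Longrightarrow> f (x + y) = f x + f y"
  and clinear_scale: "clinear f \<Longrightarrow> f (c *\<^sub>C x) = c *\<^sub>C f x"
  by (simp_all add: clinear_iff)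

lemma clinear_0: "clinear f \<Longrightarrow> f 0 = 0"
  using clinear_scale[of f 0 0] by simp

lemma alg_hom_iff:
  "alg_hom f \<longleftrightarrow> (\<forall>x y. f (x + y) = f x + f y) \<and> (\<forall>c x. f (c *\<^sub>C x) = c *\<^sub>C f x)
     \<and> (\<forall>x y. f (x * y) = f x * f y)"
  by (auto simp: alg_hom_def clinear_iff)

lemma alg_hom_id: "alg_hom id"
  by (simp add: alg_hom_iff)

lemma alg_hom_comp: "alg_hom f \<Longrightarrow> alg_hom g \<Longrightarrow> alg_hom (f \<circ> g)"
  by (simp add: alg_hom_iff)

lemma alg_hom_0: "alg_hom f \<Longrightarrow> f 0 = 0"
  by (simp add: alg_hom_def clinear_0)


section \<open>Free products\<close>

text \<open>
  Free products are presented as term algebras modulo the congruence generated by the axioms of an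
  algebra and by the requirement that the two embeddings are homomorphisms.  The carrier sets
  \<open>S\<close> and \<open>T\<close> allow for free products of subalgebras of types.  The relation \<open>E\<close> lists pairs of
  elements to be identified in addition: \<open>E = {}\<close> yields the free product \<open>S \<squnion> T\<close> of not
  necessarily unital algebras, \<open>E = {(1, 1)}\<close> yields the unital free product \<open>S \<squnion>\<^sub>1 T\<close>.
\<close>

datatype (leaves1: 'a, leaves2: 'b) fp_term =
    Leaf1 'a
  | Leaf2 'b
  | TZero
  | TPlus "('a, 'b) fp_term" "('a, 'b) fp_term"
  | TScale complex "('a, 'b) fp_term"
  | TMult "('a, 'b) fp_term" "('a, 'b) fp_term"

definition fp_terms :: "'a set \<Rightarrow> 'b set \<Rightarrow> ('a, 'b) fp_term set" where
  "fp_terms S T = {t. leaves1 t \<subseteq> S \<and> leaves2 t \<subseteq> T}"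

inductive fp_rel :: "'a::complex_algebra set \<Rightarrow> 'b::complex_algebra set \<Rightarrow> ('a \<times> 'b) set
    \<Rightarrow> ('a, 'b) fp_term \<Rightarrow> ('a, 'b) fp_term \<Rightarrow> bool" for S T E where
  refl: "s \<in> fp_terms S T \<Longrightarrow> fp_rel S T E s s"
| sym: "fp_rel S T E s t \<Longrightarrow> fp_rel S T E t s"
| trans: "fp_rel S T E s t \<Longrightarrow> fp_rel S T E t u \<Longrightarrow> fp_rel S T E s u"
| plus_cong: "fp_rel S T E s s' \<Longrightarrow> fp_rel S T E t t' \<Longrightarrow> fp_rel S T E (TPlus s t) (TPlus s' t')"
| scale_cong: "fp_rel S T E s s' \<Longrightarrow> fp_rel S T E (TScale c s) (TScale c s')"
| mult_cong: "fp_rel S T E s s' \<Longrightarrow> fp_rel S T E t t' \<Longrightarrow> fp_rel S T E (TMult s t) (TMult s' t')"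
| plus_assoc: "s \<in> fp_terms S T \<Longrightarrow> t \<in> fp_terms S T \<Longrightarrow> u \<in> fp_terms S T \<Longrightarrow>
    fp_rel S T E (TPlus (TPlus s t) u) (TPlus s (TPlus t u))"
| plus_comm: "s \<in> fp_terms S T \<Longrightarrow> t \<in> fp_terms S T \<Longrightarrow> fp_rel S T E (TPlus s t) (TPlus t s)"
| plus_zero: "s \<in> fp_terms S T \<Longrightarrow> fp_rel S T E (TPlus TZero s) s"
| plus_minus: "s \<in> fp_terms S T \<Longrightarrow> fp_rel S T E (TPlus (TScale (-1) s) s) TZero"
| scale_plus: "s \<in> fp_terms S T \<Longrightarrow> t \<in> fp_terms S T \<Longrightarrow>
    fp_rel S T E (TScale c (TPlus s t)) (TPlus (TScale c s) (TScale c t))"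
| plus_scale: "s \<in> fp_terms S T \<Longrightarrow>
    fp_rel S T E (TScale (c + d) s) (TPlus (TScale c s) (TScale d s))"
| scale_scale: "s \<in> fp_terms S T \<Longrightarrow> fp_rel S T E (TScale c (TScale d s)) (TScale (c * d) s)"
| scale_one: "s \<in> fp_terms S T \<Longrightarrow> fp_rel S T E (TScale 1 s) s"
| mult_assoc: "s \<in> fp_terms S T \<Longrightarrow> t \<in> fp_terms S T \<Longrightarrow> u \<in> fp_terms S T \<Longrightarrow>
    fp_rel S T E (TMult (TMult s t) u) (TMult s (TMult t u))"
| mult_plus: "s \<in> fp_terms S T \<Longrightarrow> t \<in> fp_terms S T \<Longrightarrow> u \<in> fp_terms S T \<Longrightarrow>
    fp_rel S T E (TMult s (TPlus t u)) (TPlus (TMult s t) (TMult s u))"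
| plus_mult: "s \<in> fp_terms S T \<Longrightarrow> t \<in> fp_terms S T \<Longrightarrow> u \<in> fp_terms S T \<Longrightarrow>
    fp_rel S T E (TMult (TPlus s t) u) (TPlus (TMult s u) (TMult t u))"
| scale_mult: "s \<in> fp_terms S T \<Longrightarrow> t \<in> fp_terms S T \<Longrightarrow>
    fp_rel S T E (TMult (TScale c s) t) (TScale c (TMult s t))"
| mult_scale: "s \<in> fp_terms S T \<Longrightarrow> t \<in> fp_terms S T \<Longrightarrow>
    fp_rel S T E (TMult s (TScale c t)) (TScale c (TMult s t))"
| leaf1_plus: "a \<in> S \<Longrightarrow> a' \<in> S \<Longrightarrow> a + a' \<in> S \<Longrightarrow>
    fp_rel S T E (Leaf1 (a + a')) (TPlus (Leaf1 a) (Leaf1 a'))"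
| leaf1_scale: "a \<in> S \<Longrightarrow> c *\<^sub>C a \<in> S \<Longrightarrow> fp_rel S T E (Leaf1 (c *\<^sub>C a)) (TScale c (Leaf1 a))"
| leaf1_mult: "a \<in> S \<Longrightarrow> a' \<in> S \<Longrightarrow> a * a' \<in> S \<Longrightarrow>
    fp_rel S T E (Leaf1 (a * a')) (TMult (Leaf1 a) (Leaf1 a'))"
| leaf2_plus: "b \<in> T \<Longrightarrow> b' \<in> T \<Longrightarrow> b + b' \<in> T \<Longrightarrow>
    fp_rel S T E (Leaf2 (b + b')) (TPlus (Leaf2 b) (Leaf2 b'))"
| leaf2_scale: "b \<in> T \<Longrightarrow> c *\<^sub>C b \<in> T \<Longrightarrow> fp_rel S T E (Leaf2 (c *\<^sub>C b)) (TScale c (Leaf2 b))"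
| leaf2_mult: "b \<in> T \<Longrightarrow> b' \<in> T \<Longrightarrow> b * b' \<in> T \<Longrightarrow>
    fp_rel S T E (Leaf2 (b * b')) (TMult (Leaf2 b) (Leaf2 b'))"
| identify: "(a, b) \<in> E \<Longrightarrow> a \<in> S \<Longrightarrow> b \<in> T \<Longrightarrow> fp_rel S T E (Leaf1 a) (Leaf2 b)"

primrec fp_eval :: "('a \<Rightarrow> 'c::complex_algebra) \<Rightarrow> ('b \<Rightarrow> 'c) \<Rightarrow> ('a, 'b) fp_term \<Rightarrow> 'c" where
  "fp_eval f g (Leaf1 a) = f a"
| "fp_eval f g (Leaf2 b) = g b"
| "fp_eval f g TZero = 0"
| "fp_eval f g (TPlus s t) = fp_eval f g s + fp_eval f g t"
| "fp_eval f g (TScale c s) = c *\<^sub>C fp_eval f g s"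
| "fp_eval f g (TMult s t) = fp_eval f g s * fp_eval f g t"

primrec fp_term_star :: "('a \<Rightarrow> 'a) \<Rightarrow> ('b \<Rightarrow> 'b) \<Rightarrow> ('a, 'b) fp_term \<Rightarrow> ('a, 'b) fp_term" where
  "fp_term_star f g (Leaf1 a) = Leaf1 (f a)"
| "fp_term_star f g (Leaf2 b) = Leaf2 (g b)"
| "fp_term_star f g TZero = TZero"
| "fp_term_star f g (TPlus s t) = TPlus (fp_term_star f g s) (fp_term_star f g t)"
| "fp_term_star f g (TScale c s) = TScale (cnj c) (fp_term_star f g s)"
| "fp_term_star f g (TMult s t) = TMult (fp_term_star f g t) (fp_term_star f g s)"

lemma fp_terms_simps [simp]:
  "Leaf1 a \<in> fp_terms S T \<longleftrightarrow> a \<in> S" "Leaf2 b \<in> fp_terms S T \<longleftrightarrow> b \<in> T"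
  "TZero \<in> fp_terms S T"
  "TPlus s t \<in> fp_terms S T \<longleftrightarrow> s \<in> fp_terms S T \<and> t \<in> fp_terms S T"
  "TScale c s \<in> fp_terms S T \<longleftrightarrow> s \<in> fp_terms S T"
  "TMult s t \<in> fp_terms S T \<longleftrightarrow> s \<in> fp_terms S T \<and> t \<in> fp_terms S T"
  "s \<in> fp_terms UNIV UNIV"
  by (auto simp: fp_terms_def)

lemma fp_rel_terms: "fp_rel S T E s t \<Longrightarrow> s \<in> fp_terms S T \<and> t \<in> fp_terms S T"
  by (induction rule: fp_rel.induct) auto

lemma equivp_fp_rel: "equivp (fp_rel UNIV UNIV E)"
  by (intro equivpI reflpI sympI transpI) (auto intro: fp_rel.intros)

lemma fp_eval_rel:
  assumes "alg_hom f" "alg_hom g" "\<And>a b. (a, b) \<in> E \<Longrightarrow> f a = g b" "fp_rel S T E s t"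
  shows "fp_eval f g s = fp_eval f g t"
  using assms(4)
proof (induction rule: fp_rel.induct)
  case (plus_minus s)
  have "(-1) *\<^sub>C x + x = 0" for x :: 'c
    using scaleC_add_left[of "-1" 1 x] by (simp add: scaleC_one)
  then show ?case by simp
qed (use assms(1-3) in \<open>auto simp: alg_hom_iff algebra_simps scaleC_add_right scaleC_add_left
    scaleC_scaleC scaleC_one mult_scaleC_left mult_scaleC_right\<close>)

lemma fp_eval_hom: "alg_hom h \<Longrightarrow> h (fp_eval f g t) = fp_eval (h \<circ> f) (h \<circ> g) t"
  by (induction t) (auto simp: alg_hom_iff alg_hom_0)

lemma fp_eval_cong_terms:
  assumes "t \<in> fp_terms S T" "\<And>a. a \<in> S \<Longrightarrow> f a = f' a" "\<And>b. b \<in> T \<Longrightarrow> g b = g' b"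
  shows "fp_eval f g t = fp_eval f' g' t"
  using assms by (induction t) auto


subsection \<open>The free product of algebras\<close>

quotient_type (overloaded) ('a, 'b) free_prod =
    "('a::complex_algebra, 'b::complex_algebra) fp_term" / "fp_rel UNIV UNIV {}"
  by (rule equivp_fp_rel)

instantiation free_prod :: (complex_algebra, complex_algebra) complex_algebra
begin

lift_definition zero_free_prod :: "('a, 'b) free_prod" is TZero .
lift_definition plus_free_prod :: "('a, 'b) free_prod \<Rightarrow> ('a, 'b) free_prod \<Rightarrow> ('a, 'b) free_prod"
  is TPlus by (rule fp_rel.plus_cong)
lift_definition scaleC_free_prod :: "complex \<Rightarrow> ('a, 'b) free_prod \<Rightarrow> ('a, 'b) free_prod"
  is TScale by (rule fp_rel.scale_cong)
lift_definition times_free_prod :: "('a, 'b) free_prod \<Rightarrow> ('a, 'b) free_prod \<Rightarrow> ('a, 'b) free_prod"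
  is TMult by (rule fp_rel.mult_cong)
definition uminus_free_prod :: "('a, 'b) free_prod \<Rightarrow> ('a, 'b) free_prod"
  where "- x = (-1) *\<^sub>C x" for x :: "('a, 'b) free_prod"
definition minus_free_prod :: "('a, 'b) free_prod \<Rightarrow> ('a, 'b) free_prod \<Rightarrow> ('a, 'b) free_prod"
  where "x - y = x + (- y)" for x :: "('a, 'b) free_prod"

instance
proof
  fix x y z :: "('a, 'b) free_prod" and c d :: complex
  show "x + y + z = x + (y + z)" by transfer (simp add: fp_rel.plus_assoc)
  show "x + y = y + x" by transfer (simp add: fp_rel.plus_comm)
  show "0 + x = x" by transfer (simp add: fp_rel.plus_zero)
  show "- x + x = 0" unfolding uminus_free_prod_def by transfer (simp add: fp_rel.plus_minus)
  show "x - y = x + - y" by (rule minus_free_prod_def)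
  show "c *\<^sub>C (x + y) = c *\<^sub>C x + c *\<^sub>C y" by transfer (simp add: fp_rel.scale_plus)
  show "(c + d) *\<^sub>C x = c *\<^sub>C x + d *\<^sub>C x" by transfer (simp add: fp_rel.plus_scale)
  show "c *\<^sub>C d *\<^sub>C x = (c * d) *\<^sub>C x" by transfer (simp add: fp_rel.scale_scale)
  show "1 *\<^sub>C x = x" by transfer (simp add: fp_rel.scale_one)
  show "x * y * z = x * (y * z)" by transfer (simp add: fp_rel.mult_assoc)
  show "(x + y) * z = x * z + y * z" by transfer (simp add: fp_rel.plus_mult)
  show "x * (y + z) = x * y + x * z" by transfer (simp add: fp_rel.mult_plus)
  show "(c *\<^sub>C x) * y = c *\<^sub>C (x * y)" by transfer (simp add: fp_rel.scale_mult)
  show "x * (c *\<^sub>C y) = c *\<^sub>C (x * y)" by transfer (simp add: fp_rel.mult_scale)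
qed

end

lift_definition in1 :: "'a \<Rightarrow> ('a::complex_algebra, 'b::complex_algebra) free_prod" is Leaf1 .
lift_definition in2 :: "'b \<Rightarrow> ('a::complex_algebra, 'b::complex_algebra) free_prod" is Leaf2 .

text \<open>The homomorphism \<open>f \<squnion> g\<close>, independent of the representative if \<open>f\<close> and \<open>g\<close> are homomorphisms.\<close>

definition fp_lift :: "('a \<Rightarrow> 'c) \<Rightarrow> ('b \<Rightarrow> 'c)
    \<Rightarrow> ('a::complex_algebra, 'b::complex_algebra) free_prod \<Rightarrow> 'c::complex_algebra" where
  "fp_lift f g x = fp_eval f g (rep_free_prod x)"

definition fp_map :: "('a::complex_algebra \<Rightarrow> 'c::complex_algebra) \<Rightarrow>
    ('b::complex_algebra \<Rightarrow> 'd::complex_algebra) \<Rightarrow> ('a, 'b) free_prod \<Rightarrow> ('c, 'd) free_prod" where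
  "fp_map f g = fp_lift (in1 \<circ> f) (in2 \<circ> g)"

definition fp_assoc :: "(('a::complex_algebra, 'b::complex_algebra) free_prod, 'c::complex_algebra) free_prod
    \<Rightarrow> ('a, ('b, 'c) free_prod) free_prod" where
  "fp_assoc = fp_lift (fp_lift in1 (in2 \<circ> in1)) (in2 \<circ> in2)"

text \<open>
  For subalgebras \<open>S\<close> and \<open>T\<close>, \<open>fp_sub S T\<close> is the copy of \<open>S \<squnion> T\<close> in the free product, i.e. the image
  of the canonical homomorphism.
\<close>

definition fp_sub :: "'a::complex_algebra set \<Rightarrow> 'b::complex_algebra set \<Rightarrow> ('a, 'b) free_prod set" where
  "fp_sub S T = abs_free_prod ` fp_terms S T"

lemma alg_hom_in1: "alg_hom in1" and alg_hom_in2: "alg_hom in2"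
  unfolding alg_hom_iff
  by (intro conjI allI; transfer; simp add: fp_rel.leaf1_plus fp_rel.leaf1_scale fp_rel.leaf1_mult
      fp_rel.leaf2_plus fp_rel.leaf2_scale fp_rel.leaf2_mult)+

lemma abs_free_prod_eval: "abs_free_prod t = fp_eval in1 in2 t"
  by (induction t) (simp_all add: in1.abs_eq in2.abs_eq zero_free_prod.abs_eq
      flip: plus_free_prod.abs_eq scaleC_free_prod.abs_eq times_free_prod.abs_eq)

lemma fp_cases:
  obtains t where "x = fp_eval in1 in2 t"
  using that[of "rep_free_prod x"]
  by (simp add: Quotient3_abs_rep[OF Quotient3_free_prod] flip: abs_free_prod_eval)

lemma fp_lift_eval:
  assumes "alg_hom f" "alg_hom g"
  shows "fp_lift f g (fp_eval in1 in2 t) = fp_eval f g t"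
proof -
  have "fp_rel UNIV UNIV {} (rep_free_prod (abs_free_prod t)) t"
    by (simp add: Quotient3_abs_rep[OF Quotient3_free_prod] flip: free_prod.abs_eq_iff)
  then show ?thesis
    using fp_eval_rel[OF assms] by (fastforce simp: fp_lift_def abs_free_prod_eval)
qed

lemma fp_lift_in [simp]:
  assumes "alg_hom f" "alg_hom g"
  shows "fp_lift f g (in1 a) = f a" "fp_lift f g (in2 b) = g b"
  using fp_lift_eval[OF assms, of "Leaf1 a"] fp_lift_eval[OF assms, of "Leaf2 b"] by simp_all

lemma alg_hom_fp_lift:
  assumes "alg_hom f" "alg_hom g"
  shows "alg_hom (fp_lift f g)"
proof -
  have "fp_lift f g (x + y) = fp_lift f g x + fp_lift f g y"
       "fp_lift f g (x * y) = fp_lift f g x * fp_lift f g y"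
       "fp_lift f g (c *\<^sub>C x) = c *\<^sub>C fp_lift f g x" for x y c
  proof -
    obtain s t where st: "x = fp_eval in1 in2 s" "y = fp_eval in1 in2 t"
      by (metis fp_cases)
    show "fp_lift f g (x + y) = fp_lift f g x + fp_lift f g y"
      using fp_lift_eval[OF assms, of "TPlus s t"] fp_lift_eval[OF assms] by (simp add: st)
    show "fp_lift f g (x * y) = fp_lift f g x * fp_lift f g y"
      using fp_lift_eval[OF assms, of "TMult s t"] fp_lift_eval[OF assms] by (simp add: st)
    show "fp_lift f g (c *\<^sub>C x) = c *\<^sub>C fp_lift f g x"
      using fp_lift_eval[OF assms, of "TScale c s"] fp_lift_eval[OF assms] by (simp add: st)
  qed
  then show ?thesis by (auto simp: alg_hom_iff)
qed

lemma fp_hom_eqI: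
  fixes h k :: "('a::complex_algebra, 'b::complex_algebra) free_prod \<Rightarrow> 'c::complex_algebra"
  assumes "alg_hom h" "alg_hom k" "\<And>a. h (in1 a) = k (in1 a)" "\<And>b. h (in2 b) = k (in2 b)"
  shows "h = k"
proof
  fix x :: "('a, 'b) free_prod"
  obtain t where "x = fp_eval in1 in2 t" by (rule fp_cases)
  moreover have "h \<circ> in1 = k \<circ> in1" "h \<circ> in2 = k \<circ> in2" using assms(3,4) by auto
  ultimately show "h x = k x"
    using fp_eval_hom[OF assms(1), of in1 in2 t] fp_eval_hom[OF assms(2), of in1 in2 t] by simp
qed


subsection \<open>The free product of unital algebras\<close>

quotient_type (overloaded) ('a, 'b) ufree_prod =
    "('a::complex_unital_algebra, 'b::complex_unital_algebra) fp_term" / "fp_rel UNIV UNIV {(1, 1)}"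
  by (rule equivp_fp_rel)

instantiation ufree_prod :: (complex_unital_algebra, complex_unital_algebra) complex_algebra
begin

lift_definition zero_ufree_prod :: "('a, 'b) ufree_prod" is TZero .
lift_definition plus_ufree_prod :: "('a, 'b) ufree_prod \<Rightarrow> ('a, 'b) ufree_prod \<Rightarrow> ('a, 'b) ufree_prod"
  is TPlus by (rule fp_rel.plus_cong)
lift_definition scaleC_ufree_prod :: "complex \<Rightarrow> ('a, 'b) ufree_prod \<Rightarrow> ('a, 'b) ufree_prod"
  is TScale by (rule fp_rel.scale_cong)
lift_definition times_ufree_prod :: "('a, 'b) ufree_prod \<Rightarrow> ('a, 'b) ufree_prod \<Rightarrow> ('a, 'b) ufree_prod"
  is TMult by (rule fp_rel.mult_cong)
definition uminus_ufree_prod :: "('a, 'b) ufree_prod \<Rightarrow> ('a, 'b) ufree_prod"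
  where "- x = (-1) *\<^sub>C x" for x :: "('a, 'b) ufree_prod"
definition minus_ufree_prod :: "('a, 'b) ufree_prod \<Rightarrow> ('a, 'b) ufree_prod \<Rightarrow> ('a, 'b) ufree_prod"
  where "x - y = x + (- y)" for x :: "('a, 'b) ufree_prod"

instance
proof
  fix x y z :: "('a, 'b) ufree_prod" and c d :: complex
  show "x + y + z = x + (y + z)" by transfer (simp add: fp_rel.plus_assoc)
  show "x + y = y + x" by transfer (simp add: fp_rel.plus_comm)
  show "0 + x = x" by transfer (simp add: fp_rel.plus_zero)
  show "- x + x = 0" unfolding uminus_ufree_prod_def by transfer (simp add: fp_rel.plus_minus)
  show "x - y = x + - y" by (rule minus_ufree_prod_def)
  show "c *\<^sub>C (x + y) = c *\<^sub>C x + c *\<^sub>C y" by transfer (simp add: fp_rel.scale_plus)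
  show "(c + d) *\<^sub>C x = c *\<^sub>C x + d *\<^sub>C x" by transfer (simp add: fp_rel.plus_scale)
  show "c *\<^sub>C d *\<^sub>C x = (c * d) *\<^sub>C x" by transfer (simp add: fp_rel.scale_scale)
  show "1 *\<^sub>C x = x" by transfer (simp add: fp_rel.scale_one)
  show "x * y * z = x * (y * z)" by transfer (simp add: fp_rel.mult_assoc)
  show "(x + y) * z = x * z + y * z" by transfer (simp add: fp_rel.plus_mult)
  show "x * (y + z) = x * y + x * z" by transfer (simp add: fp_rel.mult_plus)
  show "(c *\<^sub>C x) * y = c *\<^sub>C (x * y)" by transfer (simp add: fp_rel.scale_mult)
  show "x * (c *\<^sub>C y) = c *\<^sub>C (x * y)" by transfer (simp add: fp_rel.mult_scale)
qed

end

lift_definition uin1 :: "'a \<Rightarrow> ('a::complex_unital_algebra, 'b::complex_unital_algebra) ufree_prod"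
  is Leaf1 .
lift_definition uin2 :: "'b \<Rightarrow> ('a::complex_unital_algebra, 'b::complex_unital_algebra) ufree_prod"
  is Leaf2 .

lemma alg_hom_uin1: "alg_hom uin1" and alg_hom_uin2: "alg_hom uin2"
  unfolding alg_hom_iff
  by (intro conjI allI; transfer; simp add: fp_rel.leaf1_plus fp_rel.leaf1_scale fp_rel.leaf1_mult
      fp_rel.leaf2_plus fp_rel.leaf2_scale fp_rel.leaf2_mult)+

lemma uin1_1: "uin1 1 = uin2 1"
  by transfer (simp add: fp_rel.identify)

lemma abs_ufree_prod_eval: "abs_ufree_prod t = fp_eval uin1 uin2 t"
  by (induction t) (simp_all add: uin1.abs_eq uin2.abs_eq zero_ufree_prod.abs_eq
      flip: plus_ufree_prod.abs_eq scaleC_ufree_prod.abs_eq times_ufree_prod.abs_eq)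

lemma ufp_cases:
  obtains t where "x = fp_eval uin1 uin2 t"
  using that[of "rep_ufree_prod x"]
  by (simp add: Quotient3_abs_rep[OF Quotient3_ufree_prod] flip: abs_ufree_prod_eval)

text \<open>Either of the two identified units is a unit for the whole algebra.\<close>

instantiation ufree_prod :: (complex_unital_algebra, complex_unital_algebra) complex_unital_algebra
begin

definition one_ufree_prod :: "('a, 'b) ufree_prod" where "1 = uin1 1"

instance
proof
  fix x :: "('a, 'b) ufree_prod"
  obtain t where x: "x = fp_eval uin1 uin2 t" by (rule ufp_cases)
  have 1: "uin1 1 * uin1 a = (uin1 a :: ('a, 'b) ufree_prod)"
      "uin1 a * uin1 1 = (uin1 a :: ('a, 'b) ufree_prod)" for a
    using alg_hom_uin1 unfolding alg_hom_iff by (metis mult_1_left mult_1_right)+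
  have 2: "uin1 1 * uin2 a = (uin2 a :: ('a, 'b) ufree_prod)"
      "uin2 a * uin1 1 = (uin2 a :: ('a, 'b) ufree_prod)" for a
    using alg_hom_uin2 unfolding alg_hom_iff uin1_1 by (metis mult_1_left mult_1_right)+
  show "1 * x = x" unfolding x one_ufree_prod_def
    by (induction t) (simp_all add: 1 2 distrib_left mult_scaleC_right flip: mult.assoc)
  show "x * 1 = x" unfolding x one_ufree_prod_def
    by (induction t) (simp_all add: 1 2 distrib_right mult_scaleC_left mult.assoc)
qed

end

text \<open>The homomorphism induced by unital homomorphisms \<open>f\<close> and \<open>g\<close>.\<close>

definition ufp_lift :: "('a \<Rightarrow> 'c) \<Rightarrow> ('b \<Rightarrow> 'c)
    \<Rightarrow> ('a::complex_unital_algebra, 'b::complex_unital_algebra) ufree_prod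
    \<Rightarrow> 'c::complex_unital_algebra" where
  "ufp_lift f g x = fp_eval f g (rep_ufree_prod x)"

lemma ufp_lift_eval:
  assumes "alg_hom f" "alg_hom g" "f 1 = 1" "g 1 = 1"
  shows "ufp_lift f g (fp_eval uin1 uin2 t) = fp_eval f g t"
proof -
  have "fp_rel UNIV UNIV {(1, 1)} (rep_ufree_prod (abs_ufree_prod t)) t"
    by (simp add: Quotient3_abs_rep[OF Quotient3_ufree_prod] flip: ufree_prod.abs_eq_iff)
  then show ?thesis
    using fp_eval_rel[OF assms(1,2), of "{(1, 1)}" UNIV UNIV "rep_ufree_prod (abs_ufree_prod t)" t]
      assms(3,4) by (simp add: ufp_lift_def abs_ufree_prod_eval)
qed


text \<open>The star of the unital free product extending the stars of the factors.\<close>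

definition ufp_star :: "('a \<Rightarrow> 'a) \<Rightarrow> ('b \<Rightarrow> 'b) \<Rightarrow>
    ('a::complex_unital_algebra, 'b::complex_unital_algebra) ufree_prod \<Rightarrow> ('a, 'b) ufree_prod" where
  "ufp_star st1 st2 x = abs_ufree_prod (fp_term_star st1 st2 (rep_ufree_prod x))"


section \<open>Unitization\<close>

datatype 'a unitization = Unitization (scalar_part: complex) (alg_part: 'a)

instantiation unitization :: (complex_algebra) complex_unital_algebra
begin

definition "0 = Unitization 0 0"
definition "1 = Unitization 1 0"
definition "x + y = Unitization (scalar_part x + scalar_part y) (alg_part x + alg_part y)"
definition "x - y = Unitization (scalar_part x - scalar_part y) (alg_part x - alg_part y)"
definition "- x = Unitization (- scalar_part x) (- alg_part x)"
definition "c *\<^sub>C x = Unitization (c * scalar_part x) (c *\<^sub>C alg_part x)"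
definition "x * y = Unitization (scalar_part x * scalar_part y)
  (scalar_part x *\<^sub>C alg_part y + scalar_part y *\<^sub>C alg_part x + alg_part x * alg_part y)"

instance
proof
  note defs = zero_unitization_def one_unitization_def plus_unitization_def minus_unitization_def
    uminus_unitization_def scaleC_unitization_def times_unitization_def
  note distribs = distrib_left distrib_right scaleC_add_right scaleC_add_left scaleC_scaleC
    mult_scaleC_left mult_scaleC_right
  fix x y z :: "'a unitization" and c d :: complex
  show "x + y + z = x + (y + z)" by (simp add: defs add.assoc)
  show "x + y = y + x" by (simp add: defs add.commute)
  show "0 + x = x" by (simp add: defs)
  show "- x + x = 0" by (simp add: defs)
  show "x - y = x + - y" by (simp add: defs)
  show "c *\<^sub>C (x + y) = c *\<^sub>C x + c *\<^sub>C y" by (simp add: defs distribs)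
  show "(c + d) *\<^sub>C x = c *\<^sub>C x + d *\<^sub>C x" by (simp add: defs distribs)
  show "c *\<^sub>C d *\<^sub>C x = (c * d) *\<^sub>C x" by (simp add: defs distribs)
  show "1 *\<^sub>C x = x" by (simp add: defs)
  show "x * y * z = x * (y * z)"
    by (simp add: defs distribs mult.assoc[where 'a = 'a] mult_ac[where 'a = complex] add_ac)
  show "(x + y) * z = x * z + y * z" by (simp add: defs distribs add_ac)
  show "x * (y + z) = x * y + x * z" by (simp add: defs distribs add_ac)
  show "(c *\<^sub>C x) * y = c *\<^sub>C (x * y)"
    by (simp add: defs distribs mult_ac[where 'a = complex])
  show "x * (c *\<^sub>C y) = c *\<^sub>C (x * y)"
    by (simp add: defs distribs mult_ac[where 'a = complex])
  show "1 * x = x" by (simp add: defs)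
  show "x * 1 = x" by (simp add: defs)
qed

end

lemma unitization_parts [simp]:
  "scalar_part (x + y) = scalar_part x + scalar_part y" "alg_part (x + y) = alg_part x + alg_part y"
  "scalar_part (c *\<^sub>C x) = c * scalar_part x" "alg_part (c *\<^sub>C x) = c *\<^sub>C alg_part x"
  "scalar_part 0 = 0" "alg_part 0 = 0" "scalar_part 1 = 1" "alg_part 1 = 0"
  "scalar_part (x * y) = scalar_part x * scalar_part y"
  "alg_part (x * y) = scalar_part x *\<^sub>C alg_part y + scalar_part y *\<^sub>C alg_part x + alg_part x * alg_part y"
  by (simp_all add: plus_unitization_def scaleC_unitization_def zero_unitization_def
      one_unitization_def times_unitization_def)

definition unit_embed :: "'a \<Rightarrow> 'a::complex_algebra unitization" where
  "unit_embed a = Unitization 0 a"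

definition unit_map :: "('a \<Rightarrow> 'b) \<Rightarrow> 'a::complex_algebra unitization \<Rightarrow> 'b::complex_algebra unitization" where
  "unit_map f x = Unitization (scalar_part x) (f (alg_part x))"

definition unit_star :: "('a \<Rightarrow> 'a) \<Rightarrow> 'a::complex_algebra unitization \<Rightarrow> 'a unitization" where
  "unit_star st x = Unitization (cnj (scalar_part x)) (st (alg_part x))"

text \<open>The extension \<open>\<phi>~\<close> of a linear functional \<open>\<phi>\<close>.\<close>

definition unit_ext :: "('a::complex_algebra \<Rightarrow> complex) \<Rightarrow> 'a unitization \<Rightarrow> complex" where
  "unit_ext \<phi> x = scalar_part x + \<phi> (alg_part x)"

text \<open>
  The canonical identification of the unital free product of the unitizations with the unitization
  of the free product.
\<close>

definition unit_ident :: "('a::complex_algebra unitization, 'b::complex_algebra unitization) ufree_prod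
    \<Rightarrow> ('a, 'b) free_prod unitization" where
  "unit_ident = ufp_lift (unit_map in1) (unit_map in2)"

lemma unitization_eqI: "scalar_part x = scalar_part y \<Longrightarrow> alg_part x = alg_part y \<Longrightarrow> x = y"
  by (simp add: unitization.expand)

lemma alg_hom_unit_embed: "alg_hom unit_embed"
  by (auto simp: alg_hom_iff unit_embed_def intro: unitization_eqI)

lemma alg_hom_unit_map:
  assumes "alg_hom f"
  shows "alg_hom (unit_map f)" "unit_map f 1 = 1"
  using assms alg_hom_0[OF assms]
  by (auto simp: alg_hom_iff unit_map_def intro!: unitization_eqI)

lemma unit_ident_eval:
  "unit_ident (fp_eval uin1 uin2 t) = fp_eval (unit_map in1) (unit_map in2) t"
  unfolding unit_ident_def
  by (rule ufp_lift_eval) (simp_all add: alg_hom_unit_map alg_hom_in1 alg_hom_in2)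

lemma unit_ident_uin [simp]:
  "unit_ident (uin1 a) = unit_map in1 a" "unit_ident (uin2 b) = unit_map in2 b"
  using unit_ident_eval[of "Leaf1 a"] unit_ident_eval[of "Leaf2 b"] by simp_all

lemma alg_hom_unit_ident: "alg_hom unit_ident" and unit_ident_1: "unit_ident 1 = 1"
proof -
  have "unit_ident (x + y) = unit_ident x + unit_ident y"
       "unit_ident (x * y) = unit_ident x * unit_ident y"
       "unit_ident (c *\<^sub>C x) = c *\<^sub>C unit_ident x"
    for x y :: "('a unitization, 'b unitization) ufree_prod" and c
  proof -
    obtain s where s: "x = fp_eval uin1 uin2 s" by (rule ufp_cases)
    obtain t where t: "y = fp_eval uin1 uin2 t" by (rule ufp_cases)
    show "unit_ident (x + y) = unit_ident x + unit_ident y"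
      using unit_ident_eval[of "TPlus s t"] by (simp add: s t unit_ident_eval)
    show "unit_ident (x * y) = unit_ident x * unit_ident y"
      using unit_ident_eval[of "TMult s t"] by (simp add: s t unit_ident_eval)
    show "unit_ident (c *\<^sub>C x) = c *\<^sub>C unit_ident x"
      using unit_ident_eval[of "TScale c s"] by (simp add: s unit_ident_eval)
  qed
  then show "alg_hom (unit_ident :: ('a unitization, 'b unitization) ufree_prod \<Rightarrow> _)"
    by (simp add: alg_hom_iff)
  show "unit_ident (1 :: ('c unitization, 'd unitization) ufree_prod) = 1"
    by (simp add: one_ufree_prod_def alg_hom_unit_map alg_hom_in1)
qed

lemma bij_unit_ident:
  "bij (unit_ident :: ('a::complex_algebra unitization, 'b::complex_algebra unitization) ufree_prod \<Rightarrow> _)"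
proof (rule o_bij)
  let ?i = "unit_ident :: ('a unitization, 'b unitization) ufree_prod \<Rightarrow> _"
  define f where "f = (uin1 \<circ> unit_embed :: 'a \<Rightarrow> ('a unitization, 'b unitization) ufree_prod)"
  define g where "g = (uin2 \<circ> unit_embed :: 'b \<Rightarrow> ('a unitization, 'b unitization) ufree_prod)"
  have fg: "alg_hom f" "alg_hom g"
    by (simp_all add: f_def g_def alg_hom_comp alg_hom_uin1 alg_hom_uin2 alg_hom_unit_embed)
  define l where "l = fp_lift f g"
  have l: "alg_hom l" by (simp add: l_def fg alg_hom_fp_lift)
  have l_in: "l (in1 a) = f a" "l (in2 b) = g b" for a b
    by (simp_all add: l_def fg)
  define k where "k x = scalar_part x *\<^sub>C 1 + l (alg_part x)" for x
  have k: "alg_hom k"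
    using l by (simp add: alg_hom_iff k_def distrib_left distrib_right scaleC_add_left
        scaleC_add_right scaleC_scaleC mult_scaleC_left mult_scaleC_right add_ac)
  have split: "a = scalar_part a *\<^sub>C 1 + unit_embed (alg_part a)" for a :: "'x::complex_algebra unitization"
    by (rule unitization_eqI) (simp_all add: unit_embed_def)
  have u1: "uin1 a = (scalar_part a *\<^sub>C 1 + f (alg_part a))" for a
    using alg_hom_uin1 split[of a] unfolding alg_hom_iff f_def o_def one_ufree_prod_def by metis
  have u2: "uin2 a = (scalar_part a *\<^sub>C 1 + g (alg_part a))" for a
    using alg_hom_uin2 split[of a] unfolding alg_hom_iff g_def o_def one_ufree_prod_def uin1_1 by metis
  have "k \<circ> unit_map in1 = uin1" "k \<circ> unit_map in2 = uin2"
    by (auto simp: k_def unit_map_def l_in u1 u2)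
  then have "k (unit_ident x) = x" for x
  proof -
    obtain t where t: "x = fp_eval uin1 uin2 t" by (rule ufp_cases)
    show ?thesis unfolding t unit_ident_eval fp_eval_hom[OF k]
      using \<open>k \<circ> unit_map in1 = uin1\<close> \<open>k \<circ> unit_map in2 = uin2\<close> by simp
  qed
  then show "k \<circ> ?i = id" by auto
  have "?i \<circ> l = unit_embed"
    by (rule fp_hom_eqI)
      (auto simp: alg_hom_comp alg_hom_unit_ident l alg_hom_unit_embed l_in f_def g_def
        unit_map_def unit_embed_def alg_hom_0[OF alg_hom_in1])
  then have "?i (l x) = unit_embed x" for x by (metis comp_apply)
  moreover have "?i (x + y) = ?i x + ?i y" "?i (c *\<^sub>C x) = c *\<^sub>C ?i x" for x y c
    using alg_hom_unit_ident[where 'a = 'a and 'b = 'b] by (simp_all add: alg_hom_iff)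
  ultimately have "?i (k x) = x" for x
    by (simp add: k_def unit_ident_1 split[of x, symmetric])
  then show "?i \<circ> k = id" by auto
qed


section \<open>Linear operators and tensor products\<close>

typedef (overloaded) 'v linop = "{f :: 'v::complex_vector \<Rightarrow> 'v. clinear f}"
  morphisms op_apply Abs_linop
  by (rule exI[of _ id]) (simp add: clinear_iff)

setup_lifting type_definition_linop

instantiation linop :: (complex_vector) complex_unital_algebra
begin

lift_definition zero_linop :: "'a linop" is "\<lambda>_. 0" by (simp add: clinear_iff)
lift_definition one_linop :: "'a linop" is "\<lambda>v. v" by (simp add: clinear_iff)
lift_definition plus_linop :: "'a linop \<Rightarrow> 'a linop \<Rightarrow> 'a linop" is "\<lambda>f g v. f v + g v"
  by (simp add: clinear_iff scaleC_add_right add_ac)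
lift_definition minus_linop :: "'a linop \<Rightarrow> 'a linop \<Rightarrow> 'a linop" is "\<lambda>f g v. f v - g v"
  by (simp add: clinear_iff cvs.scale_right_diff_distrib)
lift_definition uminus_linop :: "'a linop \<Rightarrow> 'a linop" is "\<lambda>f v. - f v"
  by (simp add: clinear_iff)
lift_definition scaleC_linop :: "complex \<Rightarrow> 'a linop \<Rightarrow> 'a linop" is "\<lambda>c f v. c *\<^sub>C f v"
  by (simp add: clinear_iff scaleC_add_right scaleC_scaleC mult.commute)
lift_definition times_linop :: "'a linop \<Rightarrow> 'a linop \<Rightarrow> 'a linop" is "\<lambda>f g v. f (g v)"
  by (simp add: clinear_iff)

instance
  by standard (transfer; simp add: fun_eq_iff clinear_iff scaleC_add_right scaleC_add_left
      scaleC_scaleC add_ac)+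

end

lemma op_apply_simps [simp]:
  "op_apply 0 v = 0" "op_apply 1 v = v"
  "op_apply (f + g) v = op_apply f v + op_apply g v"
  "op_apply (c *\<^sub>C f) v = c *\<^sub>C op_apply f v"
  "op_apply (f * g) v = op_apply f (op_apply g v)"
  by (transfer; simp)+

lemma clinear_op_apply: "clinear (op_apply f)"
  using op_apply[of f] by simp

lemma op_apply_linear [simp]:
  "op_apply f (v + w) = op_apply f v + op_apply f w" "op_apply f (c *\<^sub>C v) = c *\<^sub>C op_apply f v"
  "op_apply f 0 = 0"
  using clinear_op_apply[of f] by (simp_all add: clinear_add clinear_scale clinear_0)

lemma linop_eqI: "(\<And>v. op_apply f v = op_apply g v) \<Longrightarrow> f = g"
  by (simp add: op_apply_inject[symmetric] fun_eq_iff)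

lemma op_apply_Abs: "clinear f \<Longrightarrow> op_apply (Abs_linop f) = f"
  by (simp add: Abs_linop_inverse)

text \<open>
  The algebraic tensor product, presented by the elementary tensors as generators and the vector
  space axioms together with bilinearity as relations.
\<close>

datatype ('v, 'w) tensor_term =
    TPure 'v 'w
  | TnZero
  | TnPlus "('v, 'w) tensor_term" "('v, 'w) tensor_term"
  | TnScale complex "('v, 'w) tensor_term"

inductive tensor_rel :: "('v::complex_vector, 'w::complex_vector) tensor_term
    \<Rightarrow> ('v, 'w) tensor_term \<Rightarrow> bool" where
  refl: "tensor_rel s s"
| sym: "tensor_rel s t \<Longrightarrow> tensor_rel t s"
| trans: "tensor_rel s t \<Longrightarrow> tensor_rel t u \<Longrightarrow> tensor_rel s u"
| plus_cong: "tensor_rel s s' \<Longrightarrow> tensor_rel t t' \<Longrightarrow> tensor_rel (TnPlus s t) (TnPlus s' t')"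
| scale_cong: "tensor_rel s s' \<Longrightarrow> tensor_rel (TnScale c s) (TnScale c s')"
| plus_assoc: "tensor_rel (TnPlus (TnPlus s t) u) (TnPlus s (TnPlus t u))"
| plus_comm: "tensor_rel (TnPlus s t) (TnPlus t s)"
| plus_zero: "tensor_rel (TnPlus TnZero s) s"
| plus_minus: "tensor_rel (TnPlus (TnScale (-1) s) s) TnZero"
| scale_plus: "tensor_rel (TnScale c (TnPlus s t)) (TnPlus (TnScale c s) (TnScale c t))"
| plus_scale: "tensor_rel (TnScale (c + d) s) (TnPlus (TnScale c s) (TnScale d s))"
| scale_scale: "tensor_rel (TnScale c (TnScale d s)) (TnScale (c * d) s)"
| scale_one: "tensor_rel (TnScale 1 s) s"
| pure_plus_left: "tensor_rel (TPure (v + v') w) (TnPlus (TPure v w) (TPure v' w))"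
| pure_plus_right: "tensor_rel (TPure v (w + w')) (TnPlus (TPure v w) (TPure v w'))"
| pure_scale_left: "tensor_rel (TPure (c *\<^sub>C v) w) (TnScale c (TPure v w))"
| pure_scale_right: "tensor_rel (TPure v (c *\<^sub>C w)) (TnScale c (TPure v w))"

quotient_type (overloaded) ('v, 'w) tensor =
    "('v::complex_vector, 'w::complex_vector) tensor_term" / tensor_rel
  by (intro equivpI reflpI sympI transpI) (auto intro: tensor_rel.intros)

instantiation tensor :: (complex_vector, complex_vector) complex_vector
begin

lift_definition zero_tensor :: "('a, 'b) tensor" is TnZero .
lift_definition plus_tensor :: "('a, 'b) tensor \<Rightarrow> ('a, 'b) tensor \<Rightarrow> ('a, 'b) tensor"
  is TnPlus by (rule tensor_rel.plus_cong)
lift_definition scaleC_tensor :: "complex \<Rightarrow> ('a, 'b) tensor \<Rightarrow> ('a, 'b) tensor"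
  is TnScale by (rule tensor_rel.scale_cong)
definition uminus_tensor :: "('a, 'b) tensor \<Rightarrow> ('a, 'b) tensor"
  where "- x = (-1) *\<^sub>C x" for x :: "('a, 'b) tensor"
definition minus_tensor :: "('a, 'b) tensor \<Rightarrow> ('a, 'b) tensor \<Rightarrow> ('a, 'b) tensor"
  where "x - y = x + (- y)" for x :: "('a, 'b) tensor"

instance
proof
  fix x y z :: "('a, 'b) tensor" and c d :: complex
  show "x + y + z = x + (y + z)" by transfer (rule tensor_rel.plus_assoc)
  show "x + y = y + x" by transfer (rule tensor_rel.plus_comm)
  show "0 + x = x" by transfer (rule tensor_rel.plus_zero)
  show "- x + x = 0" unfolding uminus_tensor_def by transfer (rule tensor_rel.plus_minus)
  show "x - y = x + - y" by (rule minus_tensor_def)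
  show "c *\<^sub>C (x + y) = c *\<^sub>C x + c *\<^sub>C y" by transfer (rule tensor_rel.scale_plus)
  show "(c + d) *\<^sub>C x = c *\<^sub>C x + d *\<^sub>C x" by transfer (rule tensor_rel.plus_scale)
  show "c *\<^sub>C d *\<^sub>C x = (c * d) *\<^sub>C x" by transfer (rule tensor_rel.scale_scale)
  show "1 *\<^sub>C x = x" by transfer (rule tensor_rel.scale_one)
qed

end

lift_definition pure_tensor :: "'v \<Rightarrow> 'w \<Rightarrow> ('v::complex_vector, 'w::complex_vector) tensor"
  (infixr \<open>\<otimes>\<close> 70) is TPure .

primrec tensor_eval :: "('v \<Rightarrow> 'w \<Rightarrow> 'u::complex_vector) \<Rightarrow> ('v, 'w) tensor_term \<Rightarrow> 'u" where
  "tensor_eval \<beta> (TPure v w) = \<beta> v w"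
| "tensor_eval \<beta> TnZero = 0"
| "tensor_eval \<beta> (TnPlus s t) = tensor_eval \<beta> s + tensor_eval \<beta> t"
| "tensor_eval \<beta> (TnScale c s) = c *\<^sub>C tensor_eval \<beta> s"

text \<open>The linear map induced by a bilinear map \<open>\<beta>\<close>.\<close>

definition tensor_lift :: "('v \<Rightarrow> 'w \<Rightarrow> 'u) \<Rightarrow> ('v::complex_vector, 'w::complex_vector) tensor
    \<Rightarrow> 'u::complex_vector" where
  "tensor_lift \<beta> x = tensor_eval \<beta> (rep_tensor x)"

definition tensor_op :: "'v::complex_vector linop \<Rightarrow> 'w::complex_vector linop
    \<Rightarrow> ('v, 'w) tensor linop" where
  "tensor_op f g = Abs_linop (tensor_lift (\<lambda>v w. op_apply f v \<otimes> op_apply g w))"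

lemma pure_tensor_bilinear:
  "(v + v') \<otimes> w = v \<otimes> w + v' \<otimes> w" "v \<otimes> (w + w') = v \<otimes> w + v \<otimes> w'"
  "(c *\<^sub>C v) \<otimes> w = c *\<^sub>C (v \<otimes> w)" "v \<otimes> (c *\<^sub>C w) = c *\<^sub>C (v \<otimes> w)"
  by (transfer; rule tensor_rel.pure_plus_left tensor_rel.pure_plus_right
    tensor_rel.pure_scale_left tensor_rel.pure_scale_right)+

lemma abs_tensor_eval: "abs_tensor t = tensor_eval (\<otimes>) t"
  by (induction t) (simp_all add: pure_tensor.abs_eq zero_tensor.abs_eq
      flip: plus_tensor.abs_eq scaleC_tensor.abs_eq)

lemma tensor_cases:
  obtains t where "x = tensor_eval (\<otimes>) t"
  using that[of "rep_tensor x"]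
  by (simp add: Quotient3_abs_rep[OF Quotient3_tensor] flip: abs_tensor_eval)

lemma tensor_induct [case_names pure zero plus scale]:
  assumes "\<And>v w. P (v \<otimes> w)" "P 0" "\<And>x y. P x \<Longrightarrow> P y \<Longrightarrow> P (x + y)" "\<And>c x. P x \<Longrightarrow> P (c *\<^sub>C x)"
  shows "P x"
proof -
  obtain t where "x = tensor_eval (\<otimes>) t" by (rule tensor_cases)
  moreover have "P (tensor_eval (\<otimes>) t)" by (induction t) (auto intro: assms)
  ultimately show ?thesis by simp
qed

definition cbilinear :: "('v::complex_vector \<Rightarrow> 'w::complex_vector \<Rightarrow> 'u::complex_vector) \<Rightarrow> bool" where
  "cbilinear \<beta> \<longleftrightarrow> (\<forall>v. clinear (\<beta> v)) \<and> (\<forall>w. clinear (\<lambda>v. \<beta> v w))"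

lemma tensor_eval_rel:
  fixes \<beta> :: "'v::complex_vector \<Rightarrow> 'w::complex_vector \<Rightarrow> 'u::complex_vector"
  assumes "cbilinear \<beta>" "tensor_rel s t"
  shows "tensor_eval \<beta> s = tensor_eval \<beta> t"
  using assms(2)
proof (induction rule: tensor_rel.induct)
  case (plus_minus s)
  have "(-1) *\<^sub>C x + x = 0" for x :: 'u
    using scaleC_add_left[of "-1" 1 x] by (simp add: scaleC_one)
  then show ?case by simp
qed (use assms(1) in \<open>simp_all add: cbilinear_def clinear_iff add_ac scaleC_add_right scaleC_add_left
    scaleC_scaleC\<close>)

lemma tensor_lift_eval:
  assumes "cbilinear \<beta>"
  shows "tensor_lift \<beta> (tensor_eval (\<otimes>) t) = tensor_eval \<beta> t"
proof -
  have "tensor_rel (rep_tensor (abs_tensor t)) t"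
    by (simp add: Quotient3_abs_rep[OF Quotient3_tensor] flip: tensor.abs_eq_iff)
  then show ?thesis
    using tensor_eval_rel[OF assms] by (simp add: tensor_lift_def abs_tensor_eval)
qed

lemma tensor_lift_pure: "cbilinear \<beta> \<Longrightarrow> tensor_lift \<beta> (v \<otimes> w) = \<beta> v w"
  using tensor_lift_eval[of \<beta> "TPure v w"] by simp

lemma clinear_tensor_lift:
  assumes "cbilinear \<beta>"
  shows "clinear (tensor_lift \<beta>)"
proof -
  have "tensor_lift \<beta> (x + y) = tensor_lift \<beta> x + tensor_lift \<beta> y"
       "tensor_lift \<beta> (c *\<^sub>C x) = c *\<^sub>C tensor_lift \<beta> x" for x y c
  proof -
    obtain s where s: "x = tensor_eval (\<otimes>) s" by (rule tensor_cases)
    obtain t where t: "y = tensor_eval (\<otimes>) t" by (rule tensor_cases)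
    show "tensor_lift \<beta> (x + y) = tensor_lift \<beta> x + tensor_lift \<beta> y"
      using tensor_lift_eval[OF assms, of "TnPlus s t"] tensor_lift_eval[OF assms] by (simp add: s t)
    show "tensor_lift \<beta> (c *\<^sub>C x) = c *\<^sub>C tensor_lift \<beta> x"
      using tensor_lift_eval[OF assms, of "TnScale c s"] tensor_lift_eval[OF assms] by (simp add: s)
  qed
  then show ?thesis by (simp add: clinear_iff)
qed

lemma op_apply_tensor_op [simp]:
  "op_apply (tensor_op f g) (v \<otimes> w) = op_apply f v \<otimes> op_apply g w"
proof -
  have "cbilinear (\<lambda>v w. op_apply f v \<otimes> op_apply g w)"
    by (simp add: cbilinear_def clinear_iff pure_tensor_bilinear)
  then show ?thesis
    by (simp add: tensor_op_def op_apply_Abs clinear_tensor_lift tensor_lift_pure)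
qed

lemma tensor_linop_eqI:
  assumes "\<And>v w. op_apply f (v \<otimes> w) = op_apply g (v \<otimes> w)"
  shows "f = g"
proof (rule linop_eqI)
  show "op_apply f x = op_apply g x" for x
    by (induction x rule: tensor_induct) (simp_all add: assms)
qed

lemma tensor_op_algebra:
  "tensor_op f g * tensor_op f' g' = tensor_op (f * f') (g * g')"
  "tensor_op (f + f') g = tensor_op f g + tensor_op f' g"
  "tensor_op f (g + g') = tensor_op f g + tensor_op f g'"
  "tensor_op (c *\<^sub>C f) g = c *\<^sub>C tensor_op f g"
  "tensor_op f (c *\<^sub>C g) = c *\<^sub>C tensor_op f g"
  by (rule tensor_linop_eqI, simp add: pure_tensor_bilinear)+


section \<open>Two-faced algebras\<close>

text \<open>The pair of the left and the right face.\<close>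

type_synonym 'a faces = "'a set \<times> 'a set"

text \<open>
  The carrier of \<open>S \<squnion> T\<close> for subalgebras \<open>S\<close> and \<open>T\<close>, and the map \<open>S \<squnion> T \<rightarrow> A\<close> which is induced by
  the inclusions if both are subalgebras of \<open>A\<close>.
\<close>

definition fp_carrier :: "'a::complex_algebra set \<Rightarrow> 'b::complex_algebra set \<Rightarrow> ('a, 'b) fp_term set set" where
  "fp_carrier S T = fp_terms S T // {(s, t). fp_rel S T {} s t}"

definition canonical_map :: "('a::complex_algebra, 'a) fp_term set \<Rightarrow> 'a" where
  "canonical_map X = the_elem (fp_eval id id ` X)"

definition two_faced :: "'a::complex_algebra faces \<Rightarrow> bool" where
  "two_faced F \<longleftrightarrow> subalgebra (fst F) \<and> subalgebra (snd F)
     \<and> bij_betw canonical_map (fp_carrier (fst F) (snd F)) UNIV"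

definition two_faced_star :: "('a::complex_algebra \<Rightarrow> 'a) \<Rightarrow> 'a faces \<Rightarrow> bool" where
  "two_faced_star st F \<longleftrightarrow> two_faced F \<and> is_star st \<and> st ` fst F \<subseteq> fst F \<and> st ` snd F \<subseteq> snd F"

definition two_faced_hom :: "'b::complex_algebra faces \<Rightarrow> 'a::complex_algebra faces \<Rightarrow> ('b \<Rightarrow> 'a) \<Rightarrow> bool" where
  "two_faced_hom G F j \<longleftrightarrow> alg_hom j \<and> j ` fst G \<subseteq> fst F \<and> j ` snd G \<subseteq> snd F"

definition fp_faces :: "'a::complex_algebra faces \<Rightarrow> 'b::complex_algebra faces \<Rightarrow> ('a, 'b) free_prod faces" where
  "fp_faces F1 F2 = (fp_sub (fst F1) (fst F2), fp_sub (snd F1) (snd F2))"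

lemma canonical_map_eval:
  assumes "t \<in> fp_terms S T"
  shows "canonical_map ({(s, t). fp_rel S T {} s t} `` {t}) = fp_eval id id t"
proof -
  have "fp_eval id id s = fp_eval id id t" if "fp_rel S T {} t s" for s
    using fp_eval_rel[OF alg_hom_id alg_hom_id _ that] by simp
  then have "fp_eval id id ` ({(s, t). fp_rel S T {} s t} `` {t})
      = (\<lambda>_. fp_eval id id t) ` ({(s, t). fp_rel S T {} s t} `` {t})"
    by (intro image_cong) (simp_all only: Image_singleton_iff mem_Collect_eq case_prod_conv)
  also have "\<dots> = {fp_eval id id t}"
    by (rule image_constant[of t]) (simp add: fp_rel.refl[OF assms])
  finally have "fp_eval id id ` ({(s, t). fp_rel S T {} s t} `` {t}) = {fp_eval id id t}" .
  then show ?thesis by (simp add: canonical_map_def)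
qed

lemma two_faced_rel:
  assumes "two_faced F" "s \<in> fp_terms (fst F) (snd F)" "t \<in> fp_terms (fst F) (snd F)"
    "fp_eval id id s = fp_eval id id t"
  shows "fp_rel (fst F) (snd F) {} s t"
proof -
  let ?r = "{(s, t). fp_rel (fst F) (snd F) {} s t}"
  have "?r `` {s} \<in> fp_carrier (fst F) (snd F)" "?r `` {t} \<in> fp_carrier (fst F) (snd F)"
    unfolding fp_carrier_def using assms(2,3) by (simp_all only: quotientI)
  moreover have "canonical_map (?r `` {s}) = canonical_map (?r `` {t})"
    using assms by (simp only: canonical_map_eval)
  ultimately have "?r `` {s} = ?r `` {t}"
    using assms(1) unfolding two_faced_def bij_betw_def by (metis inj_onD)
  moreover have "t \<in> ?r `` {t}" using fp_rel.refl[OF assms(3), of "{}"] by simp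
  ultimately have "t \<in> ?r `` {s}" by simp
  then show ?thesis by simp
qed

lemma two_faced_cases:
  assumes "two_faced F"
  obtains t where "t \<in> fp_terms (fst F) (snd F)" "a = fp_eval id id t"
proof -
  have "a \<in> canonical_map ` fp_carrier (fst F) (snd F)"
    using assms by (simp add: two_faced_def bij_betw_def)
  then obtain X where X: "X \<in> fp_carrier (fst F) (snd F)" "a = canonical_map X"
    by blast
  from X(1) obtain t where "t \<in> fp_terms (fst F) (snd F)"
      "X = {(s, t). fp_rel (fst F) (snd F) {} s t} `` {t}"
    unfolding fp_carrier_def by (rule quotientE)
  with X(2) show ?thesis by (intro that[of t]) (simp_all only: canonical_map_eval)
qed

lemma two_faced_hom_eqI:
  assumes "two_faced F" "alg_hom h" "alg_hom k" "\<And>a. a \<in> fst F \<Longrightarrow> h a = k a" "\<And>a. a \<in> snd F \<Longrightarrow> h a = k a"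
  shows "h = k"
proof
  fix a
  obtain t where t: "t \<in> fp_terms (fst F) (snd F)" "a = fp_eval id id t"
    using assms(1) by (rule two_faced_cases)
  have "fp_eval h h t = fp_eval k k t"
    by (rule fp_eval_cong_terms[OF t(1)]) (simp_all add: assms(4,5))
  then show "h a = k a"
    unfolding t(2) fp_eval_hom[OF assms(2)] fp_eval_hom[OF assms(3)] by simp
qed

lemma two_faced_extend:
  assumes F: "two_faced F" and fg: "alg_hom f" "alg_hom g"
  obtains h where "alg_hom h" "\<And>a. a \<in> fst F \<Longrightarrow> h a = f a" "\<And>a. a \<in> snd F \<Longrightarrow> h a = g a"
proof -
  let ?T = "fp_terms (fst F) (snd F)"
  define h where "h a = fp_eval f g (SOME t. t \<in> ?T \<and> a = fp_eval id id t)" for a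
  have h: "h (fp_eval id id t) = fp_eval f g t" if t: "t \<in> ?T" for t
  proof -
    have "(SOME s. s \<in> ?T \<and> fp_eval id id t = fp_eval id id s) \<in> ?T \<and>
        fp_eval id id t = fp_eval id id (SOME s. s \<in> ?T \<and> fp_eval id id t = fp_eval id id s)"
      by (rule someI[of _ t]) (use t in simp)
    then have "fp_rel (fst F) (snd F) {} (SOME s. s \<in> ?T \<and> fp_eval id id t = fp_eval id id s) t"
      using two_faced_rel[OF F _ t] by metis
    then show ?thesis
      unfolding h_def by (rule fp_eval_rel[OF fg, rotated]) simp
  qed
  have "h (a + b) = h a + h b" "h (a * b) = h a * h b" "h (c *\<^sub>C a) = c *\<^sub>C h a" for a b c
  proof -
    obtain s where s: "s \<in> ?T" "a = fp_eval id id s" using F by (rule two_faced_cases)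
    obtain t where t: "t \<in> ?T" "b = fp_eval id id t" using F by (rule two_faced_cases)
    show "h (a + b) = h a + h b" using h[of "TPlus s t"] h[of s] h[of t] s t by simp
    show "h (a * b) = h a * h b" using h[of "TMult s t"] h[of s] h[of t] s t by simp
    show "h (c *\<^sub>C a) = c *\<^sub>C h a" using h[of "TScale c s"] h[of s] s by simp
  qed
  moreover have "h a = f a" if "a \<in> fst F" for a using h[of "Leaf1 a"] that by simp
  moreover have "h a = g a" if "a \<in> snd F" for a using h[of "Leaf2 a"] that by simp
  ultimately show ?thesis by (intro that[of h]) (auto simp: alg_hom_iff)
qed


section \<open>The bi-monotone product\<close>

text \<open>The decomposition of a vector space as \<open>\<complex>\<Omega> \<oplus> V\<close> with \<open>\<Omega> \<noteq> 0\<close>.\<close>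

definition pointed :: "'v::complex_vector \<Rightarrow> 'v set \<Rightarrow> bool" where
  "pointed \<Omega> V \<longleftrightarrow> \<Omega> \<noteq> 0 \<and> cvs.subspace V \<and> cvs.span {\<Omega>} \<inter> V = {0}
     \<and> (\<forall>x. \<exists>c. \<exists>v\<in>V. x = c *\<^sub>C \<Omega> + v)"

definition vac_proj :: "'v::complex_vector \<Rightarrow> 'v set \<Rightarrow> 'v linop" where
  "vac_proj \<Omega> V = (THE p. op_apply p \<Omega> = \<Omega> \<and> (\<forall>v\<in>V. op_apply p v = 0))"

definition pointed_rep :: "'v::complex_vector \<Rightarrow> 'v set \<Rightarrow> ('a::complex_algebra \<Rightarrow> 'v linop) \<Rightarrow> bool" where
  "pointed_rep \<Omega> V \<pi> \<longleftrightarrow> pointed \<Omega> V \<and> alg_hom \<pi>"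

definition represents :: "'v::complex_vector \<Rightarrow> 'v set \<Rightarrow> ('a::complex_algebra \<Rightarrow> 'v linop)
    \<Rightarrow> ('a \<Rightarrow> complex) \<Rightarrow> bool" where
  "represents \<Omega> V \<pi> \<phi> \<longleftrightarrow> pointed_rep \<Omega> V \<pi>
     \<and> (\<forall>a. \<phi> a *\<^sub>C \<Omega> = op_apply (vac_proj \<Omega> V) (op_apply (\<pi> a) \<Omega>))"

definition tensor_compl :: "'v::complex_vector \<Rightarrow> 'v set \<Rightarrow> 'w::complex_vector \<Rightarrow> 'w set
    \<Rightarrow> ('v, 'w) tensor set" where
  "tensor_compl \<Omega>1 V1 \<Omega>2 V2 = cvs.span
     ({\<Omega>1 \<otimes> w | w. w \<in> V2} \<union> {v \<otimes> \<Omega>2 | v. v \<in> V1} \<union> {v \<otimes> w | v w. v \<in> V1 \<and> w \<in> V2})"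

text \<open>\<open>is_bm_rep\<close> characterizes the representation \<open>\<pi>1 \<bowtie> \<pi>2\<close>.\<close>

definition is_bm_rep :: "'a::complex_algebra faces \<Rightarrow> 'b::complex_algebra faces
    \<Rightarrow> 'v::complex_vector \<Rightarrow> 'v set \<Rightarrow> ('a \<Rightarrow> 'v linop)
    \<Rightarrow> 'w::complex_vector \<Rightarrow> 'w set \<Rightarrow> ('b \<Rightarrow> 'w linop)
    \<Rightarrow> (('a, 'b) free_prod \<Rightarrow> ('v, 'w) tensor linop) \<Rightarrow> bool" where
  "is_bm_rep F1 F2 \<Omega>1 V1 \<pi>1 \<Omega>2 V2 \<pi>2 h \<longleftrightarrow> alg_hom h
     \<and> (\<forall>a\<in>fst F1. h (in1 a) = tensor_op (\<pi>1 a) 1)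
     \<and> (\<forall>a\<in>snd F1. h (in1 a) = tensor_op (\<pi>1 a) (vac_proj \<Omega>2 V2))
     \<and> (\<forall>a\<in>snd F2. h (in2 a) = tensor_op 1 (\<pi>2 a))
     \<and> (\<forall>a\<in>fst F2. h (in2 a) = tensor_op (vac_proj \<Omega>1 V1) (\<pi>2 a))"

definition bm_rep :: "'a::complex_algebra faces \<Rightarrow> 'b::complex_algebra faces
    \<Rightarrow> 'v::complex_vector \<Rightarrow> 'v set \<Rightarrow> ('a \<Rightarrow> 'v linop)
    \<Rightarrow> 'w::complex_vector \<Rightarrow> 'w set \<Rightarrow> ('b \<Rightarrow> 'w linop)
    \<Rightarrow> ('a, 'b) free_prod \<Rightarrow> ('v, 'w) tensor linop" where
  "bm_rep F1 F2 \<Omega>1 V1 \<pi>1 \<Omega>2 V2 \<pi>2 = (THE h. is_bm_rep F1 F2 \<Omega>1 V1 \<pi>1 \<Omega>2 V2 \<pi>2 h)"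

definition bm_functional :: "'a::complex_algebra faces \<Rightarrow> 'b::complex_algebra faces
    \<Rightarrow> 'v::complex_vector \<Rightarrow> 'v set \<Rightarrow> ('a \<Rightarrow> 'v linop)
    \<Rightarrow> 'w::complex_vector \<Rightarrow> 'w set \<Rightarrow> ('b \<Rightarrow> 'w linop)
    \<Rightarrow> ('a, 'b) free_prod \<Rightarrow> complex" where
  "bm_functional F1 F2 \<Omega>1 V1 \<pi>1 \<Omega>2 V2 \<pi>2 x = (THE c. c *\<^sub>C (\<Omega>1 \<otimes> \<Omega>2) =
     op_apply (vac_proj (\<Omega>1 \<otimes> \<Omega>2) (tensor_compl \<Omega>1 V1 \<Omega>2 V2))
       (op_apply (bm_rep F1 F2 \<Omega>1 V1 \<pi>1 \<Omega>2 V2 \<pi>2 x) (\<Omega>1 \<otimes> \<Omega>2)))"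

text \<open>
  The bi-monotone product is defined by means of a particular pointed representation of each
  functional \<open>\<phi>\<close>, namely left multiplication on the unitization with \<open>\<Omega> = 1\<close> and \<open>V = ker \<phi>~\<close>.
  Theorem \<open>bm_functional_eq_bm_prod\<close> below shows that any other choice gives the same result.
\<close>

definition std_rep :: "'a::complex_algebra \<Rightarrow> 'a unitization linop" where
  "std_rep a = Abs_linop (\<lambda>x. unit_embed a * x)"

definition std_compl :: "('a::complex_algebra \<Rightarrow> complex) \<Rightarrow> 'a unitization set" where
  "std_compl \<phi> = {x. unit_ext \<phi> x = 0}"

definition bm_prod :: "'a::complex_algebra faces \<Rightarrow> 'b::complex_algebra faces
    \<Rightarrow> ('a \<Rightarrow> complex) \<Rightarrow> ('b \<Rightarrow> complex) \<Rightarrow> ('a, 'b) free_prod \<Rightarrow> complex" where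
  "bm_prod F1 F2 \<phi>1 \<phi>2 = bm_functional F1 F2 1 (std_compl \<phi>1) std_rep 1 (std_compl \<phi>2) std_rep"


subsection \<open>Well-definedness\<close>

lemma pointedI:
  assumes "clinear \<kappa>" "\<kappa> \<Omega> = (1::complex)"
  shows "pointed \<Omega> {v. \<kappa> v = 0}"
  unfolding pointed_def
proof (intro conjI allI)
  note [simp] = clinear_add[OF assms(1)] clinear_scale[OF assms(1)] clinear_0[OF assms(1)] assms(2)
  show "\<Omega> \<noteq> 0" using assms clinear_0 zero_neq_one by metis
  show "cvs.subspace {v. \<kappa> v = 0}" by (simp add: cvs.subspace_def)
  show "cvs.span {\<Omega>} \<inter> {v. \<kappa> v = 0} = {0}" by (auto simp: cvs.span_singleton)
  fix x
  have "x = \<kappa> x *\<^sub>C \<Omega> + (x + (- \<kappa> x) *\<^sub>C \<Omega>)"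
    by (simp add: algebra_simps)
  moreover have "\<kappa> (x + (- \<kappa> x) *\<^sub>C \<Omega>) = 0"
    by (simp del: cvs.scale_minus_left)
  ultimately show "\<exists>c. \<exists>v\<in>{v. \<kappa> v = 0}. x = c *\<^sub>C \<Omega> + v" by blast
qed

lemma pointedE:
  assumes "pointed \<Omega> V"
  obtains \<kappa> where "clinear \<kappa>" "\<kappa> \<Omega> = (1::complex)" "V = {v. \<kappa> v = 0}"
proof -
  from assms have V: "cvs.subspace V" and 0: "\<Omega> \<noteq> 0" and int: "cvs.span {\<Omega>} \<inter> V = {0}"
    and ex: "\<And>x. \<exists>c. \<exists>v\<in>V. x = c *\<^sub>C \<Omega> + v"
    by (auto simp: pointed_def)
  have uniq: "c = d" if "c *\<^sub>C \<Omega> + v = d *\<^sub>C \<Omega> + w" "v \<in> V" "w \<in> V" for c d v w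
  proof -
    have "(c - d) *\<^sub>C \<Omega> = w - v" using that(1) by (simp add: cvs.scale_left_diff_distrib algebra_simps)
    moreover have "w - v \<in> V" using V that by (simp add: cvs.subspace_diff)
    moreover have "(c - d) *\<^sub>C \<Omega> \<in> cvs.span {\<Omega>}" by (simp add: cvs.span_base cvs.span_scale)
    ultimately have "(c - d) *\<^sub>C \<Omega> \<in> cvs.span {\<Omega>} \<inter> V" by simp
    then have "(c - d) *\<^sub>C \<Omega> = 0" unfolding int by (rule singletonD)
    then show "c = d" unfolding cvs.scale_eq_0_iff using 0 by simp
  qed
  define \<kappa> where "\<kappa> x = (THE c. \<exists>v\<in>V. x = c *\<^sub>C \<Omega> + v)" for x
  have \<kappa>: "\<kappa> (c *\<^sub>C \<Omega> + v) = c" if "v \<in> V" for c v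
    unfolding \<kappa>_def by (rule the_equality) (use uniq that in blast)+
  have "clinear \<kappa>" unfolding clinear_iff
  proof (intro conjI allI)
    fix x y c
    obtain d v where x: "v \<in> V" "x = d *\<^sub>C \<Omega> + v" using ex by blast
    obtain e w where y: "w \<in> V" "y = e *\<^sub>C \<Omega> + w" using ex by blast
    have "x + y = (d + e) *\<^sub>C \<Omega> + (v + w)" by (simp add: x y scaleC_add_left add_ac)
    then have "\<kappa> (x + y) = d + e" by (simp only: \<kappa>[OF cvs.subspace_add[OF V x(1) y(1)]])
    then show "\<kappa> (x + y) = \<kappa> x + \<kappa> y" by (simp only: x y \<kappa>)
    have "c *\<^sub>C x = (c * d) *\<^sub>C \<Omega> + c *\<^sub>C v" by (simp add: x scaleC_add_right)
    then have "\<kappa> (c *\<^sub>C x) = c * d" by (simp only: \<kappa>[OF cvs.subspace_scale[OF V x(1)]])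
    then show "\<kappa> (c *\<^sub>C x) = c *\<^sub>C \<kappa> x" by (simp only: x \<kappa> scaleC_complex_def)
  qed
  moreover have "\<kappa> \<Omega> = 1" using \<kappa>[of 0 1] V by (simp add: cvs.subspace_0)
  moreover have "V = {v. \<kappa> v = 0}"
  proof (intro set_eqI iffI)
    fix v assume "v \<in> V" then show "v \<in> {v. \<kappa> v = 0}" using \<kappa>[of v 0] by simp
  next
    fix x assume "x \<in> {v. \<kappa> v = 0}"
    moreover obtain d v where x: "v \<in> V" "x = d *\<^sub>C \<Omega> + v" using ex by blast
    ultimately show "x \<in> V" by (simp add: \<kappa>)
  qed
  ultimately show ?thesis by (rule that)
qed

lemma vac_proj_apply:
  assumes "clinear \<kappa>" "\<kappa> \<Omega> = (1::complex)"
  shows "op_apply (vac_proj \<Omega> {v. \<kappa> v = 0}) x = \<kappa> x *\<^sub>C \<Omega>"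
proof -
  note [simp] = clinear_add[OF assms(1)] clinear_scale[OF assms(1)] assms(2)
  have lin: "clinear (\<lambda>x. \<kappa> x *\<^sub>C \<Omega>)" by (simp add: clinear_iff scaleC_add_left scaleC_scaleC)
  have "vac_proj \<Omega> {v. \<kappa> v = 0} = Abs_linop (\<lambda>x. \<kappa> x *\<^sub>C \<Omega>)"
    unfolding vac_proj_def
  proof (rule the_equality)
    show "op_apply (Abs_linop (\<lambda>x. \<kappa> x *\<^sub>C \<Omega>)) \<Omega> = \<Omega>
        \<and> (\<forall>v\<in>{v. \<kappa> v = 0}. op_apply (Abs_linop (\<lambda>x. \<kappa> x *\<^sub>C \<Omega>)) v = 0)"
      by (simp add: op_apply_Abs[OF lin])
    fix p assume p: "op_apply p \<Omega> = \<Omega> \<and> (\<forall>v\<in>{v. \<kappa> v = 0}. op_apply p v = 0)"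
    show "p = Abs_linop (\<lambda>x. \<kappa> x *\<^sub>C \<Omega>)"
    proof (rule linop_eqI)
      fix x
      have "\<kappa> (x + (- \<kappa> x) *\<^sub>C \<Omega>) = 0" by (simp del: cvs.scale_minus_left)
      then have "op_apply p (x + (- \<kappa> x) *\<^sub>C \<Omega>) = 0" using p by blast
      then have "op_apply p x = \<kappa> x *\<^sub>C \<Omega>"
        using p by (simp only: op_apply_linear) simp
      then show "op_apply p x = op_apply (Abs_linop (\<lambda>x. \<kappa> x *\<^sub>C \<Omega>)) x"
        by (simp add: op_apply_Abs[OF lin])
    qed
  qed
  then show ?thesis by (simp add: op_apply_Abs[OF lin])
qed

lemma alg_hom_tensor_op:
  "alg_hom \<pi> \<Longrightarrow> e * e = e \<Longrightarrow> alg_hom (\<lambda>a. tensor_op (\<pi> a) e)"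
  "alg_hom \<pi> \<Longrightarrow> e * e = e \<Longrightarrow> alg_hom (\<lambda>a. tensor_op e (\<pi> a))"
  by (simp_all add: alg_hom_iff tensor_op_algebra)

lemma vac_proj_idem:
  assumes "pointed \<Omega> V"
  shows "vac_proj \<Omega> V * vac_proj \<Omega> V = vac_proj \<Omega> V"
  using assms by (elim pointedE) (auto intro!: linop_eqI simp: vac_proj_apply clinear_scale)

lemma is_bm_rep_bm_rep:
  assumes F: "two_faced F1" "two_faced F2"
    and p: "pointed_rep \<Omega>1 V1 \<pi>1" "pointed_rep \<Omega>2 V2 \<pi>2"
  shows "is_bm_rep F1 F2 \<Omega>1 V1 \<pi>1 \<Omega>2 V2 \<pi>2 (bm_rep F1 F2 \<Omega>1 V1 \<pi>1 \<Omega>2 V2 \<pi>2)"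
proof -
  have pi: "alg_hom \<pi>1" "alg_hom \<pi>2" and idem: "vac_proj \<Omega>1 V1 * vac_proj \<Omega>1 V1 = vac_proj \<Omega>1 V1"
      "vac_proj \<Omega>2 V2 * vac_proj \<Omega>2 V2 = vac_proj \<Omega>2 V2"
    using p by (simp_all add: pointed_rep_def vac_proj_idem)
  obtain h1 where h1: "alg_hom h1" "\<And>a. a \<in> fst F1 \<Longrightarrow> h1 a = tensor_op (\<pi>1 a) 1"
      "\<And>a. a \<in> snd F1 \<Longrightarrow> h1 a = tensor_op (\<pi>1 a) (vac_proj \<Omega>2 V2)"
    using two_faced_extend[OF F(1) alg_hom_tensor_op(1)[OF pi(1), of 1] alg_hom_tensor_op(1)[OF pi(1) idem(2)]]
    by auto
  obtain h2 where h2: "alg_hom h2" "\<And>a. a \<in> fst F2 \<Longrightarrow> h2 a = tensor_op (vac_proj \<Omega>1 V1) (\<pi>2 a)"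
      "\<And>a. a \<in> snd F2 \<Longrightarrow> h2 a = tensor_op 1 (\<pi>2 a)"
    using two_faced_extend[OF F(2) alg_hom_tensor_op(2)[OF pi(2) idem(1)] alg_hom_tensor_op(2)[OF pi(2), of 1]]
    by auto
  show ?thesis unfolding bm_rep_def
  proof (rule theI[of "is_bm_rep F1 F2 \<Omega>1 V1 \<pi>1 \<Omega>2 V2 \<pi>2"])
    show ex: "is_bm_rep F1 F2 \<Omega>1 V1 \<pi>1 \<Omega>2 V2 \<pi>2 (fp_lift h1 h2)"
      by (simp add: is_bm_rep_def h1 h2 alg_hom_fp_lift)
    fix h assume h: "is_bm_rep F1 F2 \<Omega>1 V1 \<pi>1 \<Omega>2 V2 \<pi>2 h"
    have "h \<circ> in1 = h1"
      by (rule two_faced_hom_eqI[OF F(1)])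
        (use h h1 in \<open>auto simp: is_bm_rep_def alg_hom_comp alg_hom_in1\<close>)
    moreover have "h \<circ> in2 = h2"
      by (rule two_faced_hom_eqI[OF F(2)])
        (use h h2 in \<open>auto simp: is_bm_rep_def alg_hom_comp alg_hom_in2\<close>)
    ultimately show "h = fp_lift h1 h2"
      using h h1(1) h2(1) by (intro fp_hom_eqI) (auto simp: is_bm_rep_def alg_hom_fp_lift)
  qed
qed

lemma tensor_compl_eq:
  assumes \<kappa>: "clinear \<kappa>1" "\<kappa>1 \<Omega>1 = (1::complex)" "clinear \<kappa>2" "\<kappa>2 \<Omega>2 = (1::complex)"
  obtains \<kappa> where "clinear \<kappa>" "\<And>v w. \<kappa> (v \<otimes> w) = \<kappa>1 v * \<kappa>2 w"
    "tensor_compl \<Omega>1 {v. \<kappa>1 v = 0} \<Omega>2 {v. \<kappa>2 v = 0} = {x. \<kappa> x = 0}"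
proof -
  note [simp] = clinear_add[OF \<kappa>(1)] clinear_scale[OF \<kappa>(1)] clinear_add[OF \<kappa>(3)] clinear_scale[OF \<kappa>(3)] \<kappa>(2,4)
  let ?C = "tensor_compl \<Omega>1 {v. \<kappa>1 v = 0} \<Omega>2 {v. \<kappa>2 v = 0}"
  define \<kappa> where "\<kappa> = tensor_lift (\<lambda>v w. \<kappa>1 v * \<kappa>2 w)"
  have bil: "cbilinear (\<lambda>v w. \<kappa>1 v * \<kappa>2 w)"
    by (simp add: cbilinear_def clinear_iff algebra_simps)
  have lin: "clinear \<kappa>" and \<kappa>_pure: "\<And>v w. \<kappa> (v \<otimes> w) = \<kappa>1 v * \<kappa>2 w"
    using bil by (simp_all add: \<kappa>_def clinear_tensor_lift tensor_lift_pure)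
  have sub: "cvs.subspace {x. \<kappa> x = 0}"
    using lin by (simp add: cvs.subspace_def clinear_add clinear_scale clinear_0)
  have "?C \<subseteq> {x. \<kappa> x = 0}"
    unfolding tensor_compl_def by (rule cvs.span_minimal[OF _ sub]) (auto simp: \<kappa>_pure)
  moreover have "\<exists>y\<in>?C. x = \<kappa> x *\<^sub>C (\<Omega>1 \<otimes> \<Omega>2) + y" for x
  proof (induction x rule: tensor_induct)
    case (pure v w)
    define v' where "v' = v + (- \<kappa>1 v) *\<^sub>C \<Omega>1"
    define w' where "w' = w + (- \<kappa>2 w) *\<^sub>C \<Omega>2"
    have v: "v = \<kappa>1 v *\<^sub>C \<Omega>1 + v'" "\<kappa>1 v' = 0" and w: "w = \<kappa>2 w *\<^sub>C \<Omega>2 + w'" "\<kappa>2 w' = 0"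
      by (simp_all add: v'_def w'_def del: cvs.scale_minus_left)
        (simp_all add: algebra_simps)
    have mem: "\<Omega>1 \<otimes> w' \<in> ?C" "v' \<otimes> \<Omega>2 \<in> ?C" "v' \<otimes> w' \<in> ?C"
      unfolding tensor_compl_def using v(2) w(2) by (auto intro!: cvs.span_base)
    have "v \<otimes> w = (\<kappa>1 v *\<^sub>C \<Omega>1 + v') \<otimes> (\<kappa>2 w *\<^sub>C \<Omega>2 + w')"
      using v(1) w(1) by simp
    also have "\<dots> = \<kappa> (v \<otimes> w) *\<^sub>C (\<Omega>1 \<otimes> \<Omega>2)
        + (\<kappa>1 v *\<^sub>C (\<Omega>1 \<otimes> w') + \<kappa>2 w *\<^sub>C (v' \<otimes> \<Omega>2) + v' \<otimes> w')"
      by (simp add: pure_tensor_bilinear \<kappa>_pure scaleC_add_right scaleC_scaleC add_ac mult.commute)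
    finally have "v \<otimes> w = \<dots>" .
    moreover have "\<kappa>1 v *\<^sub>C (\<Omega>1 \<otimes> w') + \<kappa>2 w *\<^sub>C (v' \<otimes> \<Omega>2) + v' \<otimes> w' \<in> ?C"
      using mem unfolding tensor_compl_def by (intro cvs.span_add cvs.span_scale)
    ultimately show ?case by blast
  next
    case zero
    have "0 \<in> ?C" by (simp add: tensor_compl_def cvs.span_zero)
    then show ?case using clinear_0[OF lin] by auto
  next
    case (plus x y)
    then obtain x' y' where *: "x' \<in> ?C" "y' \<in> ?C" "x = \<kappa> x *\<^sub>C (\<Omega>1 \<otimes> \<Omega>2) + x'" "y = \<kappa> y *\<^sub>C (\<Omega>1 \<otimes> \<Omega>2) + y'"
      by blast
    have "x + y = (\<kappa> x *\<^sub>C (\<Omega>1 \<otimes> \<Omega>2) + x') + (\<kappa> y *\<^sub>C (\<Omega>1 \<otimes> \<Omega>2) + y')"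
      using *(3,4) by simp
    also have "\<dots> = \<kappa> (x + y) *\<^sub>C (\<Omega>1 \<otimes> \<Omega>2) + (x' + y')"
      by (simp add: clinear_add[OF lin] scaleC_add_left add_ac)
    finally have "x + y = \<dots>" .
    moreover have "x' + y' \<in> ?C" using *(1,2) unfolding tensor_compl_def by (rule cvs.span_add)
    ultimately show ?case by blast
  next
    case (scale c x)
    then obtain x' where *: "x' \<in> ?C" "x = \<kappa> x *\<^sub>C (\<Omega>1 \<otimes> \<Omega>2) + x'" by blast
    have "c *\<^sub>C x = c *\<^sub>C (\<kappa> x *\<^sub>C (\<Omega>1 \<otimes> \<Omega>2) + x')"
      using *(2) by simp
    also have "\<dots> = \<kappa> (c *\<^sub>C x) *\<^sub>C (\<Omega>1 \<otimes> \<Omega>2) + c *\<^sub>C x'"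
      by (simp add: clinear_scale[OF lin] scaleC_add_right scaleC_scaleC)
    finally have "c *\<^sub>C x = \<dots>" .
    moreover have "c *\<^sub>C x' \<in> ?C" using *(1) unfolding tensor_compl_def by (rule cvs.span_scale)
    ultimately show ?case by blast
  qed
  then have "{x. \<kappa> x = 0} \<subseteq> ?C" by (metis (mono_tags, lifting) add_0 cvs.scale_zero_left mem_Collect_eq subsetI)
  ultimately show ?thesis using lin \<kappa>_pure that by blast
qed

lemma bm_functional_apply:
  fixes \<kappa> :: "('v::complex_vector, 'w::complex_vector) tensor \<Rightarrow> complex"
  assumes "clinear \<kappa>" "\<kappa> (\<Omega>1 \<otimes> \<Omega>2) = 1" "tensor_compl \<Omega>1 V1 \<Omega>2 V2 = {x. \<kappa> x = 0}"
  shows "bm_functional F1 F2 \<Omega>1 V1 \<pi>1 \<Omega>2 V2 \<pi>2 x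
    = \<kappa> (op_apply (bm_rep F1 F2 \<Omega>1 V1 \<pi>1 \<Omega>2 V2 \<pi>2 x) (\<Omega>1 \<otimes> \<Omega>2))"
proof -
  have "\<Omega>1 \<otimes> \<Omega>2 \<noteq> 0" using assms(2) clinear_0[OF assms(1)] by auto
  then show ?thesis
    unfolding bm_functional_def assms(3) vac_proj_apply[OF assms(1,2)] by simp
qed

lemma represents_std_rep:
  fixes \<phi> :: "'a::complex_algebra \<Rightarrow> complex"
  assumes "clinear \<phi>"
  shows "represents 1 (std_compl \<phi>) std_rep \<phi>"
proof -
  have ext: "clinear (unit_ext \<phi>)" "unit_ext \<phi> 1 = 1"
    using assms by (simp_all add: clinear_iff unit_ext_def distrib_left clinear_0[OF assms])
  have app: "op_apply (std_rep a) x = unit_embed a * x" for a :: 'a and x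
    unfolding std_rep_def
    by (subst op_apply_Abs) (simp_all add: clinear_iff distrib_left mult_scaleC_right)
  have "alg_hom (std_rep :: 'a \<Rightarrow> _)"
    using alg_hom_unit_embed[where 'a = 'a] unfolding alg_hom_iff
    by (auto intro!: linop_eqI simp: app distrib_right mult_scaleC_left mult.assoc)
  moreover have "unit_ext \<phi> (unit_embed a) = \<phi> a" for a
    by (simp add: unit_ext_def unit_embed_def)
  ultimately show ?thesis
    by (simp add: represents_def pointed_rep_def std_compl_def pointedI[OF ext] vac_proj_apply[OF ext] app)
qed

text \<open>
  For the independence of the chosen representations, two pairs of representations are compared by
  means of linked vectors and operators preserving linkedness.
\<close>

definition link :: "'v::complex_vector \<Rightarrow> ('a \<Rightarrow> 'v linop) \<Rightarrow> 'v'::complex_vector \<Rightarrow> ('a \<Rightarrow> 'v' linop)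
    \<Rightarrow> 'v \<Rightarrow> 'v' \<Rightarrow> bool" where
  "link \<Omega> \<pi> \<Omega>' \<pi>' v v' \<longleftrightarrow>
     (\<exists>c b. v = c *\<^sub>C \<Omega> + op_apply (\<pi> b) \<Omega> \<and> v' = c *\<^sub>C \<Omega>' + op_apply (\<pi>' b) \<Omega>')"

inductive linkT :: "('v::complex_vector \<Rightarrow> 'v'::complex_vector \<Rightarrow> bool)
    \<Rightarrow> ('w::complex_vector \<Rightarrow> 'w'::complex_vector \<Rightarrow> bool)
    \<Rightarrow> ('v, 'w) tensor \<Rightarrow> ('v', 'w') tensor \<Rightarrow> bool" for N1 N2 where
  pure: "N1 v v' \<Longrightarrow> N2 w w' \<Longrightarrow> linkT N1 N2 (v \<otimes> w) (v' \<otimes> w')"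
| zero: "linkT N1 N2 0 0"
| plus: "linkT N1 N2 x x' \<Longrightarrow> linkT N1 N2 y y' \<Longrightarrow> linkT N1 N2 (x + y) (x' + y')"
| scale: "linkT N1 N2 x x' \<Longrightarrow> linkT N1 N2 (c *\<^sub>C x) (c *\<^sub>C x')"

definition preserves :: "('v::complex_vector \<Rightarrow> 'v'::complex_vector \<Rightarrow> bool) \<Rightarrow> 'v linop \<Rightarrow> 'v' linop \<Rightarrow> bool" where
  "preserves N f f' \<longleftrightarrow> (\<forall>v v'. N v v' \<longrightarrow> N (op_apply f v) (op_apply f' v'))"

lemma preserves_linkT_tensor_op:
  assumes "preserves N1 f f'" "preserves N2 g g'"
  shows "preserves (linkT N1 N2) (tensor_op f g) (tensor_op f' g')"
  unfolding preserves_def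
proof (intro allI impI)
  fix x x' assume "linkT N1 N2 x x'"
  then show "linkT N1 N2 (op_apply (tensor_op f g) x) (op_apply (tensor_op f' g') x')"
    by induction (use assms in \<open>auto simp: preserves_def intro: linkT.intros\<close>)
qed

lemma preserves_linkT_closed:
  "preserves (linkT N1 N2) 0 0"
  "preserves (linkT N1 N2) f f' \<Longrightarrow> preserves (linkT N1 N2) g g' \<Longrightarrow> preserves (linkT N1 N2) (f + g) (f' + g')"
  "preserves (linkT N1 N2) f f' \<Longrightarrow> preserves (linkT N1 N2) (c *\<^sub>C f) (c *\<^sub>C f')"
  "preserves (linkT N1 N2) f f' \<Longrightarrow> preserves (linkT N1 N2) g g' \<Longrightarrow> preserves (linkT N1 N2) (f * g) (f' * g')"
  by (auto simp: preserves_def intro: linkT.intros)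

lemma preserves_one: "preserves N 1 1"
  by (simp add: preserves_def)

lemma preserves_link_rep:
  assumes "alg_hom \<pi>" "alg_hom \<pi>'"
  shows "preserves (link \<Omega> \<pi> \<Omega>' \<pi>') (\<pi> a) (\<pi>' a)"
  unfolding preserves_def link_def
proof (intro allI impI, elim exE conjE)
  fix v v' c b
  assume v: "v = c *\<^sub>C \<Omega> + op_apply (\<pi> b) \<Omega>" "v' = c *\<^sub>C \<Omega>' + op_apply (\<pi>' b) \<Omega>'"
  have *: "op_apply (\<rho> a) (c *\<^sub>C \<omega> + op_apply (\<rho> b) \<omega>)
      = 0 *\<^sub>C \<omega> + op_apply (\<rho> (c *\<^sub>C a + a * b)) \<omega>"
    if "alg_hom \<rho>" for \<rho> :: "'a \<Rightarrow> 'x::complex_vector linop" and \<omega>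
    using that by (simp add: alg_hom_iff)
  show "\<exists>c b. op_apply (\<pi> a) v = c *\<^sub>C \<Omega> + op_apply (\<pi> b) \<Omega>
      \<and> op_apply (\<pi>' a) v' = c *\<^sub>C \<Omega>' + op_apply (\<pi>' b) \<Omega>'"
    unfolding v using *[OF assms(1)] *[OF assms(2)] by blast
qed

lemma link_vacuum:
  assumes "alg_hom \<pi>" "alg_hom \<pi>'"
  shows "link \<Omega> \<pi> \<Omega>' \<pi>' \<Omega> \<Omega>'"
  unfolding link_def by (rule exI[of _ 1], rule exI[of _ 0]) (simp add: alg_hom_0 assms)

lemma link_coefficient:
  assumes "represents \<Omega> {v. \<kappa> v = 0} \<pi> \<phi>" "represents \<Omega>' {v. \<kappa>' v = 0} \<pi>' \<phi>"
    and \<kappa>: "clinear \<kappa>" "\<kappa> \<Omega> = (1::complex)" and \<kappa>': "clinear \<kappa>'" "\<kappa>' \<Omega>' = (1::complex)"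
    and "link \<Omega> \<pi> \<Omega>' \<pi>' v v'"
  shows "\<kappa> v = \<kappa>' v'"
proof -
  have "\<Omega> \<noteq> 0" "\<Omega>' \<noteq> 0" using assms(1,2) by (auto simp: represents_def pointed_rep_def pointed_def)
  then have "\<kappa> (op_apply (\<pi> b) \<Omega>) = \<phi> b" "\<kappa>' (op_apply (\<pi>' b) \<Omega>') = \<phi> b" for b
    using assms(1,2) by (simp_all add: represents_def vac_proj_apply[OF \<kappa>] vac_proj_apply[OF \<kappa>'])
  then show ?thesis
    using assms(7) by (auto simp: link_def clinear_add[OF \<kappa>(1)] clinear_scale[OF \<kappa>(1)] \<kappa>(2)
        clinear_add[OF \<kappa>'(1)] clinear_scale[OF \<kappa>'(1)] \<kappa>'(2))
qed

lemma preserves_link_proj: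
  assumes "represents \<Omega> V \<pi> \<phi>" "represents \<Omega>' V' \<pi>' \<phi>"
  shows "preserves (link \<Omega> \<pi> \<Omega>' \<pi>') (vac_proj \<Omega> V) (vac_proj \<Omega>' V')"
proof -
  have hom: "alg_hom \<pi>" "alg_hom \<pi>'" and p: "pointed \<Omega> V" "pointed \<Omega>' V'"
    using assms by (simp_all add: represents_def pointed_rep_def)
  obtain \<kappa> where \<kappa>: "clinear \<kappa>" "\<kappa> \<Omega> = (1::complex)" "V = {v. \<kappa> v = 0}" using p(1) by (rule pointedE)
  obtain \<kappa>' where \<kappa>': "clinear \<kappa>'" "\<kappa>' \<Omega>' = (1::complex)" "V' = {v. \<kappa>' v = 0}" using p(2) by (rule pointedE)
  have "link \<Omega> \<pi> \<Omega>' \<pi>' (c *\<^sub>C \<Omega>) (c *\<^sub>C \<Omega>')" for c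
    unfolding link_def by (rule exI[of _ c], rule exI[of _ 0]) (simp add: alg_hom_0 hom)
  then show ?thesis
    using link_coefficient[OF assms[unfolded \<kappa>(3) \<kappa>'(3)] \<kappa>(1,2) \<kappa>'(1,2)]
    by (auto simp: preserves_def \<kappa>(3) \<kappa>'(3) vac_proj_apply[OF \<kappa>(1,2)] vac_proj_apply[OF \<kappa>'(1,2)])
qed

lemma preserves_hom:
  assumes "two_faced F" "alg_hom h" "alg_hom h'"
    "\<And>a. a \<in> fst F \<union> snd F \<Longrightarrow> preserves (linkT N1 N2) (h a) (h' a)"
  shows "preserves (linkT N1 N2) (h a) (h' a)"
proof -
  obtain t where t: "t \<in> fp_terms (fst F) (snd F)" "a = fp_eval id id t"
    using assms(1) by (rule two_faced_cases)
  from t(1) have "preserves (linkT N1 N2) (h (fp_eval id id t)) (h' (fp_eval id id t))"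
    using assms(2-4) by (induction t) (auto simp: alg_hom_iff alg_hom_0 preserves_linkT_closed)
  then show ?thesis using t(2) by simp
qed

lemma bm_functional_independent:
  fixes F1 :: "'a::complex_algebra faces" and F2 :: "'b::complex_algebra faces"
  assumes F: "two_faced F1" "two_faced F2"
    and r: "represents \<Omega>1 V1 \<pi>1 \<phi>1" "represents \<Omega>2 V2 \<pi>2 \<phi>2"
    and r': "represents \<Omega>1' V1' \<pi>1' \<phi>1" "represents \<Omega>2' V2' \<pi>2' \<phi>2"
  shows "bm_functional F1 F2 \<Omega>1 V1 \<pi>1 \<Omega>2 V2 \<pi>2 = bm_functional F1 F2 \<Omega>1' V1' \<pi>1' \<Omega>2' V2' \<pi>2'"
proof
  fix x :: "('a, 'b) free_prod"
  let ?N1 = "link \<Omega>1 \<pi>1 \<Omega>1' \<pi>1'" and ?N2 = "link \<Omega>2 \<pi>2 \<Omega>2' \<pi>2'"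
  let ?h = "bm_rep F1 F2 \<Omega>1 V1 \<pi>1 \<Omega>2 V2 \<pi>2" and ?h' = "bm_rep F1 F2 \<Omega>1' V1' \<pi>1' \<Omega>2' V2' \<pi>2'"
  have hom: "alg_hom \<pi>1" "alg_hom \<pi>2" "alg_hom \<pi>1'" "alg_hom \<pi>2'"
    and p: "pointed \<Omega>1 V1" "pointed \<Omega>2 V2" "pointed \<Omega>1' V1'" "pointed \<Omega>2' V2'"
    and pr: "pointed_rep \<Omega>1 V1 \<pi>1" "pointed_rep \<Omega>2 V2 \<pi>2" "pointed_rep \<Omega>1' V1' \<pi>1'" "pointed_rep \<Omega>2' V2' \<pi>2'"
    using r r' by (simp_all add: represents_def pointed_rep_def)
  have h: "is_bm_rep F1 F2 \<Omega>1 V1 \<pi>1 \<Omega>2 V2 \<pi>2 ?h"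
    and h': "is_bm_rep F1 F2 \<Omega>1' V1' \<pi>1' \<Omega>2' V2' \<pi>2' ?h'"
    using F pr by (simp_all add: is_bm_rep_bm_rep)
  then have hh: "alg_hom ?h" "alg_hom ?h'" by (simp_all add: is_bm_rep_def)
  note pres = preserves_linkT_tensor_op preserves_one preserves_link_rep[OF hom(1,3)]
    preserves_link_rep[OF hom(2,4)] preserves_link_proj[OF r(1) r'(1)] preserves_link_proj[OF r(2) r'(2)]
  have 1: "preserves (linkT ?N1 ?N2) ((?h \<circ> in1) a) ((?h' \<circ> in1) a)" for a
  proof (rule preserves_hom[OF F(1)])
    show "alg_hom (?h \<circ> in1)" "alg_hom (?h' \<circ> in1)" using hh by (simp_all add: alg_hom_comp alg_hom_in1)
    show "preserves (linkT ?N1 ?N2) ((?h \<circ> in1) a) ((?h' \<circ> in1) a)" if "a \<in> fst F1 \<union> snd F1" for a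
      using that h h' unfolding is_bm_rep_def by (elim UnE) (simp_all add: pres)
  qed
  have 2: "preserves (linkT ?N1 ?N2) ((?h \<circ> in2) a) ((?h' \<circ> in2) a)" for a
  proof (rule preserves_hom[OF F(2)])
    show "alg_hom (?h \<circ> in2)" "alg_hom (?h' \<circ> in2)" using hh by (simp_all add: alg_hom_comp alg_hom_in2)
    show "preserves (linkT ?N1 ?N2) ((?h \<circ> in2) a) ((?h' \<circ> in2) a)" if "a \<in> fst F2 \<union> snd F2" for a
      using that h h' unfolding is_bm_rep_def by (elim UnE) (simp_all add: pres)
  qed
  obtain t where t: "x = fp_eval in1 in2 t" by (rule fp_cases)
  have "preserves (linkT ?N1 ?N2) (?h x) (?h' x)"
    unfolding t using hh 1 2
    by (induction t) (auto simp: alg_hom_iff alg_hom_0 preserves_linkT_closed)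
  moreover have "linkT ?N1 ?N2 (\<Omega>1 \<otimes> \<Omega>2) (\<Omega>1' \<otimes> \<Omega>2')"
    by (intro linkT.pure link_vacuum hom)
  ultimately have link: "linkT ?N1 ?N2 (op_apply (?h x) (\<Omega>1 \<otimes> \<Omega>2)) (op_apply (?h' x) (\<Omega>1' \<otimes> \<Omega>2'))"
    by (simp add: preserves_def)
  obtain \<kappa>1 where \<kappa>1: "clinear \<kappa>1" "\<kappa>1 \<Omega>1 = (1::complex)" "V1 = {v. \<kappa>1 v = 0}" using p(1) by (rule pointedE)
  obtain \<kappa>2 where \<kappa>2: "clinear \<kappa>2" "\<kappa>2 \<Omega>2 = (1::complex)" "V2 = {v. \<kappa>2 v = 0}" using p(2) by (rule pointedE)
  obtain \<kappa>1' where \<kappa>1': "clinear \<kappa>1'" "\<kappa>1' \<Omega>1' = (1::complex)" "V1' = {v. \<kappa>1' v = 0}" using p(3) by (rule pointedE)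
  obtain \<kappa>2' where \<kappa>2': "clinear \<kappa>2'" "\<kappa>2' \<Omega>2' = (1::complex)" "V2' = {v. \<kappa>2' v = 0}" using p(4) by (rule pointedE)
  obtain \<kappa> where \<kappa>: "clinear \<kappa>" "\<And>v w. \<kappa> (v \<otimes> w) = \<kappa>1 v * \<kappa>2 w" "tensor_compl \<Omega>1 V1 \<Omega>2 V2 = {x. \<kappa> x = 0}"
    using tensor_compl_eq[OF \<kappa>1(1,2) \<kappa>2(1,2)] unfolding \<kappa>1(3) \<kappa>2(3) by blast
  obtain \<kappa>' where \<kappa>': "clinear \<kappa>'" "\<And>v w. \<kappa>' (v \<otimes> w) = \<kappa>1' v * \<kappa>2' w" "tensor_compl \<Omega>1' V1' \<Omega>2' V2' = {x. \<kappa>' x = 0}"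
    using tensor_compl_eq[OF \<kappa>1'(1,2) \<kappa>2'(1,2)] unfolding \<kappa>1'(3) \<kappa>2'(3) by blast
  have "\<kappa> y = \<kappa>' y'" if "linkT ?N1 ?N2 y y'" for y y'
    using that
  proof induction
    case (pure v v' w w')
    then show ?case
      using link_coefficient[OF r(1)[unfolded \<kappa>1(3)] r'(1)[unfolded \<kappa>1'(3)] \<kappa>1(1,2) \<kappa>1'(1,2)]
        link_coefficient[OF r(2)[unfolded \<kappa>2(3)] r'(2)[unfolded \<kappa>2'(3)] \<kappa>2(1,2) \<kappa>2'(1,2)]
      by (simp add: \<kappa>(2) \<kappa>'(2))
  qed (simp_all add: clinear_add[OF \<kappa>(1)] clinear_add[OF \<kappa>'(1)] clinear_scale[OF \<kappa>(1)]
      clinear_scale[OF \<kappa>'(1)] clinear_0[OF \<kappa>(1)] clinear_0[OF \<kappa>'(1)])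
  from this[OF link] show "bm_functional F1 F2 \<Omega>1 V1 \<pi>1 \<Omega>2 V2 \<pi>2 x = bm_functional F1 F2 \<Omega>1' V1' \<pi>1' \<Omega>2' V2' \<pi>2' x"
    by (simp add: bm_functional_apply[OF \<kappa>(1) _ \<kappa>(3)] bm_functional_apply[OF \<kappa>'(1) _ \<kappa>'(3)]
        \<kappa>(2) \<kappa>'(2) \<kappa>1(2) \<kappa>2(2) \<kappa>1'(2) \<kappa>2'(2))
qed

theorem bm_functional_eq_bm_prod:
  assumes "two_faced F1" "two_faced F2" "clinear \<phi>1" "clinear \<phi>2"
    and "represents \<Omega>1 V1 \<pi>1 \<phi>1" "represents \<Omega>2 V2 \<pi>2 \<phi>2"
  shows "bm_functional F1 F2 \<Omega>1 V1 \<pi>1 \<Omega>2 V2 \<pi>2 = bm_prod F1 F2 \<phi>1 \<phi>2"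
  unfolding bm_prod_def
  by (rule bm_functional_independent[OF assms(1,2,5,6) represents_std_rep[OF assms(3)] represents_std_rep[OF assms(4)]])

lemma clinear_bm_prod:
  fixes F1 :: "'a::complex_algebra faces" and F2 :: "'b::complex_algebra faces"
  assumes F: "two_faced F1" "two_faced F2" and lin: "clinear \<phi>1" "clinear \<phi>2"
  shows "clinear (bm_prod F1 F2 \<phi>1 \<phi>2)"
proof -
  let ?h = "bm_rep F1 F2 1 (std_compl \<phi>1) std_rep 1 (std_compl \<phi>2) std_rep"
  have pr: "pointed_rep 1 (std_compl \<phi>1) std_rep" "pointed_rep 1 (std_compl \<phi>2) std_rep"
    using represents_std_rep[OF lin(1)] represents_std_rep[OF lin(2)] by (simp_all add: represents_def)
  then have p: "pointed (1 :: 'a unitization) (std_compl \<phi>1)" "pointed (1 :: 'b unitization) (std_compl \<phi>2)"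
    by (simp_all add: pointed_rep_def)
  have h: "alg_hom ?h" using is_bm_rep_bm_rep[OF F pr] by (simp add: is_bm_rep_def)
  obtain \<kappa>1 where \<kappa>1: "clinear \<kappa>1" "\<kappa>1 1 = (1::complex)" "std_compl \<phi>1 = {v. \<kappa>1 v = 0}"
    using p(1) by (rule pointedE)
  obtain \<kappa>2 where \<kappa>2: "clinear \<kappa>2" "\<kappa>2 1 = (1::complex)" "std_compl \<phi>2 = {v. \<kappa>2 v = 0}"
    using p(2) by (rule pointedE)
  obtain \<kappa> where \<kappa>: "clinear \<kappa>" "\<And>v w. \<kappa> (v \<otimes> w) = \<kappa>1 v * \<kappa>2 w"
      "tensor_compl 1 (std_compl \<phi>1) 1 (std_compl \<phi>2) = {x. \<kappa> x = 0}"
    using tensor_compl_eq[OF \<kappa>1(1,2) \<kappa>2(1,2)] unfolding \<kappa>1(3) \<kappa>2(3) by blast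
  have "bm_prod F1 F2 \<phi>1 \<phi>2 = (\<lambda>x. \<kappa> (op_apply (?h x) (1 \<otimes> 1)))"
    unfolding bm_prod_def
    by (rule ext) (simp add: bm_functional_apply[OF \<kappa>(1) _ \<kappa>(3)] \<kappa>(2) \<kappa>1(2) \<kappa>2(2))
  then show ?thesis
    using h by (simp add: clinear_iff alg_hom_iff clinear_add[OF \<kappa>(1)] clinear_scale[OF \<kappa>(1)])
qed

end

theory Submission
  imports Defs
begin

text \<open>
  All four properties are read off from representations, using that the bi-monotone product of two
  functionals is the vacuum expectation of \<open>\<pi>1 \<bowtie> \<pi>2\<close> for any choice of pointed representations.

  The product restricts to its factors since \<open>v \<mapsto> v \<otimes> \<Omega>2\<close> intertwines \<open>\<pi>1\<close> with \<open>\<pi>1 \<bowtie> \<pi>2\<close> on \<open>A1\<close>,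
  because the vacuum projection \<open>P\<close> fixes \<open>\<Omega>2\<close>; similarly for \<open>A2\<close> (\<open>bm_rep_in1_vacuum\<close>,
  \<open>bm_rep_in2_vacuum\<close>). It is natural since \<open>(\<pi>1 \<bowtie> \<pi>2) \<circ> (j1 \<squnion> j2)\<close> is the bi-monotone product of
  \<open>\<pi>1 \<circ> j1\<close> and \<open>\<pi>2 \<circ> j2\<close> by uniqueness.

  The product is associative for the following reason. The representation \<open>\<pi>1 \<bowtie> \<pi>2\<close> represents the
  product functional (\<open>represents_bm_rep\<close>), so both iterated products are computed on a threefold
  tensor product, where the associator intertwines them as \<open>P\<close> for a tensor product of pointed
  spaces is \<open>P \<otimes> P\<close>. Speaking of iterated products presupposes that \<open>A1 \<squnion> A2\<close> is two-faced
  (\<open>two_faced_fp_faces\<close>), that is, freely generated by the product of the left faces and the product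
  of the right faces. This is shown on terms: every element of \<open>A1 \<squnion> A2\<close> is spelled over the four
  faces, and the spelling is unique up to the relations of the free product.

  The product of states is a state because it comes from a \<open>*\<close>-representation. A state on the
  unitization yields the positive semidefinite form \<open>\<phi>(x\<^sup>* y)\<close>, for which left multiplication is a
  \<open>*\<close>-representation and the vacuum projection is self-adjoint. The tensor product of two such forms
  is again positive semidefinite (\<open>psd_tensor_form\<close>), by Gram-Schmidt orthogonalization in the first
  factor. All operators that define \<open>\<pi>1 \<bowtie> \<pi>2\<close> then have the expected adjoints (\<open>bm_rep_adjoint\<close>), so
  the product functional evaluated at \<open>x\<^sup>* x\<close> is the squared length of the image of the vacuum under
  \<open>x\<close>.
\<close>

section \<open>Free products of two-faced algebras\<close>

text \<open>
  Terms over one pair of alphabets are rewritten into terms over another one by substituting terms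
  for leaves. This replaces a homomorphism into \<open>S \<squnion> T\<close>: for subalgebras \<open>S\<close> and \<open>T\<close> that free product is
  a set of equivalence classes of terms and not a type, so that the universal property of the free
  product of types does not apply to it.
\<close>
primrec fp_bind :: "('a \<Rightarrow> ('c, 'd) fp_term) \<Rightarrow> ('b \<Rightarrow> ('c, 'd) fp_term)
    \<Rightarrow> ('a, 'b) fp_term \<Rightarrow> ('c, 'd) fp_term" where
  "fp_bind f g (Leaf1 a) = f a"
| "fp_bind f g (Leaf2 b) = g b"
| "fp_bind f g TZero = TZero"
| "fp_bind f g (TPlus s t) = TPlus (fp_bind f g s) (fp_bind f g t)"
| "fp_bind f g (TScale c s) = TScale c (fp_bind f g s)"
| "fp_bind f g (TMult s t) = TMult (fp_bind f g s) (fp_bind f g t)"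

text \<open>
  A map that sends the elements of \<open>C\<close> to terms and that becomes a partial homomorphism
  \<open>C \<rightarrow> S \<squnion> T\<close> after passing to congruence classes.
\<close>
definition term_hom :: "'c::complex_algebra set \<Rightarrow> 'd::complex_algebra set \<Rightarrow> 'a::complex_algebra set
    \<Rightarrow> ('a \<Rightarrow> ('c, 'd) fp_term) \<Rightarrow> bool" where
  "term_hom S T C f \<longleftrightarrow> (\<forall>a\<in>C. f a \<in> fp_terms S T)
     \<and> (\<forall>a\<in>C. \<forall>b\<in>C. a + b \<in> C \<longrightarrow> fp_rel S T {} (f (a + b)) (TPlus (f a) (f b)))
     \<and> (\<forall>a\<in>C. \<forall>c. c *\<^sub>C a \<in> C \<longrightarrow> fp_rel S T {} (f (c *\<^sub>C a)) (TScale c (f a)))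
     \<and> (\<forall>a\<in>C. \<forall>b\<in>C. a * b \<in> C \<longrightarrow> fp_rel S T {} (f (a * b)) (TMult (f a) (f b)))"

lemma fp_bind_terms:
  assumes "\<And>a. a \<in> C \<Longrightarrow> f a \<in> fp_terms S T" "\<And>b. b \<in> D \<Longrightarrow> g b \<in> fp_terms S T" "t \<in> fp_terms C D"
  shows "fp_bind f g t \<in> fp_terms S T"
  using assms(3) by (induction t) (auto simp: assms(1,2))

lemma fp_rel_bind:
  assumes "term_hom S T C f" "term_hom S T D g" "fp_rel C D {} s t"
  shows "fp_rel S T {} (fp_bind f g s) (fp_bind f g t)"
proof -
  have terms: "fp_bind f g u \<in> fp_terms S T" if "u \<in> fp_terms C D" for u
    by (rule fp_bind_terms[OF _ _ that]) (use assms(1,2) in \<open>auto simp: term_hom_def\<close>)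
  from assms(3) show ?thesis
    by (induction rule: fp_rel.induct)
      (use assms(1,2) in \<open>auto simp: term_hom_def intro: fp_rel.intros terms\<close>)
qed

lemma fp_eval_bind:
  assumes "t \<in> fp_terms C D" "\<And>a. a \<in> C \<Longrightarrow> fp_eval f g (k a) = f' a" "\<And>b. b \<in> D \<Longrightarrow> fp_eval f g (l b) = g' b"
  shows "fp_eval f g (fp_bind k l t) = fp_eval f' g' t"
  using assms(1) by (induction t) (auto simp: assms(2,3))

text \<open>
  A map \<open>\<sigma>\<close> that spells every element as a term over the faces is an inverse of the canonical map,
  provided that spelling the value of a term gives back a congruent term.
\<close>
lemma two_facedI:
  assumes sub: "subalgebra S" "subalgebra T"
    and spell: "\<And>x. \<sigma> x \<in> fp_terms S T" "\<And>x. fp_eval id id (\<sigma> x) = x"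
      "\<And>s. s \<in> fp_terms S T \<Longrightarrow> fp_rel S T {} (\<sigma> (fp_eval id id s)) s"
  shows "two_faced (S, T)"
  unfolding two_faced_def
proof (intro conjI)
  show "bij_betw canonical_map (fp_carrier (fst (S, T)) (snd (S, T))) UNIV"
  proof (rule bij_betw_imageI)
    let ?r = "{(s, t). fp_rel S T {} s t}"
    have r: "?r `` {s} = ?r `` {t}" if "fp_rel S T {} s t" for s t
      using that by (auto intro: fp_rel.sym fp_rel.trans)
    show "inj_on canonical_map (fp_carrier (fst (S, T)) (snd (S, T)))"
    proof (rule inj_onI)
      fix X Y assume XY: "X \<in> fp_carrier (fst (S, T)) (snd (S, T))" "Y \<in> fp_carrier (fst (S, T)) (snd (S, T))"
        and eq: "canonical_map X = canonical_map Y"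
      obtain s where s: "s \<in> fp_terms S T" "X = ?r `` {s}"
        using XY(1) by (auto simp: fp_carrier_def elim: quotientE)
      obtain t where t: "t \<in> fp_terms S T" "Y = ?r `` {t}"
        using XY(2) by (auto simp: fp_carrier_def elim: quotientE)
      have e: "fp_eval id id s = fp_eval id id t"
        using eq unfolding s(2) t(2) canonical_map_eval[OF s(1)] canonical_map_eval[OF t(1)] .
      have "fp_rel S T {} (\<sigma> (fp_eval id id s)) t" unfolding e by (rule spell(3)[OF t(1)])
      with spell(3)[OF s(1)] have "fp_rel S T {} s t" by (blast intro: fp_rel.sym fp_rel.trans)
      then show "X = Y" unfolding s(2) t(2) by (rule r)
    qed
    show "canonical_map ` fp_carrier (fst (S, T)) (snd (S, T)) = UNIV"
    proof (intro set_eqI iffI UNIV_I)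
      fix x
      have "?r `` {\<sigma> x} \<in> fp_carrier S T" by (simp only: fp_carrier_def quotientI[OF spell(1)])
      moreover have "canonical_map (?r `` {\<sigma> x}) = x"
        using spell by (simp only: canonical_map_eval)
      ultimately show "x \<in> canonical_map ` fp_carrier (fst (S, T)) (snd (S, T))"
        by (metis fst_conv snd_conv imageI)
    qed
  qed
qed (simp_all add: sub)

text \<open>
  A two-faced algebra is the free product of its faces, so a homomorphism \<open>i\<close> that maps the faces into
  \<open>S\<close> and \<open>T\<close> lifts to \<open>S \<squnion> T\<close>. The lift sends \<open>a\<close> to any spelling of \<open>a\<close> over the faces, with \<open>i\<close>
  applied to its letters; a different spelling gives a congruent term because the canonical map of
  a two-faced algebra is injective.
\<close>
lemma two_faced_spelling:
  assumes F: "two_faced F" and i: "alg_hom i" "i ` fst F \<subseteq> S" "i ` snd F \<subseteq> T"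
  obtains f where "term_hom S T UNIV f" "\<And>a. fp_eval id id (f a) = i a"
    "\<And>a. a \<in> fst F \<Longrightarrow> fp_rel S T {} (f a) (Leaf1 (i a))"
    "\<And>a. a \<in> snd F \<Longrightarrow> fp_rel S T {} (f a) (Leaf2 (i a))"
proof -
  let ?T = "fp_terms (fst F) (snd F)" and ?m = "fp_bind (Leaf1 \<circ> i) (Leaf2 \<circ> i)"
  have "\<exists>t\<in>?T. a = fp_eval id id t" for a by (metis two_faced_cases[OF F])
  then obtain r where r: "\<And>a. r a \<in> ?T" "\<And>a. a = fp_eval id id (r a)" by metis
  have m: "term_hom S T (fst F) (Leaf1 \<circ> i)" "term_hom S T (snd F) (Leaf2 \<circ> i)"
    unfolding term_hom_def using i
    by (auto simp: alg_hom_iff subset_iff image_iff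
        intro!: fp_rel.leaf1_plus fp_rel.leaf1_scale fp_rel.leaf1_mult fp_rel.leaf2_plus
          fp_rel.leaf2_scale fp_rel.leaf2_mult; metis)+
  have m_rel: "fp_rel S T {} (?m (r a)) (?m t)" if "t \<in> ?T" "fp_eval id id t = a" for a t
    by (rule fp_rel_bind[OF m two_faced_rel[OF F r(1) that(1)]]) (simp add: that(2) flip: r(2))
  show ?thesis
  proof (rule that[of "\<lambda>a. ?m (r a)"])
    have "?m (r a) \<in> fp_terms S T" for a
      by (rule fp_bind_terms[OF _ _ r(1)]) (use i in auto)
    moreover have "fp_rel S T {} (?m (r (a + b))) (TPlus (?m (r a)) (?m (r b)))" for a b
      using m_rel[of "TPlus (r a) (r b)"] r by simp
    moreover have "fp_rel S T {} (?m (r (c *\<^sub>C a))) (TScale c (?m (r a)))" for a c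
      using m_rel[of "TScale c (r a)"] r by simp
    moreover have "fp_rel S T {} (?m (r (a * b))) (TMult (?m (r a)) (?m (r b)))" for a b
      using m_rel[of "TMult (r a) (r b)"] r by simp
    ultimately show "term_hom S T UNIV (\<lambda>a. ?m (r a))" by (simp add: term_hom_def)
    show "fp_eval id id (?m (r a)) = i a" for a
    proof -
      have "fp_eval id id (?m (r a)) = fp_eval i i (r a)" by (rule fp_eval_bind[OF r(1)]) simp_all
      also have "\<dots> = i a" using fp_eval_hom[OF i(1), of id id "r a"] r(2) by simp
      finally show ?thesis .
    qed
    show "fp_rel S T {} (?m (r a)) (Leaf1 (i a))" if "a \<in> fst F" for a
      using m_rel[of "Leaf1 a"] that by simp
    show "fp_rel S T {} (?m (r a)) (Leaf2 (i a))" if "a \<in> snd F" for a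
      using m_rel[of "Leaf2 a"] that by simp
  qed
qed

lemma fp_sub_eq: "fp_sub S T = fp_eval in1 in2 ` fp_terms S T"
  by (simp add: fp_sub_def abs_free_prod_eval)

lemma fp_subI: "t \<in> fp_terms S T \<Longrightarrow> fp_eval in1 in2 t \<in> fp_sub S T"
  by (simp add: fp_sub_eq)

lemma in_fp_sub: "a \<in> S \<Longrightarrow> in1 a \<in> fp_sub S T" "b \<in> T \<Longrightarrow> in2 b \<in> fp_sub S T"
  using fp_subI[of "Leaf1 a" S T] fp_subI[of "Leaf2 b" S T] by simp_all

lemma subalgebra_fp_sub: "subalgebra (fp_sub S T)"
  unfolding subalgebra_def cvs.subspace_def
proof (intro conjI ballI allI)
  show "0 \<in> fp_sub S T" using fp_subI[of TZero S T] by simp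
  fix x assume "x \<in> fp_sub S T"
  then obtain s where s: "s \<in> fp_terms S T" "x = fp_eval in1 in2 s" by (auto simp: fp_sub_eq)
  show "c *\<^sub>C x \<in> fp_sub S T" for c using fp_subI[of "TScale c s" S T] s by simp
  fix y assume "y \<in> fp_sub S T"
  then obtain t where t: "t \<in> fp_terms S T" "y = fp_eval in1 in2 t" by (auto simp: fp_sub_eq)
  show "x + y \<in> fp_sub S T" "x * y \<in> fp_sub S T"
    using fp_subI[of "TPlus s t" S T] fp_subI[of "TMult s t" S T] s t by simp_all
qed

lemma fp_rel_zero:
  assumes "s \<in> fp_terms S T" shows "fp_rel S T E (TScale 0 s) TZero"
proof -
  have "fp_rel S T E (TScale (-1 + 1) s) (TPlus (TScale (-1) s) (TScale 1 s))"
    by (rule fp_rel.plus_scale[OF assms])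
  moreover have "fp_rel S T E \<dots> (TPlus (TScale (-1) s) s)"
    by (intro fp_rel.plus_cong fp_rel.refl fp_rel.scale_one) (use assms in simp_all)
  moreover have "fp_rel S T E \<dots> TZero" by (rule fp_rel.plus_minus[OF assms])
  ultimately show ?thesis by (simp, blast intro: fp_rel.trans)
qed

text \<open>
  If \<open>L\<close> is a homomorphism up to congruence on a subalgebra \<open>H\<close> and the substitution agrees with \<open>L\<close> on
  the letters of a term, then both agree on the element that the term denotes. With \<open>L\<close> being one of
  the two leaf constructors, it says that a left element of \<open>A1 \<squnion> A2\<close>, which is built from left
  elements of \<open>A1\<close> and \<open>A2\<close>, is spelled by its own leaf
  up to congruence.
\<close>
lemma fp_bind_respects_subalgebra:
  assumes L: "term_hom S T H L" and H: "subalgebra H"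
    and f: "\<And>a. a \<in> C \<Longrightarrow> in1 a \<in> H \<and> fp_rel S T {} (f a) (L (in1 a))"
    and g: "\<And>b. b \<in> D \<Longrightarrow> in2 b \<in> H \<and> fp_rel S T {} (g b) (L (in2 b))"
    and t: "t \<in> fp_terms C D"
  shows "fp_eval in1 in2 t \<in> H \<and> fp_rel S T {} (fp_bind f g t) (L (fp_eval in1 in2 t))"
  using t
proof (induction t)
  case TZero
  have 0: "0 \<in> H" using H by (simp add: subalgebra_def cvs.subspace_0)
  then have L0: "L 0 \<in> fp_terms S T" using L by (simp add: term_hom_def)
  have "fp_rel S T {} (L (0 *\<^sub>C 0)) (TScale 0 (L 0))"
    using L 0 unfolding term_hom_def by (metis cvs.scale_zero_right)
  then have "fp_rel S T {} (L 0) TZero" using fp_rel_zero[OF L0] by (auto intro: fp_rel.trans)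
  then show ?case using 0 by (simp add: fp_rel.sym)
next
  case (TPlus s t)
  then have IH: "(fp_eval in1 in2 s) \<in> H" "fp_rel S T {} (fp_bind f g s) (L (fp_eval in1 in2 s))"
    "(fp_eval in1 in2 t) \<in> H" "fp_rel S T {} (fp_bind f g t) (L (fp_eval in1 in2 t))" by auto
  have "(fp_eval in1 in2 s) + (fp_eval in1 in2 t) \<in> H"
    using H IH by (simp add: subalgebra_def cvs.subspace_add)
  moreover from this have "fp_rel S T {} (L ((fp_eval in1 in2 s) + (fp_eval in1 in2 t)))
      (TPlus (L (fp_eval in1 in2 s)) (L (fp_eval in1 in2 t)))"
    using L IH by (simp add: term_hom_def)
  ultimately show ?case
    using fp_rel.plus_cong[OF IH(2,4)] by (auto intro: fp_rel.trans fp_rel.sym)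
next
  case (TScale c s)
  then have IH: "(fp_eval in1 in2 s) \<in> H" "fp_rel S T {} (fp_bind f g s) (L (fp_eval in1 in2 s))" by auto
  have "c *\<^sub>C (fp_eval in1 in2 s) \<in> H"
    using H IH by (simp add: subalgebra_def cvs.subspace_scale)
  moreover from this have "fp_rel S T {} (L (c *\<^sub>C (fp_eval in1 in2 s)))
      (TScale c (L (fp_eval in1 in2 s)))"
    using L IH by (simp add: term_hom_def)
  ultimately show ?case
    using fp_rel.scale_cong[OF IH(2)] by (auto intro: fp_rel.trans fp_rel.sym)
next
  case (TMult s t)
  then have IH: "(fp_eval in1 in2 s) \<in> H" "fp_rel S T {} (fp_bind f g s) (L (fp_eval in1 in2 s))"
    "(fp_eval in1 in2 t) \<in> H" "fp_rel S T {} (fp_bind f g t) (L (fp_eval in1 in2 t))" by auto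
  have "(fp_eval in1 in2 s) * (fp_eval in1 in2 t) \<in> H"
    using H IH by (simp add: subalgebra_def)
  moreover from this have "fp_rel S T {} (L ((fp_eval in1 in2 s) * (fp_eval in1 in2 t)))
      (TMult (L (fp_eval in1 in2 s)) (L (fp_eval in1 in2 t)))"
    using L IH by (simp add: term_hom_def)
  ultimately show ?case
    using fp_rel.mult_cong[OF IH(2,4)] by (auto intro: fp_rel.trans fp_rel.sym)
qed (use f g in auto)

text \<open>
  By associativity and commutativity of free products \<open>A1 \<squnion> A2\<close> is the free product of the four
  faces, hence of the algebra generated by the left faces and the one generated by the right faces.
  Concretely, an element is spelled by choosing a term over \<open>A1\<close> and \<open>A2\<close> and replacing each of its
  letters by a spelling of that letter over the faces.
\<close>
theorem two_faced_fp_faces: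
  fixes F1 :: "'a::complex_algebra faces" and F2 :: "'b::complex_algebra faces"
  assumes F1: "two_faced F1" and F2: "two_faced F2"
  shows "two_faced (fp_faces F1 F2)"
proof -
  let ?S = "fp_sub (fst F1) (fst F2)" and ?T = "fp_sub (snd F1) (snd F2)"
  let ?R = "fp_rel ?S ?T {}"
  have faces: "in1 ` fst F1 \<subseteq> ?S" "in1 ` snd F1 \<subseteq> ?T" "in2 ` fst F2 \<subseteq> ?S" "in2 ` snd F2 \<subseteq> ?T"
    by (auto simp: in_fp_sub)
  obtain f where f: "term_hom ?S ?T UNIV f" "\<And>a. fp_eval id id (f a) = in1 a"
      "\<And>a. a \<in> fst F1 \<Longrightarrow> ?R (f a) (Leaf1 (in1 a))" "\<And>a. a \<in> snd F1 \<Longrightarrow> ?R (f a) (Leaf2 (in1 a))"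
    by (rule two_faced_spelling[OF F1 alg_hom_in1 faces(1,2)]) (rule that)
  obtain g where g: "term_hom ?S ?T UNIV g" "\<And>b. fp_eval id id (g b) = in2 b"
      "\<And>b. b \<in> fst F2 \<Longrightarrow> ?R (g b) (Leaf1 (in2 b))" "\<And>b. b \<in> snd F2 \<Longrightarrow> ?R (g b) (Leaf2 (in2 b))"
    by (rule two_faced_spelling[OF F2 alg_hom_in2 faces(3,4)]) (rule that)
  define \<sigma> where "\<sigma> x = fp_bind f g (rep_free_prod x)" for x
  have terms: "fp_bind f g t \<in> fp_terms ?S ?T" for t
    by (rule fp_bind_terms[of UNIV _ _ _ UNIV]) (use f(1) g(1) in \<open>auto simp: term_hom_def\<close>)
  have eval: "fp_eval id id (fp_bind f g t) = fp_eval in1 in2 t" for t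
    by (rule fp_eval_bind[of _ UNIV UNIV]) (simp_all add: f g)
  have \<sigma>: "?R (\<sigma> (fp_eval in1 in2 t)) (fp_bind f g t)" for t
  proof -
    have "fp_rel UNIV UNIV {} (rep_free_prod (abs_free_prod t)) t"
      by (simp add: Quotient3_abs_rep[OF Quotient3_free_prod] flip: free_prod.abs_eq_iff)
    then show ?thesis
      unfolding \<sigma>_def abs_free_prod_eval[symmetric] by (rule fp_rel_bind[OF f(1) g(1)])
  qed
  have leaves: "term_hom ?S ?T ?S Leaf1" "term_hom ?S ?T ?T Leaf2"
    by (auto simp: term_hom_def intro: fp_rel.intros)
  have \<sigma>1: "?R (\<sigma> x) (Leaf1 x)" if "x \<in> ?S" for x
  proof -
    obtain t where t: "t \<in> fp_terms (fst F1) (fst F2)" "x = fp_eval in1 in2 t"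
      using \<open>x \<in> ?S\<close> by (auto simp: fp_sub_eq)
    have "?R (fp_bind f g t) (Leaf1 x)"
      using fp_bind_respects_subalgebra[OF leaves(1) subalgebra_fp_sub _ _ t(1), of f g] t(2) f(3) g(3)
      by (simp add: in_fp_sub)
    then show ?thesis using \<sigma>[of t] t(2) by (auto intro: fp_rel.trans)
  qed
  have \<sigma>2: "?R (\<sigma> x) (Leaf2 x)" if "x \<in> ?T" for x
  proof -
    obtain t where t: "t \<in> fp_terms (snd F1) (snd F2)" "x = fp_eval in1 in2 t"
      using \<open>x \<in> ?T\<close> by (auto simp: fp_sub_eq)
    have "?R (fp_bind f g t) (Leaf2 x)"
      using fp_bind_respects_subalgebra[OF leaves(2) subalgebra_fp_sub _ _ t(1), of f g] t(2) f(4) g(4)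
      by (simp add: in_fp_sub)
    then show ?thesis using \<sigma>[of t] t(2) by (auto intro: fp_rel.trans)
  qed
  have \<sigma>_hom: "?R (\<sigma> 0) TZero" "?R (\<sigma> (x + y)) (TPlus (\<sigma> x) (\<sigma> y))"
    "?R (\<sigma> (c *\<^sub>C x)) (TScale c (\<sigma> x))" "?R (\<sigma> (x * y)) (TMult (\<sigma> x) (\<sigma> y))" for x y c
  proof -
    have rep: "fp_eval in1 in2 (rep_free_prod x) = x" for x :: "('a, 'b) free_prod"
      by (simp add: Quotient3_abs_rep[OF Quotient3_free_prod] flip: abs_free_prod_eval)
    show "?R (\<sigma> 0) TZero" using \<sigma>[of TZero] by simp
    show "?R (\<sigma> (x + y)) (TPlus (\<sigma> x) (\<sigma> y))"
      using \<sigma>[of "TPlus (rep_free_prod x) (rep_free_prod y)"] by (simp add: rep \<sigma>_def[of x] \<sigma>_def[of y])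
    show "?R (\<sigma> (c *\<^sub>C x)) (TScale c (\<sigma> x))"
      using \<sigma>[of "TScale c (rep_free_prod x)"] by (simp add: rep \<sigma>_def[of x])
    show "?R (\<sigma> (x * y)) (TMult (\<sigma> x) (\<sigma> y))"
      using \<sigma>[of "TMult (rep_free_prod x) (rep_free_prod y)"] by (simp add: rep \<sigma>_def[of x] \<sigma>_def[of y])
  qed
  have "?R (\<sigma> (fp_eval id id s)) s" if "s \<in> fp_terms ?S ?T" for s
    using that
  proof (induction s)
    case (TPlus s t)
    then show ?case by (auto intro: fp_rel.trans[OF \<sigma>_hom(2)] fp_rel.plus_cong)
  next
    case (TScale c s)
    then show ?case by (auto intro: fp_rel.trans[OF \<sigma>_hom(3)] fp_rel.scale_cong)
  next
    case (TMult s t)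
    then show ?case by (auto intro: fp_rel.trans[OF \<sigma>_hom(4)] fp_rel.mult_cong)
  qed (auto simp: \<sigma>1 \<sigma>2 \<sigma>_hom(1))
  moreover have "fp_eval id id (\<sigma> x) = x" for x
    unfolding \<sigma>_def eval
    by (simp add: Quotient3_abs_rep[OF Quotient3_free_prod] flip: abs_free_prod_eval)
  ultimately show ?thesis
    unfolding fp_faces_def
    by (intro two_facedI[of _ _ \<sigma>]) (simp_all add: subalgebra_fp_sub terms \<sigma>_def)
qed

section \<open>Intertwining maps, unit law and naturality\<close>

text \<open>
  Every identity between bi-monotone products below comes from a linear map between the underlying
  spaces that intertwines two representations and respects the vacuum. Since the operators that are
  intertwined by \<open>\<alpha>\<close> are closed under the algebra operations, it suffices to check the faces.
\<close>
definition intertwines :: "('v::complex_vector \<Rightarrow> 'w::complex_vector) \<Rightarrow> 'v linop \<Rightarrow> 'w linop \<Rightarrow> bool" where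
  "intertwines \<alpha> f g \<longleftrightarrow> (\<forall>v. \<alpha> (op_apply f v) = op_apply g (\<alpha> v))"

lemma intertwines_eval:
  assumes "clinear \<alpha>" "t \<in> fp_terms S T"
    "\<And>a. a \<in> S \<Longrightarrow> intertwines \<alpha> (f a) (f' a)" "\<And>b. b \<in> T \<Longrightarrow> intertwines \<alpha> (g b) (g' b)"
  shows "intertwines \<alpha> (fp_eval f g t) (fp_eval f' g' t)"
  using assms(2)
  by (induction t) (use assms in \<open>auto simp: intertwines_def clinear_add clinear_scale clinear_0\<close>)

lemma intertwines_two_faced:
  assumes F: "two_faced F" and \<alpha>: "clinear \<alpha>" and hk: "alg_hom h" "alg_hom k"
    and "\<And>a. a \<in> fst F \<Longrightarrow> intertwines \<alpha> (h a) (k a)" "\<And>a. a \<in> snd F \<Longrightarrow> intertwines \<alpha> (h a) (k a)"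
  shows "intertwines \<alpha> (h a) (k a)"
proof -
  obtain t where t: "t \<in> fp_terms (fst F) (snd F)" "a = fp_eval id id t"
    using F by (rule two_faced_cases)
  have "intertwines \<alpha> (fp_eval h h t) (fp_eval k k t)"
    by (rule intertwines_eval[OF \<alpha> t(1)]) (fact assms(5,6))+
  then show ?thesis by (simp add: t(2) fp_eval_hom[OF hk(1)] fp_eval_hom[OF hk(2)])
qed

lemma intertwines_free_prod:
  assumes \<alpha>: "clinear \<alpha>" and hk: "alg_hom h" "alg_hom k"
    and "\<And>a. intertwines \<alpha> (h (in1 a)) (k (in1 a))" "\<And>b. intertwines \<alpha> (h (in2 b)) (k (in2 b))"
  shows "intertwines \<alpha> (h x) (k x)"
proof -
  obtain t where t: "x = fp_eval in1 in2 t" by (rule fp_cases)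
  have "intertwines \<alpha> (fp_eval (h \<circ> in1) (h \<circ> in2) t) (fp_eval (k \<circ> in1) (k \<circ> in2) t)"
    by (rule intertwines_eval[OF \<alpha>, of _ UNIV UNIV]) (use assms(4,5) in simp_all)
  then show ?thesis by (simp add: t fp_eval_hom[OF hk(1)] fp_eval_hom[OF hk(2)])
qed

lemma bm_rep_hom:
  assumes "two_faced F1" "two_faced F2" "pointed_rep \<Omega>1 V1 \<pi>1" "pointed_rep \<Omega>2 V2 \<pi>2"
  shows "alg_hom (bm_rep F1 F2 \<Omega>1 V1 \<pi>1 \<Omega>2 V2 \<pi>2)"
    and "a \<in> fst F1 \<Longrightarrow> bm_rep F1 F2 \<Omega>1 V1 \<pi>1 \<Omega>2 V2 \<pi>2 (in1 a) = tensor_op (\<pi>1 a) 1"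
    and "a \<in> snd F1 \<Longrightarrow> bm_rep F1 F2 \<Omega>1 V1 \<pi>1 \<Omega>2 V2 \<pi>2 (in1 a) = tensor_op (\<pi>1 a) (vac_proj \<Omega>2 V2)"
    and "b \<in> snd F2 \<Longrightarrow> bm_rep F1 F2 \<Omega>1 V1 \<pi>1 \<Omega>2 V2 \<pi>2 (in2 b) = tensor_op 1 (\<pi>2 b)"
    and "b \<in> fst F2 \<Longrightarrow> bm_rep F1 F2 \<Omega>1 V1 \<pi>1 \<Omega>2 V2 \<pi>2 (in2 b) = tensor_op (vac_proj \<Omega>1 V1) (\<pi>2 b)"
  using is_bm_rep_bm_rep[OF assms] by (simp_all add: is_bm_rep_def)

lemma vac_proj_vacuum:
  assumes "pointed \<Omega> V" shows "op_apply (vac_proj \<Omega> V) \<Omega> = \<Omega>"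
  using assms by (elim pointedE) (simp add: vac_proj_apply)

text \<open>
  Since \<open>P\<close> fixes \<open>\<Omega>2\<close>, the left and the right elements of \<open>A1\<close> act alike on vectors \<open>v \<otimes> \<Omega>2\<close>: the map
  \<open>v \<mapsto> v \<otimes> \<Omega>2\<close> intertwines \<open>\<pi>1\<close> with the restriction of \<open>\<pi>1 \<bowtie> \<pi>2\<close> to \<open>A1\<close>.
\<close>
lemma bm_rep_in1_vacuum:
  assumes F: "two_faced F1" "two_faced F2"
    and p: "pointed_rep \<Omega>1 V1 \<pi>1" "pointed_rep \<Omega>2 V2 \<pi>2"
  shows "op_apply (bm_rep F1 F2 \<Omega>1 V1 \<pi>1 \<Omega>2 V2 \<pi>2 (in1 a)) (v \<otimes> \<Omega>2) = op_apply (\<pi>1 a) v \<otimes> \<Omega>2"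
proof -
  let ?h = "bm_rep F1 F2 \<Omega>1 V1 \<pi>1 \<Omega>2 V2 \<pi>2"
  have "intertwines (\<lambda>v. v \<otimes> \<Omega>2) (\<pi>1 a) ((?h \<circ> in1) a)"
  proof (rule intertwines_two_faced[OF F(1)])
    show "clinear (\<lambda>v. v \<otimes> \<Omega>2)" by (simp add: clinear_iff pure_tensor_bilinear)
    show "alg_hom \<pi>1" "alg_hom (?h \<circ> in1)"
      using p by (simp_all add: pointed_rep_def alg_hom_comp bm_rep_hom(1)[OF F p] alg_hom_in1)
  qed (use p in \<open>simp_all add: intertwines_def bm_rep_hom[OF F p] vac_proj_vacuum pointed_rep_def\<close>)
  then show ?thesis by (simp add: intertwines_def)
qed

lemma bm_rep_in2_vacuum:
  assumes F: "two_faced F1" "two_faced F2"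
    and p: "pointed_rep \<Omega>1 V1 \<pi>1" "pointed_rep \<Omega>2 V2 \<pi>2"
  shows "op_apply (bm_rep F1 F2 \<Omega>1 V1 \<pi>1 \<Omega>2 V2 \<pi>2 (in2 b)) (\<Omega>1 \<otimes> w) = \<Omega>1 \<otimes> op_apply (\<pi>2 b) w"
proof -
  let ?h = "bm_rep F1 F2 \<Omega>1 V1 \<pi>1 \<Omega>2 V2 \<pi>2"
  have "intertwines (\<lambda>w. \<Omega>1 \<otimes> w) (\<pi>2 b) ((?h \<circ> in2) b)"
  proof (rule intertwines_two_faced[OF F(2)])
    show "clinear (\<lambda>w. \<Omega>1 \<otimes> w)" by (simp add: clinear_iff pure_tensor_bilinear)
    show "alg_hom \<pi>2" "alg_hom (?h \<circ> in2)"
      using p by (simp_all add: pointed_rep_def alg_hom_comp bm_rep_hom(1)[OF F p] alg_hom_in2)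
  qed (use p in \<open>simp_all add: intertwines_def bm_rep_hom[OF F p] vac_proj_vacuum pointed_rep_def\<close>)
  then show ?thesis by (simp add: intertwines_def)
qed

lemma represents_coeff:
  assumes "represents \<Omega> {v. \<kappa> v = 0} \<pi> \<phi>" "clinear \<kappa>" "\<kappa> \<Omega> = (1::complex)"
  shows "\<phi> a = \<kappa> (op_apply (\<pi> a) \<Omega>)"
proof -
  have "\<Omega> \<noteq> 0" using assms(1) by (simp add: represents_def pointed_rep_def pointed_def)
  then show ?thesis
    using assms(1) by (simp add: represents_def vac_proj_apply[OF assms(2,3)])
qed

text \<open>
  The product representation is itself a pointed representation of the product functional. This is
  what makes iterated products accessible: they may be computed from iterated tensor products
  instead of the standard representation of \<open>A1 \<squnion> A2\<close>.
\<close>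
lemma represents_bm_rep:
  assumes F: "two_faced F1" "two_faced F2" and \<phi>: "clinear \<phi>1" "clinear \<phi>2"
    and r: "represents \<Omega>1 V1 \<pi>1 \<phi>1" "represents \<Omega>2 V2 \<pi>2 \<phi>2"
  shows "represents (\<Omega>1 \<otimes> \<Omega>2) (tensor_compl \<Omega>1 V1 \<Omega>2 V2) (bm_rep F1 F2 \<Omega>1 V1 \<pi>1 \<Omega>2 V2 \<pi>2)
    (bm_prod F1 F2 \<phi>1 \<phi>2)"
proof -
  have p: "pointed_rep \<Omega>1 V1 \<pi>1" "pointed_rep \<Omega>2 V2 \<pi>2" using r by (simp_all add: represents_def)
  obtain \<kappa>1 where \<kappa>1: "clinear \<kappa>1" "\<kappa>1 \<Omega>1 = (1::complex)" "V1 = {v. \<kappa>1 v = 0}"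
    using p(1) unfolding pointed_rep_def by (auto elim: pointedE)
  obtain \<kappa>2 where \<kappa>2: "clinear \<kappa>2" "\<kappa>2 \<Omega>2 = (1::complex)" "V2 = {v. \<kappa>2 v = 0}"
    using p(2) unfolding pointed_rep_def by (auto elim: pointedE)
  obtain \<kappa> where \<kappa>: "clinear \<kappa>" "\<And>v w. \<kappa> (v \<otimes> w) = \<kappa>1 v * \<kappa>2 w" "tensor_compl \<Omega>1 V1 \<Omega>2 V2 = {x. \<kappa> x = 0}"
    using tensor_compl_eq[OF \<kappa>1(1,2) \<kappa>2(1,2)] unfolding \<kappa>1(3) \<kappa>2(3) by blast
  have 1: "\<kappa> (\<Omega>1 \<otimes> \<Omega>2) = 1" by (simp add: \<kappa> \<kappa>1 \<kappa>2)
  show ?thesis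
    using bm_functional_apply[OF \<kappa>(1) 1 \<kappa>(3), of F1 F2 \<pi>1 \<pi>2]
    by (simp add: represents_def pointed_rep_def bm_rep_hom(1)[OF F p] \<kappa>(3) pointedI[OF \<kappa>(1) 1]
        vac_proj_apply[OF \<kappa>(1) 1] bm_functional_eq_bm_prod[OF F \<phi> r, symmetric])
qed

theorem bm_prod_in:
  assumes F: "two_faced F1" "two_faced F2" and \<phi>: "clinear \<phi>1" "clinear \<phi>2"
  shows "bm_prod F1 F2 \<phi>1 \<phi>2 \<circ> in1 = \<phi>1" "bm_prod F1 F2 \<phi>1 \<phi>2 \<circ> in2 = \<phi>2"
proof -
  note r = represents_std_rep[OF \<phi>(1)] represents_std_rep[OF \<phi>(2)]
  have p: "pointed_rep 1 (std_compl \<phi>1) std_rep" "pointed_rep 1 (std_compl \<phi>2) std_rep"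
    using r by (simp_all add: represents_def)
  obtain \<kappa>1 where \<kappa>1: "clinear \<kappa>1" "\<kappa>1 1 = (1::complex)" "std_compl \<phi>1 = {v. \<kappa>1 v = 0}"
    using p(1) unfolding pointed_rep_def by (auto elim: pointedE)
  obtain \<kappa>2 where \<kappa>2: "clinear \<kappa>2" "\<kappa>2 1 = (1::complex)" "std_compl \<phi>2 = {v. \<kappa>2 v = 0}"
    using p(2) unfolding pointed_rep_def by (auto elim: pointedE)
  obtain \<kappa> where \<kappa>: "clinear \<kappa>" "\<And>v w. \<kappa> (v \<otimes> w) = \<kappa>1 v * \<kappa>2 w"
      "tensor_compl 1 (std_compl \<phi>1) 1 (std_compl \<phi>2) = {x. \<kappa> x = 0}"
    using tensor_compl_eq[OF \<kappa>1(1,2) \<kappa>2(1,2)] unfolding \<kappa>1(3) \<kappa>2(3) by blast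
  note eq = represents_coeff[OF represents_bm_rep[OF F \<phi> r, unfolded \<kappa>(3)] \<kappa>(1)]
  have "bm_prod F1 F2 \<phi>1 \<phi>2 (in1 a) = \<phi>1 a" for a
    by (simp add: eq \<kappa>(2) \<kappa>1(2) \<kappa>2(2) bm_rep_in1_vacuum[OF F p]
        represents_coeff[OF r(1)[unfolded \<kappa>1(3)] \<kappa>1(1,2)])
  moreover have "bm_prod F1 F2 \<phi>1 \<phi>2 (in2 b) = \<phi>2 b" for b
    by (simp add: eq \<kappa>(2) \<kappa>1(2) \<kappa>2(2) bm_rep_in2_vacuum[OF F p]
        represents_coeff[OF r(2)[unfolded \<kappa>2(3)] \<kappa>2(1,2)])
  ultimately show "bm_prod F1 F2 \<phi>1 \<phi>2 \<circ> in1 = \<phi>1" "bm_prod F1 F2 \<phi>1 \<phi>2 \<circ> in2 = \<phi>2" by auto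
qed

lemma bm_rep_unique:
  assumes F: "two_faced F1" "two_faced F2"
    and p: "pointed_rep \<Omega>1 V1 \<pi>1" "pointed_rep \<Omega>2 V2 \<pi>2"
    and h: "is_bm_rep F1 F2 \<Omega>1 V1 \<pi>1 \<Omega>2 V2 \<pi>2 h"
  shows "h = bm_rep F1 F2 \<Omega>1 V1 \<pi>1 \<Omega>2 V2 \<pi>2" (is "h = ?k")
proof -
  have hh: "alg_hom h" using h by (simp add: is_bm_rep_def)
  have "h \<circ> in1 = ?k \<circ> in1"
    by (rule two_faced_hom_eqI[OF F(1)])
      (use h in \<open>simp_all add: is_bm_rep_def alg_hom_comp alg_hom_in1 bm_rep_hom[OF F p]\<close>)
  moreover have "h \<circ> in2 = ?k \<circ> in2"
    by (rule two_faced_hom_eqI[OF F(2)])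
      (use h in \<open>simp_all add: is_bm_rep_def alg_hom_comp alg_hom_in2 bm_rep_hom[OF F p]\<close>)
  ultimately show ?thesis
    by (intro fp_hom_eqI hh bm_rep_hom(1)[OF F p]) (metis comp_apply)+
qed

text \<open>
  If \<open>\<pi>\<^sub>i\<close> represents \<open>\<phi>\<^sub>i\<close>, then \<open>\<pi>\<^sub>i \<circ> j\<^sub>i\<close> represents \<open>\<phi>\<^sub>i \<circ> j\<^sub>i\<close> on the same pointed space, and
  \<open>(\<pi>1 \<bowtie> \<pi>2) \<circ> (j1 \<squnion> j2)\<close> satisfies the defining conditions of \<open>(\<pi>1 \<circ> j1) \<bowtie> (\<pi>2 \<circ> j2)\<close> because the
  \<open>j\<^sub>i\<close> respect the faces.
\<close>
theorem bm_prod_natural: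
  fixes F1 :: "'a::complex_algebra faces" and F2 :: "'b::complex_algebra faces"
  assumes F: "two_faced F1" "two_faced F2" and G: "two_faced G1" "two_faced G2"
    and \<phi>: "clinear \<phi>1" "clinear \<phi>2"
    and j: "two_faced_hom G1 F1 j1" "two_faced_hom G2 F2 j2"
  shows "bm_prod F1 F2 \<phi>1 \<phi>2 \<circ> fp_map j1 j2 = bm_prod G1 G2 (\<phi>1 \<circ> j1) (\<phi>2 \<circ> j2)"
proof -
  let ?V1 = "std_compl \<phi>1" and ?V2 = "std_compl \<phi>2"
  let ?F = "bm_rep F1 F2 1 ?V1 std_rep 1 ?V2 std_rep"
  let ?G = "bm_rep G1 G2 1 ?V1 (std_rep \<circ> j1) 1 ?V2 (std_rep \<circ> j2)"
  note r = represents_std_rep[OF \<phi>(1)] represents_std_rep[OF \<phi>(2)]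
  have jh: "alg_hom j1" "alg_hom j2" using j by (simp_all add: two_faced_hom_def)
  have r': "represents 1 ?V1 (std_rep \<circ> j1) (\<phi>1 \<circ> j1)" "represents 1 ?V2 (std_rep \<circ> j2) (\<phi>2 \<circ> j2)"
    using r jh by (simp_all add: represents_def pointed_rep_def alg_hom_comp)
  have p: "pointed_rep 1 ?V1 std_rep" "pointed_rep 1 ?V2 std_rep"
    "pointed_rep 1 ?V1 (std_rep \<circ> j1)" "pointed_rep 1 ?V2 (std_rep \<circ> j2)"
    using r r' by (simp_all add: represents_def)
  have in_hom: "alg_hom (in1 \<circ> j1 :: _ \<Rightarrow> ('a, 'b) free_prod)" "alg_hom (in2 \<circ> j2 :: _ \<Rightarrow> ('a, 'b) free_prod)"
    using jh by (simp_all add: alg_hom_comp alg_hom_in1 alg_hom_in2)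
  have map: "alg_hom (fp_map j1 j2)" "\<And>a. fp_map j1 j2 (in1 a) = in1 (j1 a)" "\<And>b. fp_map j1 j2 (in2 b) = in2 (j2 b)"
    using in_hom by (simp_all add: fp_map_def alg_hom_fp_lift)
  have "is_bm_rep G1 G2 1 ?V1 (std_rep \<circ> j1) 1 ?V2 (std_rep \<circ> j2) (?F \<circ> fp_map j1 j2)"
    using j unfolding is_bm_rep_def two_faced_hom_def
    by (auto simp: map alg_hom_comp bm_rep_hom(1)[OF F p(1,2)] image_subset_iff bm_rep_hom(2-5)[OF F p(1,2)])
  then have eq: "?F \<circ> fp_map j1 j2 = ?G" by (rule bm_rep_unique[OF G p(3,4)])
  have lin: "clinear (\<phi>1 \<circ> j1)" "clinear (\<phi>2 \<circ> j2)"
    using \<phi> jh by (simp_all add: clinear_iff alg_hom_iff)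
  have "bm_prod G1 G2 (\<phi>1 \<circ> j1) (\<phi>2 \<circ> j2) = bm_functional G1 G2 1 ?V1 (std_rep \<circ> j1) 1 ?V2 (std_rep \<circ> j2)"
    by (rule bm_functional_eq_bm_prod[OF G lin r', symmetric])
  also have "\<dots> = bm_prod F1 F2 \<phi>1 \<phi>2 \<circ> fp_map j1 j2"
    by (rule ext) (simp add: bm_prod_def bm_functional_def flip: eq)
  finally show ?thesis ..
qed

section \<open>Associativity\<close>

lemma tensor_clinear_eqI:
  assumes "clinear f" "clinear g" "\<And>v w. f (v \<otimes> w) = g (v \<otimes> w)"
  shows "f x = g x"
  by (induction x rule: tensor_induct)
    (simp_all add: assms(3) clinear_add[OF assms(1)] clinear_add[OF assms(2)]
      clinear_scale[OF assms(1)] clinear_scale[OF assms(2)] clinear_0[OF assms(1)] clinear_0[OF assms(2)])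

lemma tensor_associator:
  obtains \<alpha> where "clinear \<alpha>"
    "\<And>u v w. \<alpha> ((u \<otimes> v) \<otimes> w) = (u :: 'u::complex_vector) \<otimes> ((v :: 'v::complex_vector) \<otimes> (w :: 'w::complex_vector))"
proof -
  define \<beta> where "\<beta> x w = tensor_lift (\<lambda>u v. u \<otimes> (v \<otimes> w)) x"
    for x :: "('u, 'v) tensor" and w :: 'w
  have bil: "cbilinear (\<lambda>u v. u \<otimes> (v \<otimes> w))" for w :: 'w
    by (simp add: cbilinear_def clinear_iff pure_tensor_bilinear)
  have pure: "\<beta> (u \<otimes> v) w = u \<otimes> (v \<otimes> w)" for u v w
    by (simp add: \<beta>_def tensor_lift_pure[OF bil])
  have lin: "clinear (\<lambda>x. \<beta> x w)" for w
    unfolding \<beta>_def using clinear_tensor_lift[OF bil] .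
  have "\<beta> x (w + w') = \<beta> x w + \<beta> x w'" for x w w'
    by (rule tensor_clinear_eqI[of "\<lambda>x. \<beta> x (w + w')" "\<lambda>x. \<beta> x w + \<beta> x w'"])
      (use lin in \<open>simp_all add: clinear_iff pure pure_tensor_bilinear scaleC_add_right add_ac\<close>)
  moreover have "\<beta> x (c *\<^sub>C w) = c *\<^sub>C \<beta> x w" for x c w
    by (rule tensor_clinear_eqI[of "\<lambda>x. \<beta> x (c *\<^sub>C w)" "\<lambda>x. c *\<^sub>C \<beta> x w"])
      (use lin in \<open>simp_all add: clinear_iff pure pure_tensor_bilinear scaleC_add_right scaleC_scaleC mult.commute\<close>)
  ultimately have "cbilinear \<beta>" using lin by (simp add: cbilinear_def clinear_iff)
  then show ?thesis
    by (intro that[of "tensor_lift \<beta>"]) (simp_all add: clinear_tensor_lift tensor_lift_pure pure)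
qed

text \<open>
  The vacuum projection of a tensor product is \<open>P \<otimes> P\<close>. Therefore an element of the right face of
  \<open>A1\<close> acts by \<open>\<pi>1(a) \<otimes> P \<otimes> P\<close> for either bracketing of three factors, and symmetrically for the left
  face of \<open>A3\<close>.
\<close>
lemma vac_proj_tensor:
  assumes "pointed \<Omega>1 V1" "pointed \<Omega>2 V2"
  shows "vac_proj (\<Omega>1 \<otimes> \<Omega>2) (tensor_compl \<Omega>1 V1 \<Omega>2 V2) = tensor_op (vac_proj \<Omega>1 V1) (vac_proj \<Omega>2 V2)"
proof -
  obtain \<kappa>1 where \<kappa>1: "clinear \<kappa>1" "\<kappa>1 \<Omega>1 = (1::complex)" "V1 = {v. \<kappa>1 v = 0}"
    using assms(1) by (rule pointedE)
  obtain \<kappa>2 where \<kappa>2: "clinear \<kappa>2" "\<kappa>2 \<Omega>2 = (1::complex)" "V2 = {v. \<kappa>2 v = 0}"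
    using assms(2) by (rule pointedE)
  obtain \<kappa> where \<kappa>: "clinear \<kappa>" "\<And>v w. \<kappa> (v \<otimes> w) = \<kappa>1 v * \<kappa>2 w" "tensor_compl \<Omega>1 V1 \<Omega>2 V2 = {x. \<kappa> x = 0}"
    using tensor_compl_eq[OF \<kappa>1(1,2) \<kappa>2(1,2)] unfolding \<kappa>1(3) \<kappa>2(3) by blast
  have 1: "\<kappa> (\<Omega>1 \<otimes> \<Omega>2) = 1" by (simp add: \<kappa> \<kappa>1 \<kappa>2)
  show ?thesis unfolding \<kappa>(3)
    by (rule tensor_linop_eqI)
      (simp add: vac_proj_apply[OF \<kappa>(1) 1] \<kappa>(2) \<kappa>1(3) \<kappa>2(3) vac_proj_apply[OF \<kappa>1(1,2)]
        vac_proj_apply[OF \<kappa>2(1,2)] pure_tensor_bilinear scaleC_scaleC mult.commute)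
qed

text \<open>
  The associator of the tensor product intertwines the two iterated representations. For a generator
  both sides are the same elementary tensor of three operators up to bracketing:
  \<open>\<pi>1(a) \<otimes> 1 \<otimes> 1\<close>, \<open>P \<otimes> \<pi>2(a) \<otimes> 1\<close>, \<open>P \<otimes> P \<otimes> \<pi>3(a)\<close> on left faces and
  \<open>\<pi>1(a) \<otimes> P \<otimes> P\<close>, \<open>1 \<otimes> \<pi>2(a) \<otimes> P\<close>, \<open>1 \<otimes> 1 \<otimes> \<pi>3(a)\<close> on right faces.
\<close>
theorem bm_prod_assoc:
  fixes F1 :: "'a::complex_algebra faces" and F2 :: "'b::complex_algebra faces"
    and F3 :: "'c::complex_algebra faces"
  assumes F: "two_faced F1" "two_faced F2" "two_faced F3"
    and \<phi>: "clinear \<phi>1" "clinear \<phi>2" "clinear \<phi>3"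
  shows "bm_prod (fp_faces F1 F2) F3 (bm_prod F1 F2 \<phi>1 \<phi>2) \<phi>3
    = bm_prod F1 (fp_faces F2 F3) \<phi>1 (bm_prod F2 F3 \<phi>2 \<phi>3) \<circ> fp_assoc"
proof
  fix x :: "(('a, 'b) free_prod, 'c) free_prod"
  let ?V1 = "std_compl \<phi>1" and ?V2 = "std_compl \<phi>2" and ?V3 = "std_compl \<phi>3"
  let ?V12 = "tensor_compl 1 ?V1 1 ?V2" and ?V23 = "tensor_compl 1 ?V2 1 ?V3"
  let ?\<pi>12 = "bm_rep F1 F2 1 ?V1 std_rep 1 ?V2 std_rep"
  let ?\<pi>23 = "bm_rep F2 F3 1 ?V2 std_rep 1 ?V3 std_rep"
  let ?L = "bm_rep (fp_faces F1 F2) F3 (1 \<otimes> 1) ?V12 ?\<pi>12 1 ?V3 std_rep"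
  let ?R = "bm_rep F1 (fp_faces F2 F3) 1 ?V1 std_rep (1 \<otimes> 1) ?V23 ?\<pi>23"
  note r1 = represents_std_rep[OF \<phi>(1)] and r2 = represents_std_rep[OF \<phi>(2)]
    and r3 = represents_std_rep[OF \<phi>(3)]
  note F12 = two_faced_fp_faces[OF F(1,2)] and F23 = two_faced_fp_faces[OF F(2,3)]
  note \<phi>12 = clinear_bm_prod[OF F(1,2) \<phi>(1,2)] and \<phi>23 = clinear_bm_prod[OF F(2,3) \<phi>(2,3)]
  note r12 = represents_bm_rep[OF F(1,2) \<phi>(1,2) r1 r2] and r23 = represents_bm_rep[OF F(2,3) \<phi>(2,3) r2 r3]
  note rL = represents_bm_rep[OF F12 F(3) \<phi>12 \<phi>(3) r12 r3]
    and rR = represents_bm_rep[OF F(1) F23 \<phi>(1) \<phi>23 r1 r23]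
  have p: "pointed_rep 1 ?V1 std_rep" "pointed_rep 1 ?V2 std_rep" "pointed_rep 1 ?V3 std_rep"
      "pointed_rep (1 \<otimes> 1) ?V12 ?\<pi>12" "pointed_rep (1 \<otimes> 1) ?V23 ?\<pi>23"
    using r1 r2 r3 r12 r23 by (simp_all add: represents_def)
  then have pt: "pointed 1 ?V1" "pointed 1 ?V2" "pointed 1 ?V3"
    by (simp_all add: pointed_rep_def)
  note h12 = bm_rep_hom[OF F(1,2) p(1,2)] and h23 = bm_rep_hom[OF F(2,3) p(2,3)]
    and hL = bm_rep_hom[OF F12 F(3) p(4,3)] and hR = bm_rep_hom[OF F(1) F23 p(1,5)]
  obtain \<alpha> :: "(('a unitization, 'b unitization) tensor, 'c unitization) tensor
      \<Rightarrow> ('a unitization, ('b unitization, 'c unitization) tensor) tensor"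
    where \<alpha>: "clinear \<alpha>" "\<And>u v w. \<alpha> ((u \<otimes> v) \<otimes> w) = u \<otimes> (v \<otimes> w)"
    by (rule tensor_associator) (rule that)
  have intertwines_pure: "intertwines \<alpha> f g"
    if *: "\<And>u v w. \<alpha> (op_apply f ((u \<otimes> v) \<otimes> w)) = op_apply g (u \<otimes> (v \<otimes> w))" for f g
    unfolding intertwines_def
  proof
    fix x
    have pure: "\<alpha> (op_apply f (y \<otimes> w)) = op_apply g (\<alpha> (y \<otimes> w))" for y w
      by (rule tensor_clinear_eqI[of "\<lambda>y. \<alpha> (op_apply f (y \<otimes> w))" "\<lambda>y. op_apply g (\<alpha> (y \<otimes> w))"])
        (simp_all add: clinear_iff clinear_add[OF \<alpha>(1)] clinear_scale[OF \<alpha>(1)] pure_tensor_bilinear * \<alpha>(2))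
    show "\<alpha> (op_apply f x) = op_apply g (\<alpha> x)"
      by (rule tensor_clinear_eqI[of "\<lambda>x. \<alpha> (op_apply f x)" "\<lambda>x. op_apply g (\<alpha> x)"])
        (simp_all add: clinear_iff clinear_add[OF \<alpha>(1)] clinear_scale[OF \<alpha>(1)] pure)
  qed
  have assoc1: "alg_hom (fp_lift in1 (in2 \<circ> in1) :: ('a, 'b) free_prod \<Rightarrow> ('a, ('b, 'c) free_prod) free_prod)"
    and assoc2: "alg_hom (in2 \<circ> in2 :: 'c \<Rightarrow> ('a, ('b, 'c) free_prod) free_prod)"
    by (simp_all add: alg_hom_fp_lift alg_hom_comp alg_hom_in1 alg_hom_in2)
  have assoc: "alg_hom (fp_assoc :: _ \<Rightarrow> ('a, ('b, 'c) free_prod) free_prod)"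
      "\<And>a. fp_assoc (in1 (in1 a)) = (in1 a :: ('a, ('b, 'c) free_prod) free_prod)"
      "\<And>b. fp_assoc (in1 (in2 b)) = (in2 (in1 b) :: ('a, ('b, 'c) free_prod) free_prod)"
      "\<And>c. fp_assoc (in2 c) = (in2 (in2 c) :: ('a, ('b, 'c) free_prod) free_prod)"
    by (simp_all add: fp_assoc_def alg_hom_fp_lift assoc1 assoc2 alg_hom_comp alg_hom_in1 alg_hom_in2)
  define L where "L = ?L"
  define R where "R = ?R"
  have "alg_hom L" "alg_hom R" unfolding L_def R_def by (fact hL(1) hR(1))+
  then have hom: "alg_hom L" "alg_hom (R \<circ> fp_assoc)" by (blast intro: alg_hom_comp assoc(1))+
  note homs = alg_hom_comp[OF hom(1) alg_hom_in1] alg_hom_comp[OF alg_hom_comp[OF hom(1) alg_hom_in1] alg_hom_in1]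
    alg_hom_comp[OF alg_hom_comp[OF hom(1) alg_hom_in1] alg_hom_in2] alg_hom_comp[OF hom(1) alg_hom_in2]
    alg_hom_comp[OF hom(2) alg_hom_in1] alg_hom_comp[OF alg_hom_comp[OF hom(2) alg_hom_in1] alg_hom_in1]
    alg_hom_comp[OF alg_hom_comp[OF hom(2) alg_hom_in1] alg_hom_in2] alg_hom_comp[OF hom(2) alg_hom_in2]
  have faces12: "a \<in> fst F1 \<Longrightarrow> in1 a \<in> fst (fp_faces F1 F2)" "a \<in> snd F1 \<Longrightarrow> in1 a \<in> snd (fp_faces F1 F2)"
      "b \<in> fst F2 \<Longrightarrow> in2 b \<in> fst (fp_faces F1 F2)" "b \<in> snd F2 \<Longrightarrow> in2 b \<in> snd (fp_faces F1 F2)" for a b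
    by (simp_all add: fp_faces_def in_fp_sub)
  have faces23: "b \<in> fst F2 \<Longrightarrow> in1 b \<in> fst (fp_faces F2 F3)" "b \<in> snd F2 \<Longrightarrow> in1 b \<in> snd (fp_faces F2 F3)"
      "c \<in> fst F3 \<Longrightarrow> in2 c \<in> fst (fp_faces F2 F3)" "c \<in> snd F3 \<Longrightarrow> in2 c \<in> snd (fp_faces F2 F3)" for b c
    by (simp_all add: fp_faces_def in_fp_sub)
  have gen1: "intertwines \<alpha> ((L \<circ> in1 \<circ> in1) a) ((R \<circ> fp_assoc \<circ> in1 \<circ> in1) a)" for a
    by (rule intertwines_two_faced[OF F(1) \<alpha>(1) homs(2,6)]; rule intertwines_pure)
      (simp_all add: L_def R_def assoc(2-4) hL(2-5) hR(2-5) faces12 faces23 h12(2-5) h23(2-5)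
        vac_proj_tensor pt \<alpha>(2))
  have gen2: "intertwines \<alpha> ((L \<circ> in1 \<circ> in2) b) ((R \<circ> fp_assoc \<circ> in1 \<circ> in2) b)" for b
    by (rule intertwines_two_faced[OF F(2) \<alpha>(1) homs(3,7)]; rule intertwines_pure)
      (simp_all add: L_def R_def assoc(2-4) hL(2-5) hR(2-5) faces12 faces23 h12(2-5) h23(2-5)
        vac_proj_tensor pt \<alpha>(2))
  have gen3: "intertwines \<alpha> ((L \<circ> in2) c) ((R \<circ> fp_assoc \<circ> in2) c)" for c
    by (rule intertwines_two_faced[OF F(3) \<alpha>(1) homs(4,8)]; rule intertwines_pure)
      (simp_all add: L_def R_def assoc(2-4) hL(2-5) hR(2-5) faces12 faces23 h12(2-5) h23(2-5)
        vac_proj_tensor pt \<alpha>(2))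
  have gen12: "intertwines \<alpha> ((L \<circ> in1) y) ((R \<circ> fp_assoc \<circ> in1) y)" for y
    by (rule intertwines_free_prod[OF \<alpha>(1) homs(1,5)]) (use gen1 gen2 in simp_all)
  have "intertwines \<alpha> (L x) ((R \<circ> fp_assoc) x)"
    by (rule intertwines_free_prod[OF \<alpha>(1) hom]) (use gen12 gen3 in simp_all)
  then have int: "\<alpha> (op_apply (?L x) v) = op_apply (?R (fp_assoc x)) (\<alpha> v)" for v
    by (simp add: intertwines_def L_def R_def)
  obtain \<kappa>1 where \<kappa>1: "clinear \<kappa>1" "\<kappa>1 1 = (1::complex)" "?V1 = {v. \<kappa>1 v = 0}" using pt(1) by (rule pointedE)
  obtain \<kappa>2 where \<kappa>2: "clinear \<kappa>2" "\<kappa>2 1 = (1::complex)" "?V2 = {v. \<kappa>2 v = 0}" using pt(2) by (rule pointedE)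
  obtain \<kappa>3 where \<kappa>3: "clinear \<kappa>3" "\<kappa>3 1 = (1::complex)" "?V3 = {v. \<kappa>3 v = 0}" using pt(3) by (rule pointedE)
  obtain \<kappa>12 where \<kappa>12: "clinear \<kappa>12" "\<And>v w. \<kappa>12 (v \<otimes> w) = \<kappa>1 v * \<kappa>2 w" "?V12 = {x. \<kappa>12 x = 0}"
    using tensor_compl_eq[OF \<kappa>1(1,2) \<kappa>2(1,2)] unfolding \<kappa>1(3) \<kappa>2(3) by blast
  obtain \<kappa>23 where \<kappa>23: "clinear \<kappa>23" "\<And>v w. \<kappa>23 (v \<otimes> w) = \<kappa>2 v * \<kappa>3 w" "?V23 = {x. \<kappa>23 x = 0}"
    using tensor_compl_eq[OF \<kappa>2(1,2) \<kappa>3(1,2)] unfolding \<kappa>2(3) \<kappa>3(3) by blast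
  have one: "\<kappa>12 (1 \<otimes> 1) = 1" "\<kappa>23 (1 \<otimes> 1) = 1" by (simp_all add: \<kappa>12 \<kappa>23 \<kappa>1 \<kappa>2 \<kappa>3)
  obtain \<kappa>L where \<kappa>L: "clinear \<kappa>L" "\<And>v w. \<kappa>L (v \<otimes> w) = \<kappa>12 v * \<kappa>3 w"
      "tensor_compl (1 \<otimes> 1) ?V12 1 ?V3 = {x. \<kappa>L x = 0}"
    using tensor_compl_eq[OF \<kappa>12(1) one(1) \<kappa>3(1,2)] unfolding \<kappa>12(3) \<kappa>3(3) by blast
  obtain \<kappa>R where \<kappa>R: "clinear \<kappa>R" "\<And>v w. \<kappa>R (v \<otimes> w) = \<kappa>1 v * \<kappa>23 w"
      "tensor_compl 1 ?V1 (1 \<otimes> 1) ?V23 = {x. \<kappa>R x = 0}"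
    using tensor_compl_eq[OF \<kappa>1(1,2) \<kappa>23(1) one(2)] unfolding \<kappa>1(3) \<kappa>23(3) by blast
  have vac: "\<kappa>L ((1 \<otimes> 1) \<otimes> 1) = 1" "\<kappa>R (1 \<otimes> (1 \<otimes> 1)) = 1"
    by (simp_all add: \<kappa>L \<kappa>R one \<kappa>1 \<kappa>3)
  have coeff: "\<kappa>L v = \<kappa>R (\<alpha> v)" for v
  proof (rule tensor_clinear_eqI[of \<kappa>L "\<lambda>v. \<kappa>R (\<alpha> v)"])
    show "\<kappa>L (y \<otimes> w) = \<kappa>R (\<alpha> (y \<otimes> w))" for y w
      by (rule tensor_clinear_eqI[of "\<lambda>y. \<kappa>L (y \<otimes> w)" "\<lambda>y. \<kappa>R (\<alpha> (y \<otimes> w))"])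
        (simp_all add: clinear_iff pure_tensor_bilinear clinear_add[OF \<alpha>(1)] clinear_scale[OF \<alpha>(1)]
          clinear_add[OF \<kappa>L(1)] clinear_scale[OF \<kappa>L(1)] clinear_add[OF \<kappa>R(1)] clinear_scale[OF \<kappa>R(1)]
          clinear_add[OF \<kappa>12(1)] clinear_scale[OF \<kappa>12(1)] distrib_right
          \<alpha>(2) \<kappa>L(2) \<kappa>R(2) \<kappa>12(2) \<kappa>23(2))
  qed (simp_all add: clinear_iff clinear_add[OF \<alpha>(1)] clinear_scale[OF \<alpha>(1)] clinear_add[OF \<kappa>L(1)]
      clinear_scale[OF \<kappa>L(1)] clinear_add[OF \<kappa>R(1)] clinear_scale[OF \<kappa>R(1)])
  have "bm_prod (fp_faces F1 F2) F3 (bm_prod F1 F2 \<phi>1 \<phi>2) \<phi>3 x = \<kappa>L (op_apply (?L x) ((1 \<otimes> 1) \<otimes> 1))"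
    by (rule represents_coeff[OF rL[unfolded \<kappa>L(3)] \<kappa>L(1) vac(1)])
  also have "\<dots> = \<kappa>R (op_apply (?R (fp_assoc x)) (1 \<otimes> (1 \<otimes> 1)))"
    by (simp only: coeff int \<alpha>(2))
  also have "\<dots> = bm_prod F1 (fp_faces F2 F3) \<phi>1 (bm_prod F2 F3 \<phi>2 \<phi>3) (fp_assoc x)"
    by (rule represents_coeff[OF rR[unfolded \<kappa>R(3)] \<kappa>R(1) vac(2), symmetric])
  finally show "bm_prod (fp_faces F1 F2) F3 (bm_prod F1 F2 \<phi>1 \<phi>2) \<phi>3 x
    = (bm_prod F1 (fp_faces F2 F3) \<phi>1 (bm_prod F2 F3 \<phi>2 \<phi>3) \<circ> fp_assoc) x" by simp
qed

section \<open>Positive semidefinite forms and their tensor products\<close>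

definition hermitian_form :: "('v::complex_vector \<Rightarrow> 'v \<Rightarrow> complex) \<Rightarrow> bool" where
  "hermitian_form B \<longleftrightarrow> (\<forall>x. clinear (B x)) \<and> (\<forall>x y. B y x = cnj (B x y))"

definition psd_form :: "('v::complex_vector \<Rightarrow> 'v \<Rightarrow> complex) \<Rightarrow> bool" where
  "psd_form B \<longleftrightarrow> hermitian_form B \<and> (\<forall>x. B x x \<in> \<real>\<^sub>\<ge>\<^sub>0)"

lemma hermitian_form_clinear: "hermitian_form B \<Longrightarrow> clinear (B x)"
  and hermitian_form_sym: "hermitian_form B \<Longrightarrow> B y x = cnj (B x y)"
  unfolding hermitian_form_def by blast+

lemma hermitian_form_simps:
  assumes "hermitian_form B"
  shows "B x (y + z) = B x y + B x z" "B x (c *\<^sub>C y) = c * B x y" "B x 0 = 0"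
    and "B (x + y) z = B x z + B y z" "B (c *\<^sub>C x) y = cnj c * B x y" "B 0 y = 0"
proof -
  have lin: "clinear (B x)" for x using assms by (rule hermitian_form_clinear)
  have sym: "B u v = cnj (B v u)" for u v using assms by (rule hermitian_form_sym)
  show right: "B x (y + z) = B x y + B x z" "B x (c *\<^sub>C y) = c * B x y" "B x 0 = 0" for x y z c
    using lin[of x] by (simp_all add: clinear_add clinear_scale clinear_0)
  show "B (x + y) z = B x z + B y z"
    unfolding sym[of "x + y"] sym[of x] sym[of y] by (simp add: right)
  show "B (c *\<^sub>C x) y = cnj c * B x y" unfolding sym[of "c *\<^sub>C x"] sym[of x] by (simp add: right)
  show "B 0 y = 0" unfolding sym[of 0] by (simp add: right)
qed

text \<open>
  Over the complex numbers hermitian symmetry follows from \<open>B(x, x)\<close> being real for all \<open>x\<close>, by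
  polarization: \<open>x + y\<close> gives the imaginary part of the identity and \<open>x + \<i>y\<close> the real part.
\<close>
lemma psd_formI:
  assumes right: "\<And>x. clinear (B x)"
    and left: "\<And>x y z. B (x + y) z = B x z + B y z" "\<And>c x y. B (c *\<^sub>C x) y = cnj c * B x y"
    and pos: "\<And>x. B x x \<in> \<real>\<^sub>\<ge>\<^sub>0"
  shows "psd_form B"
proof -
  note [simp] = clinear_add[OF right] clinear_scale[OF right] left
  have real: "Im (B x x) = 0" for x using pos[of x] by (simp add: complex_nonneg_Reals_iff)
  have "B y x = cnj (B x y)" for x y
  proof (rule complex_eqI)
    show "Im (B y x) = Im (cnj (B x y))" using real[of "x + y"] by (simp add: real)
    show "Re (B y x) = Re (cnj (B x y))" using real[of "x + \<i> *\<^sub>C y"] by (simp add: real)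
  qed
  then show ?thesis unfolding psd_form_def hermitian_form_def using right pos by blast
qed

text \<open>
  The degenerate case of the Cauchy-Schwarz inequality: if \<open>e\<close> has length zero, then
  \<open>B(v + c e, v + c e) = B(v, v) + 2 Re (c B(v, e))\<close>, and this is nonnegative for all \<open>c\<close> only if
  \<open>B(e, v) = 0\<close>.
\<close>
lemma psd_form_null:
  assumes "psd_form B" "B e e = 0"
  shows "B e v = 0"
proof (rule ccontr)
  assume b: "B e v \<noteq> 0"
  have B: "hermitian_form B" and pos: "\<And>x. B x x \<in> \<real>\<^sub>\<ge>\<^sub>0" using assms(1) by (auto simp: psd_form_def)
  \<comment> \<open>The number \<open>c\<close> is chosen such that the form takes the value \<open>-1\<close> at \<open>v + c e\<close>.\<close>
  define t where "t = (Re (B v v) + 1) / (2 * (cmod (B e v))\<^sup>2)"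
  define c where "c = - (complex_of_real t * B e v)"
  have "B (v + c *\<^sub>C e) (v + c *\<^sub>C e) = B v v + c * cnj (B e v) + cnj c * B e v"
    by (simp add: hermitian_form_simps[OF B] assms(2) hermitian_form_sym[OF B, of v e])
  also have "\<dots> = B v v - 2 * of_real t * (B e v * cnj (B e v))"
    by (simp add: c_def algebra_simps)
  also have "\<dots> = B v v - of_real (2 * t * (cmod (B e v))\<^sup>2)"
    by (simp only: of_real_mult complex_norm_square of_real_numeral mult.assoc)
  also have "2 * t * (cmod (B e v))\<^sup>2 = Re (B v v) + 1"
    using b by (simp add: t_def)
  finally have "Re (B (v + c *\<^sub>C e) (v + c *\<^sub>C e)) = -1" by simp
  then show False using pos[of "v + c *\<^sub>C e"] by (simp add: complex_nonneg_Reals_iff)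
qed

text \<open>
  The form with \<open>\<langle>v \<otimes> w, v' \<otimes> w'\<rangle> = B1(v, v') B2(w, w')\<close>. Linear maps out of the tensor product are
  obtained from bilinear ones, so the antilinear dependence on \<open>x\<close> is obtained as the
  conjugate of the linear functional \<open>x \<mapsto> \<langle>v' \<otimes> w', x\<rangle>\<close>.
\<close>
definition tensor_form :: "('v::complex_vector \<Rightarrow> 'v \<Rightarrow> complex) \<Rightarrow> ('w::complex_vector \<Rightarrow> 'w \<Rightarrow> complex)
    \<Rightarrow> ('v, 'w) tensor \<Rightarrow> ('v, 'w) tensor \<Rightarrow> complex" where
  "tensor_form B1 B2 x y = tensor_lift (\<lambda>v' w'. cnj (tensor_lift (\<lambda>v w. B1 v' v * B2 w' w) x)) y"

lemma hermitian_tensor_form: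
  assumes B: "hermitian_form B1" "hermitian_form B2"
  shows "hermitian_form (tensor_form B1 B2)"
    and tensor_form_pure: "tensor_form B1 B2 (v \<otimes> w) (v' \<otimes> w') = B1 v v' * B2 w w'"
proof -
  note [simp] = hermitian_form_simps[OF B(1)] hermitian_form_simps[OF B(2)]
  define l where "l v' w' = tensor_lift (\<lambda>v w. B1 v' v * B2 w' w)" for v' w'
  have bil: "cbilinear (\<lambda>v w. B1 v' v * B2 w' w)" for v' w'
    by (simp add: cbilinear_def clinear_iff algebra_simps)
  have l: "clinear (l v' w')" and l_pure: "l v' w' (v \<otimes> w) = B1 v' v * B2 w' w" for v' w' v w
    by (simp_all add: l_def clinear_tensor_lift[OF bil] tensor_lift_pure[OF bil])
  note l_simps = clinear_add[OF l] clinear_scale[OF l]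
  have l_left: "l (v + v') w x = l v w x + l v' w x" "l v (w + w') x = l v w x + l v w' x"
      "l (c *\<^sub>C v) w x = cnj c * l v w x" "l v (c *\<^sub>C w) x = cnj c * l v w x" for v v' w w' c x
    by (induction x rule: tensor_induct) (simp_all add: l_pure l_simps clinear_0[OF l] algebra_simps)
  have "cbilinear (\<lambda>v' w'. cnj (l v' w' x))" for x
    by (simp add: cbilinear_def clinear_iff l_left)
  then have T: "clinear (tensor_form B1 B2 x)" and T_pure: "tensor_form B1 B2 x (v' \<otimes> w') = cnj (l v' w' x)" for x v' w'
    unfolding tensor_form_def l_def[symmetric] by (simp_all add: clinear_tensor_lift tensor_lift_pure)
  note T_simps = clinear_add[OF T] clinear_scale[OF T] clinear_0[OF T]
  show T_pures: "tensor_form B1 B2 (v \<otimes> w) (v' \<otimes> w') = B1 v v' * B2 w w'" for v w v' w'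
    by (simp add: T_pure l_pure hermitian_form_sym[OF B(1), of v' v] hermitian_form_sym[OF B(2), of w' w])
  have left: "tensor_form B1 B2 (x + x') y = tensor_form B1 B2 x y + tensor_form B1 B2 x' y"
      "tensor_form B1 B2 (c *\<^sub>C x) y = cnj c * tensor_form B1 B2 x y" "tensor_form B1 B2 0 y = 0" for x x' y c
    by (induction y rule: tensor_induct) (simp_all add: T_pure l_simps clinear_0[OF l] T_simps algebra_simps)
  have "tensor_form B1 B2 y x = cnj (tensor_form B1 B2 x y)" for x y
  proof (induction x rule: tensor_induct)
    case (pure v w)
    show ?case
      by (induction y rule: tensor_induct)
        (simp_all add: T_pures left T_simps hermitian_form_sym[OF B(1), of _ v] hermitian_form_sym[OF B(2), of _ w])
  qed (simp_all add: left T_simps)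
  then show "hermitian_form (tensor_form B1 B2)" unfolding hermitian_form_def using T by blast
qed

definition orthogonal_decomposition :: "('v::complex_vector \<Rightarrow> 'v \<Rightarrow> complex)
    \<Rightarrow> ('v, 'w::complex_vector) tensor \<Rightarrow> nat \<Rightarrow> (nat \<Rightarrow> 'v) \<Rightarrow> (nat \<Rightarrow> 'w) \<Rightarrow> bool" where
  "orthogonal_decomposition B x n e w \<longleftrightarrow> x = (\<Sum>i<n. e i \<otimes> w i)
     \<and> (\<forall>i<n. \<forall>j<n. i \<noteq> j \<longrightarrow> B (e i) (e j) = 0)"

lemma pure_tensor_sum: "(\<Sum>i\<in>I. f i) \<otimes> w = (\<Sum>i\<in>I. f i \<otimes> w)"
proof -
  have "0 \<otimes> w = 0" using pure_tensor_bilinear(3)[of 0 0 w] by simp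
  then show ?thesis
    by (induction I rule: infinite_finite_induct) (simp_all add: pure_tensor_bilinear)
qed

lemma hermitian_form_sum:
  assumes "hermitian_form B"
  shows "B x (\<Sum>i\<in>I. f i) = (\<Sum>i\<in>I. B x (f i))" "B (\<Sum>i\<in>I. f i) y = (\<Sum>i\<in>I. B (f i) y)"
  by (induction I rule: infinite_finite_induct) (simp_all add: hermitian_form_simps[OF assms])

text \<open>
  One step of the Gram-Schmidt process: the component of \<open>v\<close> in the span of the \<open>e\<^sub>i\<close> is moved into the
  second tensor factors, and the rest of \<open>v\<close> becomes a new member of the orthogonal family.
\<close>
lemma orthogonal_decomposition_add_pure:
  assumes B: "psd_form B" and x: "orthogonal_decomposition B x n e w"
  shows "\<exists>n e w. orthogonal_decomposition B (x + v \<otimes> u) n e w"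
proof -
  have H: "hermitian_form B" using B by (simp add: psd_form_def)
  from x have orth: "\<And>i j. i < n \<Longrightarrow> j < n \<Longrightarrow> i \<noteq> j \<Longrightarrow> B (e i) (e j) = 0"
    and x_eq: "x = (\<Sum>i<n. e i \<otimes> w i)" by (auto simp: orthogonal_decomposition_def)
  \<comment> \<open>If \<open>B (e i) (e i) = 0\<close>, the quotient is \<open>0\<close> by convention, which is the right coefficient as \<open>e i\<close>
    is then orthogonal to every vector.\<close>
  define c where "c i = B (e i) v / B (e i) (e i)" for i
  define p where "p = (\<Sum>i<n. c i *\<^sub>C e i)"
  have perp: "B (e i) (v - p) = 0" if "i < n" for i
  proof -
    have "B (e i) p = (\<Sum>j<n. if j = i then c i * B (e i) (e i) else 0)"
      unfolding p_def hermitian_form_sum[OF H]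
      by (intro sum.cong) (use orth that in \<open>auto simp: hermitian_form_simps[OF H]\<close>)
    also have "\<dots> = c i * B (e i) (e i)" using that by simp
    also have "\<dots> = B (e i) v" using psd_form_null[OF B, of "e i" v] by (auto simp: c_def)
    finally show ?thesis
      using hermitian_form_simps(1)[OF H, of "e i" "v - p" p] by simp
  qed
  define e' where "e' = e(n := v - p)"
  define w' where "w' i = (if i = n then u else w i + c i *\<^sub>C u)" for i
  have "v \<otimes> u = ((v - p) + p) \<otimes> u" by simp
  also have "\<dots> = (v - p) \<otimes> u + (\<Sum>i<n. c i *\<^sub>C (e i \<otimes> u))"
    unfolding pure_tensor_bilinear(1) by (simp add: p_def pure_tensor_sum pure_tensor_bilinear(3))
  finally have "x + v \<otimes> u = (\<Sum>i<n. e i \<otimes> w i + c i *\<^sub>C (e i \<otimes> u)) + (v - p) \<otimes> u"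
    by (simp add: x_eq sum.distrib add_ac)
  also have "(\<Sum>i<n. e i \<otimes> w i + c i *\<^sub>C (e i \<otimes> u)) = (\<Sum>i<n. e' i \<otimes> w' i)"
    by (intro sum.cong) (auto simp: e'_def w'_def pure_tensor_bilinear)
  finally have "x + v \<otimes> u = (\<Sum>i<Suc n. e' i \<otimes> w' i)" by (simp add: e'_def w'_def)
  moreover have "B (e' i) (e' j) = 0" if "i < Suc n" "j < Suc n" "i \<noteq> j" for i j
    using that perp orth hermitian_form_sym[OF H, of "v - p"] by (auto simp: e'_def less_Suc_eq)
  ultimately show ?thesis unfolding orthogonal_decomposition_def by blast
qed

text \<open>
  The statement proved by induction on \<open>x\<close> is that adding \<open>x\<close> to a decomposable tensor gives a
  decomposable tensor, since the sum of two decomposable tensors is not visibly decomposable.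
\<close>
lemma ex_orthogonal_decomposition:
  assumes B: "psd_form B"
  shows "\<exists>n e w. orthogonal_decomposition B x n e w"
proof -
  have H: "hermitian_form B" using B by (simp add: psd_form_def)
  have scaled: "\<exists>n e w. orthogonal_decomposition B (c *\<^sub>C y) n e w"
    if "\<exists>n e w. orthogonal_decomposition B y n e w" for c y
  proof -
    obtain n e w where "orthogonal_decomposition B y n e w" using \<open>\<exists>n e w. _ n e w\<close> by blast
    then have "orthogonal_decomposition B (c *\<^sub>C y) n e (\<lambda>i. c *\<^sub>C w i)"
      by (auto simp: orthogonal_decomposition_def cvs.scale_sum_right pure_tensor_bilinear)
    then show ?thesis by blast
  qed
  have "\<exists>n e w. orthogonal_decomposition B (y + x) n e w"
    if "\<exists>n e w. orthogonal_decomposition B y n e w" for y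
    using that
  proof (induction x arbitrary: y rule: tensor_induct)
    case (pure v u)
    then show ?case using orthogonal_decomposition_add_pure[OF B] by blast
  next
    case (plus x x')
    then show ?case by (simp flip: add.assoc)
  next
    case (scale c x)
    show ?case
    proof (cases "c = 0")
      case False
      have "y + c *\<^sub>C x = c *\<^sub>C (inverse c *\<^sub>C y + x)"
        using False by (simp add: scaleC_add_right scaleC_scaleC scaleC_one)
      then show ?thesis
        using scaled[OF scale.IH[OF scaled[OF scale.prems, of "inverse c"]], of c] by simp
    qed (use scale.prems in simp)
  qed simp
  moreover have "orthogonal_decomposition B 0 0 (\<lambda>_. 0) (\<lambda>_. 0)"
    by (simp add: orthogonal_decomposition_def)
  ultimately show ?thesis by (metis add_0)
qed

text \<open>
  For an orthogonal decomposition \<open>x = \<Sum>\<^sub>i e\<^sub>i \<otimes> w\<^sub>i\<close> all mixed terms vanish and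
  \<open>\<langle>x, x\<rangle> = \<Sum>\<^sub>i B1(e\<^sub>i, e\<^sub>i) B2(w\<^sub>i, w\<^sub>i)\<close>.
\<close>
theorem psd_tensor_form:
  assumes B: "psd_form B1" "psd_form B2"
  shows "psd_form (tensor_form B1 B2)"
proof -
  have H: "hermitian_form B1" "hermitian_form B2" using B by (simp_all add: psd_form_def)
  note T = hermitian_tensor_form(1)[OF H]
  have "tensor_form B1 B2 x x \<in> \<real>\<^sub>\<ge>\<^sub>0" for x
  proof -
    obtain n e w where "orthogonal_decomposition B1 x n e w"
      using ex_orthogonal_decomposition[OF B(1)] by blast
    then have x: "x = (\<Sum>i<n. e i \<otimes> w i)"
        and orth: "\<And>i j. i < n \<Longrightarrow> j < n \<Longrightarrow> i \<noteq> j \<Longrightarrow> B1 (e i) (e j) = 0"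
      by (auto simp: orthogonal_decomposition_def)
    have "tensor_form B1 B2 x x = (\<Sum>i<n. \<Sum>j<n. B1 (e j) (e i) * B2 (w j) (w i))"
      unfolding x by (simp only: hermitian_form_sum[OF T] tensor_form_pure[OF H])
    also have "\<dots> = (\<Sum>i<n. \<Sum>j<n. if j = i then B1 (e i) (e i) * B2 (w i) (w i) else 0)"
      by (intro sum.cong) (auto simp: orth)
    also have "\<dots> = (\<Sum>i<n. B1 (e i) (e i) * B2 (w i) (w i))" by simp
    also have "\<dots> \<in> \<real>\<^sub>\<ge>\<^sub>0"
      using B unfolding psd_form_def
      by (induction n) (auto intro!: nonneg_Reals_add_I nonneg_Reals_mult_I)
    finally show ?thesis .
  qed
  then show ?thesis using T by (simp add: psd_form_def)
qed

section \<open>Adjoints\<close>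

definition adjoint_pair :: "('v::complex_vector \<Rightarrow> 'v \<Rightarrow> complex) \<Rightarrow> 'v linop \<Rightarrow> 'v linop \<Rightarrow> bool" where
  "adjoint_pair B f g \<longleftrightarrow> (\<forall>x y. B (op_apply f x) y = B x (op_apply g y))"

lemma adjoint_pair_closed:
  assumes "hermitian_form B"
  shows "adjoint_pair B 0 0" "adjoint_pair B 1 1"
    and "adjoint_pair B f f' \<Longrightarrow> adjoint_pair B g g' \<Longrightarrow> adjoint_pair B (f + g) (f' + g')"
    and "adjoint_pair B f f' \<Longrightarrow> adjoint_pair B (c *\<^sub>C f) (cnj c *\<^sub>C f')"
    and "adjoint_pair B f f' \<Longrightarrow> adjoint_pair B g g' \<Longrightarrow> adjoint_pair B (f * g) (g' * f')"
  by (simp_all add: adjoint_pair_def hermitian_form_simps[OF assms])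

lemma adjoint_pair_tensor_op:
  assumes H: "hermitian_form B1" "hermitian_form B2"
    and f: "adjoint_pair B1 f f'" and g: "adjoint_pair B2 g g'"
  shows "adjoint_pair (tensor_form B1 B2) (tensor_op f g) (tensor_op f' g')"
  unfolding adjoint_pair_def
proof (intro allI)
  fix x y
  note T = hermitian_tensor_form(1)[OF H]
  show "tensor_form B1 B2 (op_apply (tensor_op f g) x) y = tensor_form B1 B2 x (op_apply (tensor_op f' g') y)"
  proof (induction x rule: tensor_induct)
    case (pure v w)
    show ?case
      by (induction y rule: tensor_induct)
        (use f g in \<open>simp_all add: hermitian_form_simps[OF T] tensor_form_pure[OF H] adjoint_pair_def\<close>)
  qed (simp_all add: hermitian_form_simps[OF T])
qed

text \<open>
  The vacuum projection is self-adjoint if its kernel is the orthogonal complement of the vacuum;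
  this is what makes \<open>\<pi>1 \<bowtie> \<pi>2\<close> a \<open>*\<close>-representation if \<open>\<pi>1\<close> and \<open>\<pi>2\<close> are.
\<close>
lemma adjoint_pair_vac_proj:
  assumes H: "hermitian_form B" and 1: "B \<Omega> \<Omega> = 1"
  shows "adjoint_pair B (vac_proj \<Omega> {v. B \<Omega> v = 0}) (vac_proj \<Omega> {v. B \<Omega> v = 0})"
proof -
  have "clinear (B \<Omega>)" by (rule hermitian_form_clinear[OF H])
  from vac_proj_apply[OF this 1] show ?thesis
    by (simp add: adjoint_pair_def hermitian_form_simps[OF H] hermitian_form_sym[OF H, of _ \<Omega>])
qed

lemma adjoint_pair_eval:
  assumes H: "hermitian_form B" and t: "t \<in> fp_terms S T"
    and "\<And>a. a \<in> S \<Longrightarrow> adjoint_pair B (f a) (f (st1 a))"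
    and "\<And>b. b \<in> T \<Longrightarrow> adjoint_pair B (g b) (g (st2 b))"
  shows "adjoint_pair B (fp_eval f g t) (fp_eval f g (fp_term_star st1 st2 t))"
  using t by (induction t) (auto simp: assms(3,4) adjoint_pair_closed[OF H])

lemma is_star_0: "is_star st \<Longrightarrow> st 0 = 0"
  unfolding is_star_def by (metis cvs.scale_zero_left complex_cnj_zero)

lemma is_star_eval:
  "is_star st \<Longrightarrow> st (fp_eval id id t) = fp_eval id id (fp_term_star st st t)"
  by (induction t) (auto simp: is_star_def is_star_0)

lemma adjoint_pair_two_faced:
  assumes F: "two_faced_star st F" and H: "hermitian_form B" and h: "alg_hom h"
    and adj: "\<And>a. a \<in> fst F \<Longrightarrow> adjoint_pair B (h a) (h (st a))" "\<And>a. a \<in> snd F \<Longrightarrow> adjoint_pair B (h a) (h (st a))"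
  shows "adjoint_pair B (h a) (h (st a))"
proof -
  have tf: "two_faced F" and st: "is_star st" using F by (simp_all add: two_faced_star_def)
  obtain t where t: "t \<in> fp_terms (fst F) (snd F)" "a = fp_eval id id t"
    using tf by (rule two_faced_cases)
  have "adjoint_pair B (fp_eval h h t) (fp_eval h h (fp_term_star st st t))"
    by (rule adjoint_pair_eval[OF H t(1)]) (fact adj)+
  then show ?thesis by (simp add: t(2) is_star_eval[OF st] fp_eval_hom[OF h])
qed

lemma bm_rep_adjoint:
  assumes F: "two_faced_star st1 F1" "two_faced_star st2 F2"
    and H: "hermitian_form B1" "hermitian_form B2" and 1: "B1 \<Omega>1 \<Omega>1 = 1" "B2 \<Omega>2 \<Omega>2 = 1"
    and \<pi>: "alg_hom \<pi>1" "alg_hom \<pi>2"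
      "\<And>a. adjoint_pair B1 (\<pi>1 a) (\<pi>1 (st1 a))" "\<And>b. adjoint_pair B2 (\<pi>2 b) (\<pi>2 (st2 b))"
  defines "h \<equiv> bm_rep F1 F2 \<Omega>1 {v. B1 \<Omega>1 v = 0} \<pi>1 \<Omega>2 {v. B2 \<Omega>2 v = 0} \<pi>2"
  shows "adjoint_pair (tensor_form B1 B2) (h (in1 a)) (h (in1 (st1 a)))"
    and "adjoint_pair (tensor_form B1 B2) (h (in2 b)) (h (in2 (st2 b)))"
proof -
  note lin = hermitian_form_clinear[OF H(1), of \<Omega>1] hermitian_form_clinear[OF H(2), of \<Omega>2]
  have p: "pointed_rep \<Omega>1 {v. B1 \<Omega>1 v = 0} \<pi>1" "pointed_rep \<Omega>2 {v. B2 \<Omega>2 v = 0} \<pi>2"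
    using \<pi>(1,2) by (simp_all add: pointed_rep_def pointedI[OF lin(1) 1(1)] pointedI[OF lin(2) 1(2)])
  have tf: "two_faced F1" "two_faced F2" using F by (simp_all add: two_faced_star_def)
  have closed: "a \<in> fst F1 \<Longrightarrow> st1 a \<in> fst F1" "a \<in> snd F1 \<Longrightarrow> st1 a \<in> snd F1"
      "b \<in> fst F2 \<Longrightarrow> st2 b \<in> fst F2" "b \<in> snd F2 \<Longrightarrow> st2 b \<in> snd F2" for a b
    using F by (auto simp: two_faced_star_def)
  note h = bm_rep_hom[OF tf p, folded h_def]
  note adj = adjoint_pair_tensor_op[OF H] \<pi>(3,4) adjoint_pair_closed(2)[OF H(1)] adjoint_pair_closed(2)[OF H(2)]
    adjoint_pair_vac_proj[OF H(1) 1(1)] adjoint_pair_vac_proj[OF H(2) 1(2)]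
  have "adjoint_pair (tensor_form B1 B2) ((h \<circ> in1) a) ((h \<circ> in1) (st1 a))"
    by (rule adjoint_pair_two_faced[OF F(1) hermitian_tensor_form(1)[OF H] alg_hom_comp[OF h(1) alg_hom_in1]])
      (simp_all add: h closed adj)
  then show "adjoint_pair (tensor_form B1 B2) (h (in1 a)) (h (in1 (st1 a)))" by simp
  have "adjoint_pair (tensor_form B1 B2) ((h \<circ> in2) b) ((h \<circ> in2) (st2 b))"
    by (rule adjoint_pair_two_faced[OF F(2) hermitian_tensor_form(1)[OF H] alg_hom_comp[OF h(1) alg_hom_in2]])
      (simp_all add: h closed adj)
  then show "adjoint_pair (tensor_form B1 B2) (h (in2 b)) (h (in2 (st2 b)))" by simp
qed

section \<open>Positivity\<close>

text \<open>
  The star of a free product is computed on arbitrary representatives: the relations of the free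
  product are mapped to relations, with the order of factors reversed.
\<close>
lemma fp_rel_star:
  assumes st: "is_star st1" "is_star st2" and E: "\<And>a b. (a, b) \<in> E \<Longrightarrow> (st1 a, st2 b) \<in> E"
    and "fp_rel UNIV UNIV E s t"
  shows "fp_rel UNIV UNIV E (fp_term_star st1 st2 s) (fp_term_star st1 st2 t)"
  using assms(4)
proof (induction rule: fp_rel.induct)
  case (trans s t u)
  then show ?case by (blast intro: fp_rel.trans)
next
  case (mult_assoc s t u)
  show ?case by (simp add: fp_rel.sym[OF fp_rel.mult_assoc])
qed (use st E in \<open>auto simp: is_star_def intro: fp_rel.intros\<close>)

lemma ufp_star_eval:
  assumes st: "is_star st1" "is_star st2" "st1 1 = 1" "st2 1 = 1"
  shows "ufp_star st1 st2 (fp_eval uin1 uin2 t) = fp_eval uin1 uin2 (fp_term_star st1 st2 t)"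
proof -
  have "fp_rel UNIV UNIV {(1, 1)} (rep_ufree_prod (abs_ufree_prod t)) t"
    by (simp add: Quotient3_abs_rep[OF Quotient3_ufree_prod] flip: ufree_prod.abs_eq_iff)
  then have "fp_rel UNIV UNIV {(1, 1)} (fp_term_star st1 st2 (rep_ufree_prod (abs_ufree_prod t)))
      (fp_term_star st1 st2 t)"
    by (rule fp_rel_star[OF st(1,2), rotated]) (use st(3,4) in simp)
  then show ?thesis
    by (simp add: ufp_star_def abs_ufree_prod_eval[symmetric] ufree_prod.abs_eq_iff)
qed

lemma is_star_unit_star:
  assumes "is_star st"
  shows "is_star (unit_star st)" "unit_star st 1 = 1"
  using assms is_star_0[OF assms]
  by (auto simp: is_star_def unit_star_def add_ac intro!: unitization_eqI)

definition unit_lift :: "('a::complex_algebra \<Rightarrow> 'b) \<Rightarrow> 'a unitization \<Rightarrow> 'b::complex_unital_algebra" where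
  "unit_lift h x = scalar_part x *\<^sub>C 1 + h (alg_part x)"

lemma alg_hom_unit_lift: "alg_hom h \<Longrightarrow> alg_hom (unit_lift h)"
  by (simp add: alg_hom_iff unit_lift_def distrib_left distrib_right scaleC_add_left
      scaleC_add_right scaleC_scaleC mult_scaleC_left mult_scaleC_right add_ac)

lemma adjoint_pair_unit_lift:
  assumes H: "hermitian_form B" and h: "\<And>a. adjoint_pair B (h a) (h (st a))"
  shows "adjoint_pair B (unit_lift h x) (unit_lift h (unit_star st x))"
  unfolding unit_lift_def by (intro adjoint_pair_closed(3)[OF H]) (auto simp: unit_star_def h
      intro: adjoint_pair_closed(4)[OF H] adjoint_pair_closed(2)[OF H])

lemma op_apply_std_rep: "op_apply (std_rep a) x = unit_embed a * x"
  unfolding std_rep_def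
  by (subst op_apply_Abs) (simp_all add: clinear_iff distrib_left mult_scaleC_right)

text \<open>
  The construction of Gelfand, Naimark and Segal without passing to the quotient by null vectors.
  For \<open>B(x, y) = \<phi>(x\<^sup>* y)\<close> the standard representation is a \<open>*\<close>-representation, and the kernel of
  the extended functional, which is the complement of the vacuum \<open>1\<close>, is its orthogonal complement.
\<close>
lemma state_form:
  fixes \<phi> :: "'a::complex_algebra \<Rightarrow> complex"
  assumes st: "is_star st" and state: "is_state (unit_star st) (unit_ext \<phi>)"
  defines "B \<equiv> \<lambda>x y. unit_ext \<phi> (unit_star st x * y)"
  shows "psd_form B" "B 1 = unit_ext \<phi>" "B 1 1 = 1" "adjoint_pair B (std_rep a) (std_rep (st a))"
proof -
  note star = is_star_unit_star[OF st]
  have lin: "clinear (unit_ext \<phi>)" and one: "unit_ext \<phi> 1 = 1"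
    and pos: "\<And>x. unit_ext \<phi> (unit_star st x * x) \<in> \<real>\<^sub>\<ge>\<^sub>0"
    using state by (auto simp: is_state_def)
  note lin_simps = clinear_add[OF lin] clinear_scale[OF lin]
  show "psd_form B"
  proof (rule psd_formI)
    show "clinear (B x)" for x
      by (simp add: B_def clinear_iff distrib_left mult_scaleC_right lin_simps)
    show "B (x + y) z = B x z + B y z" "B (c *\<^sub>C x) y = cnj c * B x y" for x y z c
      using star(1) by (simp_all add: B_def is_star_def distrib_right mult_scaleC_left lin_simps)
    show "B x x \<in> \<real>\<^sub>\<ge>\<^sub>0" for x by (simp add: B_def pos)
  qed
  show "B 1 = unit_ext \<phi>" "B 1 1 = 1" by (simp_all add: B_def star(2) one)
  have "unit_star st (unit_embed a) = unit_embed (st a)"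
    by (rule unitization_eqI) (simp_all add: unit_star_def unit_embed_def)
  then show "adjoint_pair B (std_rep a) (std_rep (st a))"
    using star(1) by (simp add: adjoint_pair_def B_def op_apply_std_rep is_star_def mult.assoc)
qed

text \<open>
  The product representation, extended to the unital free product, is a \<open>*\<close>-representation \<open>U\<close> with
  respect to the tensor form, and the product functional is its vacuum expectation. Hence
  \<open>\<psi>(x\<^sup>* x) = \<langle>\<Omega>, U(x)\<^sup>* U(x) \<Omega>\<rangle> = \<langle>U(x) \<Omega>, U(x) \<Omega>\<rangle> \<ge> 0\<close>.
\<close>
theorem bm_prod_state:
  fixes F1 :: "'a::complex_algebra faces" and F2 :: "'b::complex_algebra faces"
  assumes F: "two_faced_star st1 F1" "two_faced_star st2 F2" and \<phi>: "clinear \<phi>1" "clinear \<phi>2"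
    and state: "is_state (unit_star st1) (unit_ext \<phi>1)" "is_state (unit_star st2) (unit_ext \<phi>2)"
  shows "is_state (ufp_star (unit_star st1) (unit_star st2)) (unit_ext (bm_prod F1 F2 \<phi>1 \<phi>2) \<circ> unit_ident)"
proof -
  have st: "is_star st1" "is_star st2" and tf: "two_faced F1" "two_faced F2"
    using F by (simp_all add: two_faced_star_def)
  define B1 where "B1 x y = unit_ext \<phi>1 (unit_star st1 x * y)" for x y
  define B2 where "B2 x y = unit_ext \<phi>2 (unit_star st2 x * y)" for x y
  have B1: "psd_form B1" "B1 1 = unit_ext \<phi>1" "B1 1 1 = 1" "\<And>a. adjoint_pair B1 (std_rep a) (std_rep (st1 a))"
    unfolding B1_def by (fact state_form[OF st(1) state(1)])+
  have B2: "psd_form B2" "B2 1 = unit_ext \<phi>2" "B2 1 1 = 1" "\<And>b. adjoint_pair B2 (std_rep b) (std_rep (st2 b))"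
    unfolding B2_def by (fact state_form[OF st(2) state(2)])+
  have H: "hermitian_form B1" "hermitian_form B2" using B1(1) B2(1) by (simp_all add: psd_form_def)
  define T where "T = tensor_form B1 B2"
  have T: "hermitian_form T" "\<And>x. T x x \<in> \<real>\<^sub>\<ge>\<^sub>0" "\<And>v w v' w'. T (v \<otimes> w) (v' \<otimes> w') = B1 v v' * B2 w w'"
    using psd_tensor_form[OF B1(1) B2(1)] tensor_form_pure[OF H] by (simp_all add: T_def psd_form_def)
  define h where "h = bm_rep F1 F2 1 (std_compl \<phi>1) std_rep 1 (std_compl \<phi>2) std_rep"
  have compl: "std_compl \<phi>1 = {v. B1 1 v = 0}" "std_compl \<phi>2 = {v. B2 1 v = 0}"
    by (simp_all add: std_compl_def B1(2) B2(2))
  have r: "represents (1 \<otimes> 1) (tensor_compl 1 (std_compl \<phi>1) 1 (std_compl \<phi>2)) h (bm_prod F1 F2 \<phi>1 \<phi>2)"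
    unfolding h_def by (rule represents_bm_rep[OF tf \<phi> represents_std_rep[OF \<phi>(1)] represents_std_rep[OF \<phi>(2)]])
  then have h: "alg_hom h" by (simp add: represents_def pointed_rep_def)
  have std: "alg_hom (std_rep :: 'a \<Rightarrow> _)" "alg_hom (std_rep :: 'b \<Rightarrow> _)"
    using represents_std_rep[OF \<phi>(1)] represents_std_rep[OF \<phi>(2)] by (simp_all add: represents_def pointed_rep_def)
  have adj: "adjoint_pair T (h (in1 a)) (h (in1 (st1 a)))" "adjoint_pair T (h (in2 b)) (h (in2 (st2 b)))" for a b
    unfolding T_def h_def compl by (fact bm_rep_adjoint[OF F H B1(3) B2(3) std B1(4) B2(4)])+
  obtain \<kappa> where \<kappa>: "clinear \<kappa>" "\<And>v w. \<kappa> (v \<otimes> w) = B1 1 v * B2 1 w"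
      "tensor_compl 1 (std_compl \<phi>1) 1 (std_compl \<phi>2) = {x. \<kappa> x = 0}"
    using tensor_compl_eq[OF hermitian_form_clinear[OF H(1)] B1(3) hermitian_form_clinear[OF H(2)] B2(3)]
    unfolding compl by blast
  have T_vac: "T (1 \<otimes> 1) x = \<kappa> x" for x
    by (rule tensor_clinear_eqI[OF hermitian_form_clinear[OF T(1)] \<kappa>(1)]) (simp add: T(3) \<kappa>(2))
  have vac: "\<kappa> (1 \<otimes> 1) = 1" by (simp add: \<kappa>(2) B1(3) B2(3))
  have bm: "bm_prod F1 F2 \<phi>1 \<phi>2 x = T (1 \<otimes> 1) (op_apply (h x) (1 \<otimes> 1))" for x
    unfolding T_vac by (rule represents_coeff[OF r[unfolded \<kappa>(3)] \<kappa>(1) vac])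
  define U where "U x = unit_lift h (unit_ident x)" for x
  have U: "alg_hom U"
    using alg_hom_comp[OF alg_hom_unit_lift[OF h] alg_hom_unit_ident] by (simp add: U_def[abs_def] o_def)
  have expectation: "unit_ext (bm_prod F1 F2 \<phi>1 \<phi>2) (unit_ident x) = T (1 \<otimes> 1) (op_apply (U x) (1 \<otimes> 1))" for x
    by (simp add: unit_ext_def bm U_def unit_lift_def hermitian_form_simps[OF T(1)] T(3) B1(3) B2(3))
  define star where "star = ufp_star (unit_star st1) (unit_star st2)"
  have "adjoint_pair T (unit_lift (h \<circ> in1) a) (unit_lift (h \<circ> in1) (unit_star st1 a))"
       "adjoint_pair T (unit_lift (h \<circ> in2) b) (unit_lift (h \<circ> in2) (unit_star st2 b))" for a b
    by (rule adjoint_pair_unit_lift[OF T(1)]; simp add: adj)+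
  then have U_leaf: "adjoint_pair T (U (uin1 a)) (U (uin1 (unit_star st1 a)))"
       "adjoint_pair T (U (uin2 b)) (U (uin2 (unit_star st2 b)))" for a b
    by (simp_all add: U_def unit_map_def unit_lift_def)
  have U_adj: "adjoint_pair T (U x) (U (star x))" for x
  proof -
    obtain t where x: "x = fp_eval uin1 uin2 t" by (rule ufp_cases)
    have "adjoint_pair T (fp_eval (U \<circ> uin1) (U \<circ> uin2) t)
        (fp_eval (U \<circ> uin1) (U \<circ> uin2) (fp_term_star (unit_star st1) (unit_star st2) t))"
      by (rule adjoint_pair_eval[OF T(1), of _ UNIV UNIV]) (simp_all add: U_leaf)
    then show ?thesis
      by (simp add: x star_def ufp_star_eval is_star_unit_star st fp_eval_hom[OF U])
  qed
  have "unit_ext (bm_prod F1 F2 \<phi>1 \<phi>2) (unit_ident (star x * x)) \<in> \<real>\<^sub>\<ge>\<^sub>0" for x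
  proof -
    have "unit_ext (bm_prod F1 F2 \<phi>1 \<phi>2) (unit_ident (star x * x))
        = T (1 \<otimes> 1) (op_apply (U (star x)) (op_apply (U x) (1 \<otimes> 1)))"
      using U by (simp add: expectation alg_hom_iff)
    also have "\<dots> = T (op_apply (U x) (1 \<otimes> 1)) (op_apply (U x) (1 \<otimes> 1))"
      using U_adj[of x] by (simp add: adjoint_pair_def)
    finally show ?thesis by (simp add: T(2))
  qed
  moreover have "clinear (unit_ext (bm_prod F1 F2 \<phi>1 \<phi>2) \<circ> unit_ident)"
    using U by (simp add: clinear_iff expectation alg_hom_iff hermitian_form_simps[OF T(1)])
  moreover have "unit_ext (bm_prod F1 F2 \<phi>1 \<phi>2) (unit_ident 1) = 1"
    using clinear_0[OF clinear_bm_prod[OF tf \<phi>]] by (simp add: unit_ident_1 unit_ext_def)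
  ultimately show ?thesis by (simp add: is_state_def star_def)
qed

section \<open>The positive universal product\<close>

theorem theorem3p1:
  fixes F1 :: "'a1::complex_algebra faces" and F2 :: "'a2::complex_algebra faces"
    and F3 :: "'a3::complex_algebra faces"
    and G1 :: "'b1::complex_algebra faces" and G2 :: "'b2::complex_algebra faces"
    and \<phi>1 :: "'a1 \<Rightarrow> complex" and \<phi>2 :: "'a2 \<Rightarrow> complex" and \<phi>3 :: "'a3 \<Rightarrow> complex"
    and j1 :: "'b1 \<Rightarrow> 'a1" and j2 :: "'b2 \<Rightarrow> 'a2"
  assumes "two_faced F1" "two_faced F2" "two_faced F3" "two_faced G1" "two_faced G2"
    and "clinear \<phi>1" "clinear \<phi>2" "clinear \<phi>3"
    and "two_faced_hom G1 F1 j1" "two_faced_hom G2 F2 j2"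
  shows "(bm_prod F1 F2 \<phi>1 \<phi>2 \<circ> in1 = \<phi>1 \<and> bm_prod F1 F2 \<phi>1 \<phi>2 \<circ> in2 = \<phi>2)
    \<and> bm_prod (fp_faces F1 F2) F3 (bm_prod F1 F2 \<phi>1 \<phi>2) \<phi>3
        = bm_prod F1 (fp_faces F2 F3) \<phi>1 (bm_prod F2 F3 \<phi>2 \<phi>3) \<circ> fp_assoc
    \<and> bm_prod F1 F2 \<phi>1 \<phi>2 \<circ> fp_map j1 j2 = bm_prod G1 G2 (\<phi>1 \<circ> j1) (\<phi>2 \<circ> j2)
    \<and> (\<forall>st1 st2. two_faced_star st1 F1 \<and> two_faced_star st2 F2
          \<and> is_state (unit_star st1) (unit_ext \<phi>1) \<and> is_state (unit_star st2) (unit_ext \<phi>2)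
        \<longrightarrow> is_state (ufp_star (unit_star st1) (unit_star st2))
              (unit_ext (bm_prod F1 F2 \<phi>1 \<phi>2) \<circ> unit_ident))"
  using bm_prod_in[OF assms(1,2,6,7)] bm_prod_assoc[OF assms(1-3,6-8)]
    bm_prod_natural[OF assms(1,2,4,5,6,7,9,10)] bm_prod_state[OF _ _ assms(6,7)] by blast

end
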